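(* Let $\mathcal M$ be an o-minimal structure expanding the real field $\mathbb R$. The following are equivalent: (i) $\mathcal M$ has complexification; (ii) $D_{\mathcal M,n}\cap C^\omega_n=C^\omega_{\mathcal M,n}$ for all $n\in\mathbb N$; (iii) Weierstraß division holds for the system $(D_{\mathcal M,n}\cap C^\omega_n)_{n\in\mathbb N}$.
   Context: "Definable" means definable in $\mathcal M$ with real parameters. $\mathbb C^n$ is identified with $\mathbb R^{2n}$ and $\mathbb R^n\subset\mathbb C^n$. A definable function on an open subset of $\mathbb C^n$ is $\mathbb C$-differentiable if it is continuous and complex differentiable in each variable separately (equivalently: definable and holomorphic). For open definable $U\subset\mathbb R^n$, a definable $f:U\to\mathbb R$ is $\mathbb R$-analytic if for every $a\in U$ there are an open neighbourhood $U_a$ of $a$ in $U$, an open $V_a\subset\mathbb C^n$ with $U_a\subset V_a$ and a definable holomorphic $F:V_a\to\mathbb C$ with $F|_{U_a}=f|_{U_a}$. $\mathcal M$ has complexification if for every $n$ and every open definable $U\subset\mathbb R^n$, every definable real analytic $f:U\to\mathbb R$ is $\mathbb R$-analytic. $D_{\mathcal M,n}$ is the ring of germs at $0\in\mathbb R^n$ of functions definable in $\mathcal M$, $C^\omega_n$ the ring of germs at $0$ of real analytic functions, and $C^\omega_{\mathcal M,n}$ the ring of germs at $0$ of definable functions that are $\mathbb R$-analytic near $0$. For a system of rings of germs $(A_n)_n$ (with $A_0=\mathbb R$), Weierstraß division holds if for every $n$, every $f\in A_n$ regular in $x_n$ of order $d$ (i.e. $\partial^k f/\partial x_n^k(0)=0$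 for $k<d$ and $\partial^d f/\partial x_n^d(0)\neq0$) and every $g\in A_n$, there are $q\in A_n$ and $r\in A_{n-1}[x_n]$ with $\deg_{x_n} r<d$ and $g=qf+r$. *)

theory Defs
  imports "HOL-Analysis.Analysis"
begin

text \<open>A structure expanding the ordered field of real numbers is given by the arities and
  interpretations of its additional function symbols (type \<open>'f\<close>) and relation
  symbols (type \<open>'r\<close>).  Formulas are in the language with a constant
  \<open>Par a\<close> for each real \<open>a\<close>, so definability is with real parameters.\<close>

record ('f, 'r) expansion_of_reals =
  fun_arity :: "'f \<Rightarrow> nat"
  fun_interp :: "'f \<Rightarrow> real list \<Rightarrow> real"
  rel_arity :: "'r \<Rightarrow> nat"
  rel_interp :: "'r \<Rightarrow> real list \<Rightarrow> bool"

datatype 'f trm =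
    Var nat
  | Par real
  | Plus "'f trm" "'f trm"
  | Times "'f trm" "'f trm"
  | Fn 'f "'f trm list"

text \<open>Bound variables are de Bruijn indices.\<close>

datatype ('f, 'r) frm =
    Eq "'f trm" "'f trm"
  | Less "'f trm" "'f trm"
  | Rel 'r "'f trm list"
  | Neg "('f, 'r) frm"
  | Conj "('f, 'r) frm" "('f, 'r) frm"
  | Exi "('f, 'r) frm"

fun eval_trm :: "('f, 'r) expansion_of_reals \<Rightarrow> (nat \<Rightarrow> real) \<Rightarrow> 'f trm \<Rightarrow> real" where
  "eval_trm M e (Var i) = e i"
| "eval_trm M e (Par a) = a"
| "eval_trm M e (Plus s t) = eval_trm M e s + eval_trm M e t"
| "eval_trm M e (Times s t) = eval_trm M e s * eval_trm M e t"
| "eval_trm M e (Fn f ts) = fun_interp M f (map (eval_trm M e) ts)"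

fun sat :: "('f, 'r) expansion_of_reals \<Rightarrow> (nat \<Rightarrow> real) \<Rightarrow> ('f, 'r) frm \<Rightarrow> bool" where
  "sat M e (Eq s t) \<longleftrightarrow> eval_trm M e s = eval_trm M e t"
| "sat M e (Less s t) \<longleftrightarrow> eval_trm M e s < eval_trm M e t"
| "sat M e (Rel R ts) \<longleftrightarrow> rel_interp M R (map (eval_trm M e) ts)"
| "sat M e (Neg \<phi>) \<longleftrightarrow> \<not> sat M e \<phi>"
| "sat M e (Conj \<phi> \<psi>) \<longleftrightarrow> sat M e \<phi> \<and> sat M e \<psi>"
| "sat M e (Exi \<phi>) \<longleftrightarrow> (\<exists>a. sat M (case_nat a e) \<phi>)"

text \<open>Arities are respected and the free variables are among the first \<open>n\<close>.\<close>

fun wf_trm :: "('f, 'r) expansion_of_reals \<Rightarrow> nat \<Rightarrow> 'f trm \<Rightarrow> bool" where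
  "wf_trm M n (Var i) \<longleftrightarrow> i < n"
| "wf_trm M n (Par a) \<longleftrightarrow> True"
| "wf_trm M n (Plus s t) \<longleftrightarrow> wf_trm M n s \<and> wf_trm M n t"
| "wf_trm M n (Times s t) \<longleftrightarrow> wf_trm M n s \<and> wf_trm M n t"
| "wf_trm M n (Fn f ts) \<longleftrightarrow> length ts = fun_arity M f \<and> (\<forall>t\<in>set ts. wf_trm M n t)"

fun wf_frm :: "('f, 'r) expansion_of_reals \<Rightarrow> nat \<Rightarrow> ('f, 'r) frm \<Rightarrow> bool" where
  "wf_frm M n (Eq s t) \<longleftrightarrow> wf_trm M n s \<and> wf_trm M n t"
| "wf_frm M n (Less s t) \<longleftrightarrow> wf_trm M n s \<and> wf_trm M n t"
| "wf_frm M n (Rel R ts) \<longleftrightarrow> length ts = rel_arity M R \<and> (\<forall>t\<in>set ts. wf_trm M n t)"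
| "wf_frm M n (Neg \<phi>) \<longleftrightarrow> wf_frm M n \<phi>"
| "wf_frm M n (Conj \<phi> \<psi>) \<longleftrightarrow> wf_frm M n \<phi> \<and> wf_frm M n \<psi>"
| "wf_frm M n (Exi \<phi>) \<longleftrightarrow> wf_frm M (Suc n) \<phi>"

text \<open>The \<open>n\<close>-tuples over a type, as functions vanishing at all indices
  \<open>\<ge> n\<close>; the coordinates \<open>x\<^sub>1, \<dots>, x\<^sub>n\<close> are \<open>x 0, \<dots>, x (n - 1)\<close>.
  Over the reals (the complex numbers) the subspace topology induced by the product topology is
  the usual topology of real (complex) \<open>n\<close>-space.  Over the natural numbers these are the
  multi-indices.\<close>

definition tuples :: "nat \<Rightarrow> (nat \<Rightarrow> 'a::zero) set" where
  "tuples n = {x. \<forall>i\<ge>n. x i = 0}"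

abbreviation open_in_space :: "nat \<Rightarrow> (nat \<Rightarrow> 'a::{zero,topological_space}) set \<Rightarrow> bool" where
  "open_in_space n U \<equiv> openin (top_of_set (tuples n)) U"

definition definable :: "('f, 'r) expansion_of_reals \<Rightarrow> nat \<Rightarrow> (nat \<Rightarrow> real) set \<Rightarrow> bool" where
  "definable M n A \<longleftrightarrow> (\<exists>\<phi>. wf_frm M n \<phi> \<and> A = {x \<in> tuples n. sat M x \<phi>})"

definition point_or_open_interval :: "real set \<Rightarrow> bool" where
  "point_or_open_interval I \<longleftrightarrow>
     (\<exists>a. I = {a}) \<or> (\<exists>a b. I = {a<..<b}) \<or> (\<exists>a. I = {a<..}) \<or> (\<exists>b. I = {..<b}) \<or> I = UNIV"

definition o_minimal :: "('f, 'r) expansion_of_reals \<Rightarrow> bool" where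
  "o_minimal M \<longleftrightarrow>
     (\<forall>A. definable M 1 A \<longrightarrow>
        (\<exists>\<I>. finite \<I> \<and> (\<forall>I\<in>\<I>. point_or_open_interval I) \<and> (\<lambda>x. x 0) ` A = \<Union>\<I>))"

text \<open>Functions are total in HOL; only their values on the given domain matter.\<close>

definition graph_on :: "nat \<Rightarrow> (nat \<Rightarrow> 'a) set \<Rightarrow> ((nat \<Rightarrow> 'a) \<Rightarrow> 'a) \<Rightarrow> (nat \<Rightarrow> 'a) set" where
  "graph_on n U f = (\<lambda>x. x(n := f x)) ` U"

definition definable_fun ::
    "('f, 'r) expansion_of_reals \<Rightarrow> nat \<Rightarrow> (nat \<Rightarrow> real) set \<Rightarrow> ((nat \<Rightarrow> real) \<Rightarrow> real) \<Rightarrow> bool" where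
  "definable_fun M n U f \<longleftrightarrow> U \<subseteq> tuples n \<and> definable M (Suc n) (graph_on n U f)"

text \<open>The identification of complex \<open>n\<close>-space with real \<open>2n\<close>-space:
  \<open>(z\<^sub>1, \<dots>, z\<^sub>n)\<close> corresponds to \<open>(Re z\<^sub>1, Im z\<^sub>1, \<dots>, Re z\<^sub>n, Im z\<^sub>n)\<close>.\<close>

definition realify :: "(nat \<Rightarrow> complex) \<Rightarrow> nat \<Rightarrow> real" where
  "realify z i = (if even i then Re (z (i div 2)) else Im (z (i div 2)))"

definition definable_cfun ::
    "('f, 'r) expansion_of_reals \<Rightarrow> nat \<Rightarrow> (nat \<Rightarrow> complex) set \<Rightarrow> ((nat \<Rightarrow> complex) \<Rightarrow> complex) \<Rightarrow> bool" where
  "definable_cfun M n V F \<longleftrightarrow>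
     V \<subseteq> tuples n \<and> definable M (2 * Suc n) (realify ` graph_on n V F)"

definition C_differentiable_on ::
    "nat \<Rightarrow> (nat \<Rightarrow> complex) set \<Rightarrow> ((nat \<Rightarrow> complex) \<Rightarrow> complex) \<Rightarrow> bool" where
  "C_differentiable_on n V F \<longleftrightarrow>
     continuous_on V F \<and>
     (\<forall>z\<in>V. \<forall>i<n. (\<lambda>w. F (z(i := w))) field_differentiable (at (z i)))"

definition real_analytic_on :: "nat \<Rightarrow> (nat \<Rightarrow> real) set \<Rightarrow> ((nat \<Rightarrow> real) \<Rightarrow> real) \<Rightarrow> bool" where
  "real_analytic_on n U f \<longleftrightarrow>
     (\<forall>a\<in>U. \<exists>W c. open_in_space n W \<and> a \<in> W \<and> W \<subseteq> U \<and>
        (\<forall>x\<in>W. ((\<lambda>\<alpha>. c \<alpha> * (\<Prod>i<n. (x i - a i) ^ \<alpha> i)) has_sum f x) (tuples n :: (nat \<Rightarrow> nat) set)))"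

definition R_analytic_on ::
    "('f, 'r) expansion_of_reals \<Rightarrow> nat \<Rightarrow> (nat \<Rightarrow> real) set \<Rightarrow> ((nat \<Rightarrow> real) \<Rightarrow> real) \<Rightarrow> bool" where
  "R_analytic_on M n U f \<longleftrightarrow>
     (\<forall>a\<in>U. \<exists>W V F. open_in_space n W \<and> a \<in> W \<and> W \<subseteq> U \<and>
        open_in_space n V \<and> (\<lambda>x. complex_of_real \<circ> x) ` W \<subseteq> V \<and>
        definable_cfun M n V F \<and> C_differentiable_on n V F \<and>
        (\<forall>x\<in>W. F (complex_of_real \<circ> x) = complex_of_real (f x)))"

definition has_complexification :: "('f, 'r) expansion_of_reals \<Rightarrow> bool" where
  "has_complexification M \<longleftrightarrow>
     (\<forall>n U f. open_in_space n U \<and> definable M n U \<and> definable_fun M n U f \<and> real_analytic_on n U f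
        \<longrightarrow> R_analytic_on M n U f)"

type_synonym germ = "((nat \<Rightarrow> real) \<Rightarrow> real) set"

definition open_nbhd0 :: "nat \<Rightarrow> (nat \<Rightarrow> real) set \<Rightarrow> bool" where
  "open_nbhd0 n U \<longleftrightarrow> open_in_space n U \<and> (\<lambda>_. 0) \<in> U"

definition germ_at0 :: "nat \<Rightarrow> ((nat \<Rightarrow> real) \<Rightarrow> real) \<Rightarrow> germ" where
  "germ_at0 n f = {g. \<exists>W. open_nbhd0 n W \<and> (\<forall>x\<in>W. g x = f x)}"

definition definable_germs :: "('f, 'r) expansion_of_reals \<Rightarrow> nat \<Rightarrow> germ set" where
  "definable_germs M n = {germ_at0 n f | f U. open_nbhd0 n U \<and> definable_fun M n U f}"

definition analytic_germs :: "nat \<Rightarrow> germ set" where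
  "analytic_germs n = {germ_at0 n f | f U. open_nbhd0 n U \<and> real_analytic_on n U f}"

definition R_analytic_germs :: "('f, 'r) expansion_of_reals \<Rightarrow> nat \<Rightarrow> germ set" where
  "R_analytic_germs M n =
     {germ_at0 n f | f U. open_nbhd0 n U \<and> definable M n U \<and> definable_fun M n U f \<and>
        R_analytic_on M n U f}"

text \<open>In real \<open>(m + 1)\<close>-space the last variable is \<open>x m\<close>, and
  \<open>x(m := 0)\<close> is the projection of \<open>x\<close> to the first \<open>m\<close> coordinates.\<close>

definition regular_of_order :: "nat \<Rightarrow> nat \<Rightarrow> ((nat \<Rightarrow> real) \<Rightarrow> real) \<Rightarrow> bool" where
  "regular_of_order m d f \<longleftrightarrow>
     (\<forall>k<d. (deriv ^^ k) (\<lambda>t. f ((\<lambda>_. 0)(m := t))) 0 = 0) \<and>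
     (deriv ^^ d) (\<lambda>t. f ((\<lambda>_. 0)(m := t))) 0 \<noteq> 0"

definition Weierstrass_division :: "(nat \<Rightarrow> germ set) \<Rightarrow> bool" where
  "Weierstrass_division A \<longleftrightarrow>
     (\<forall>m d f g. germ_at0 (Suc m) f \<in> A (Suc m) \<and> regular_of_order m d f \<and>
          germ_at0 (Suc m) g \<in> A (Suc m) \<longrightarrow>
        (\<exists>q r. germ_at0 (Suc m) q \<in> A (Suc m) \<and> (\<forall>k<d. germ_at0 m (r k) \<in> A m) \<and>
           germ_at0 (Suc m) g =
           germ_at0 (Suc m) (\<lambda>x. q x * f x + (\<Sum>k<d. r k (x(m := 0)) * x m ^ k))))"

end

theory Submission
  imports Defs "HOL-Complex_Analysis.Complex_Analysis"
begin

text \<open>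
  A continuous separately holomorphic function is expanded one variable at a time by means of the
  difference quotients \<open>(K(z) - K(z', 0)) / z\<^sub>m\<close>, which the Schwarz lemma bounds; so R-analytic
  functions are real analytic.  Translation of the base point then gives the equivalence of (i) and (ii).

  For (iii) \<open>\<Rightarrow>\<close> (ii), divide \<open>f(x + t y)\<close> by \<open>s\<^sup>2 + t\<^sup>2\<close> in the variables \<open>(x, y, s, t)\<close>, with
  remainder \<open>r\<^sub>0 + r\<^sub>1 t\<close>.  Continuing to complex \<open>t\<close> and putting \<open>t = i s\<close> gives
  \<open>f(x + i s y) = r\<^sub>0(x, y, s) + i s r\<^sub>1(x, y, s)\<close>, and a fixed small \<open>s\<close> yields a definable
  holomorphic extension of \<open>f\<close>.

  For (ii) \<open>\<Rightarrow>\<close> (iii), write the extension of \<open>f\<close> as \<open>w\<^sup>d u(w) + \<Delta>(z', w)\<close> with a unit \<open>u\<close> and \<open>\<Delta>\<close>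
  small for small \<open>z'\<close>; division by \<open>w\<^sup>d u(w)\<close> is explicit, and a geometric series takes care of
  \<open>\<Delta>\<close>.  The remainder is definable because it is the only polynomial of degree less than \<open>d\<close>
  whose difference from \<open>g\<close> is bounded by a constant times \<open>f\<close> on the complex disc.
\<close>

section \<open>Definable predicates and functions\<close>

text \<open>The obstacle is definability: contour integrals and sums of series need not be
  definable. Quotients and remainders are therefore constructed analytically and recovered
  afterwards by first-order formulas that only they satisfy.

  The bounded remainder is sought on a complex disc because zeros of f may leave the real line: for
  s \<noteq> 0 every polynomial in t is bounded by a multiple of s^2 + t^2 on a bounded real
  interval, so a real test would determine nothing. This is where a definable extension of f to
  complex points is indispensable.

  In the converse direction s^2 + t^2 is chosen because it vanishes at t = i s. The quotient drops
  out there, and what is left expresses a value at a complex point by two definable functions of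
  real points.

  The recurring factor 3 comes from the Schwarz lemma: h - h(0) is at most 2B, and division by 3B
  puts it strictly inside the unit disc. Each difference quotient thus costs 3 / radius, power
  series converge on a third of the polydisc, and (3 / \<rho>) ^ d measures how small the
  perturbation \<Delta> has to be.\<close>

fun subst_trm :: "(nat \<Rightarrow> 'f trm) \<Rightarrow> 'f trm \<Rightarrow> 'f trm" where
  "subst_trm \<sigma> (Var i) = \<sigma> i"
| "subst_trm \<sigma> (Par a) = Par a"
| "subst_trm \<sigma> (Plus s t) = Plus (subst_trm \<sigma> s) (subst_trm \<sigma> t)"
| "subst_trm \<sigma> (Times s t) = Times (subst_trm \<sigma> s) (subst_trm \<sigma> t)"
| "subst_trm \<sigma> (Fn f ts) = Fn f (map (subst_trm \<sigma>) ts)"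

definition lift_subst :: "(nat \<Rightarrow> 'f trm) \<Rightarrow> nat \<Rightarrow> 'f trm" where
  "lift_subst \<sigma> = case_nat (Var 0) (\<lambda>i. subst_trm (\<lambda>j. Var (Suc j)) (\<sigma> i))"

fun subst_frm :: "(nat \<Rightarrow> 'f trm) \<Rightarrow> ('f, 'r) frm \<Rightarrow> ('f, 'r) frm" where
  "subst_frm \<sigma> (Eq s t) = Eq (subst_trm \<sigma> s) (subst_trm \<sigma> t)"
| "subst_frm \<sigma> (Less s t) = Less (subst_trm \<sigma> s) (subst_trm \<sigma> t)"
| "subst_frm \<sigma> (Rel R ts) = Rel R (map (subst_trm \<sigma>) ts)"
| "subst_frm \<sigma> (Neg \<phi>) = Neg (subst_frm \<sigma> \<phi>)"
| "subst_frm \<sigma> (Conj \<phi> \<psi>) = Conj (subst_frm \<sigma> \<phi>) (subst_frm \<sigma> \<psi>)"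
| "subst_frm \<sigma> (Exi \<phi>) = Exi (subst_frm (lift_subst \<sigma>) \<phi>)"

lemma eval_subst_trm: "eval_trm M e (subst_trm \<sigma> t) = eval_trm M (\<lambda>i. eval_trm M e (\<sigma> i)) t"
  by (induction t) (simp_all add: comp_def cong: map_cong)

lemma eval_lift_subst:
  "(\<lambda>i. eval_trm M (case_nat a e) (lift_subst \<sigma> i)) = case_nat a (\<lambda>i. eval_trm M e (\<sigma> i))"
  by (auto simp: fun_eq_iff lift_subst_def eval_subst_trm split: nat.split)

lemma sat_subst_frm: "sat M e (subst_frm \<sigma> \<phi>) \<longleftrightarrow> sat M (\<lambda>i. eval_trm M e (\<sigma> i)) \<phi>"
proof (induction \<phi> arbitrary: \<sigma> e)
  case (Exi \<phi>)
  show ?case by (simp add: Exi.IH eval_lift_subst)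
qed (simp_all add: eval_subst_trm comp_def)

lemma wf_subst_trm:
  "wf_trm M n t \<Longrightarrow> (\<And>i. i < n \<Longrightarrow> wf_trm M k (\<sigma> i)) \<Longrightarrow> wf_trm M k (subst_trm \<sigma> t)"
  by (induction t) auto

lemma wf_subst_frm:
  "wf_frm M n \<phi> \<Longrightarrow> (\<And>i. i < n \<Longrightarrow> wf_trm M k (\<sigma> i)) \<Longrightarrow> wf_frm M k (subst_frm \<sigma> \<phi>)"
proof (induction \<phi> arbitrary: \<sigma> n k)
  case (Exi \<phi>)
  have "wf_frm M (Suc k) (subst_frm (lift_subst \<sigma>) \<phi>)"
  proof (rule Exi.IH)
    fix i assume "i < Suc n"
    then show "wf_trm M (Suc k) (lift_subst \<sigma> i)"
      by (auto simp: lift_subst_def split: nat.split intro!: wf_subst_trm[of M k] Exi.prems(2))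
  qed (use Exi.prems in simp)
  then show ?case by simp
qed (auto intro: wf_subst_trm)

lemma wf_trm_mono: "wf_trm M n t \<Longrightarrow> n \<le> k \<Longrightarrow> wf_trm M k t"
  by (induction t) auto

lemma wf_frm_mono: "wf_frm M n \<phi> \<Longrightarrow> n \<le> k \<Longrightarrow> wf_frm M k \<phi>"
  by (induction \<phi> arbitrary: n k) (auto intro: wf_trm_mono)

text \<open>Predicates and functions of the whole variable assignment; only finitely many variables can
  matter, and \<open>definable_iff_dpred\<close> recovers definability in a given number of variables.\<close>

definition dpred :: "('f, 'r) expansion_of_reals \<Rightarrow> ((nat \<Rightarrow> real) \<Rightarrow> bool) \<Rightarrow> bool" where
  "dpred M P \<longleftrightarrow> (\<exists>\<phi> n. wf_frm M n \<phi> \<and> (\<forall>e. sat M e \<phi> \<longleftrightarrow> P e))"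

text \<open>The value sits at index 0, the place of the variable bound by \<open>dpred_ex\<close>,
  so that a definable function is substituted into a predicate by quantifying over its
  value.\<close>

definition dfn :: "('f, 'r) expansion_of_reals \<Rightarrow> ((nat \<Rightarrow> real) \<Rightarrow> real) \<Rightarrow> bool" where
  "dfn M h \<longleftrightarrow> dpred M (\<lambda>e. e 0 = h (\<lambda>i. e (Suc i)))"

lemma dpred_subst_trm:
  assumes "dpred M P" and "\<And>i. \<exists>k. wf_trm M k (\<sigma> i)"
  shows "dpred M (\<lambda>e. P (\<lambda>i. eval_trm M e (\<sigma> i)))"
proof -
  obtain \<phi> n where \<phi>: "wf_frm M n \<phi>" "\<And>e. sat M e \<phi> \<longleftrightarrow> P e"
    using assms(1) by (auto simp: dpred_def)
  obtain k where k: "\<And>i. wf_trm M (k i) (\<sigma> i)" using assms(2) by metis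
  \<comment> \<open>Only the terms \<sigma> i with i < n occur in the result, so a finite sum bounds
    its variables although \<sigma> as a whole may involve infinitely many.\<close>
  have "wf_frm M (\<Sum>i<n. k i) (subst_frm \<sigma> \<phi>)"
    by (rule wf_subst_frm[OF \<phi>(1)]) (auto intro!: wf_trm_mono[OF k] member_le_sum)
  then show ?thesis unfolding dpred_def using \<phi>(2) sat_subst_frm by metis
qed

lemma dpred_rename:
  assumes "dpred M P"
  shows "dpred M (\<lambda>e. P (\<lambda>i. e (\<rho> i)))"
proof -
  have "\<exists>k. wf_trm M k (Var (\<rho> i))" for i by (auto intro: exI[of _ "Suc (\<rho> i)"])
  from dpred_subst_trm[OF assms this] show ?thesis by simp
qed

lemma dpred_truncate:
  assumes "dpred M P"
  shows "dpred M (\<lambda>e. P (\<lambda>i. if i \<in> I then e i else 0))"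
proof -
  have "\<exists>k. wf_trm M k (if i \<in> I then Var i else Par 0)" for i by (auto intro: exI[of _ "Suc i"])
  from dpred_subst_trm[OF assms this] show ?thesis by (simp add: if_distrib cong: if_cong)
qed

lemma dpred_neg: "dpred M P \<Longrightarrow> dpred M (\<lambda>e. \<not> P e)"
  unfolding dpred_def by (metis sat.simps(4) wf_frm.simps(4))

lemma dpred_conj:
  assumes "dpred M P" "dpred M Q"
  shows "dpred M (\<lambda>e. P e \<and> Q e)"
proof -
  obtain \<phi> n \<psi> k where "wf_frm M n \<phi>" "\<And>e. sat M e \<phi> \<longleftrightarrow> P e" "wf_frm M k \<psi>" "\<And>e. sat M e \<psi> \<longleftrightarrow> Q e"
    using assms by (auto simp: dpred_def)
  then show ?thesis unfolding dpred_def
    by (intro exI[of _ "Conj \<phi> \<psi>"] exI[of _ "max n k"]) (auto intro: wf_frm_mono)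
qed

lemma dpred_ex:
  assumes "dpred M (\<lambda>e. Q (e 0) (\<lambda>i. e (Suc i)))"
  shows "dpred M (\<lambda>e. \<exists>a. Q a e)"
proof -
  obtain \<phi> n where "wf_frm M n \<phi>" and s: "\<And>e. sat M e \<phi> \<longleftrightarrow> Q (e 0) (\<lambda>i. e (Suc i))"
    using assms by (auto simp: dpred_def)
  then have "wf_frm M n (Exi \<phi>)" by (auto intro: wf_frm_mono)
  moreover have "sat M e (Exi \<phi>) \<longleftrightarrow> (\<exists>a. Q a e)" for e by (simp add: s)
  ultimately show ?thesis unfolding dpred_def by blast
qed

lemma dpred_disj: "dpred M P \<Longrightarrow> dpred M Q \<Longrightarrow> dpred M (\<lambda>e. P e \<or> Q e)"
  using dpred_neg[OF dpred_conj[OF dpred_neg dpred_neg], of M P Q] by simp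

lemma dpred_imp: "dpred M P \<Longrightarrow> dpred M Q \<Longrightarrow> dpred M (\<lambda>e. P e \<longrightarrow> Q e)"
  unfolding imp_conv_disj by (intro dpred_disj dpred_neg)

lemma dpred_all: "dpred M (\<lambda>e. Q (e 0) (\<lambda>i. e (Suc i))) \<Longrightarrow> dpred M (\<lambda>e. \<forall>a. Q a e)"
  using dpred_neg[OF dpred_ex[of M "\<lambda>a e. \<not> Q a e", OF dpred_neg]] by simp

lemma dpred_True: "dpred M (\<lambda>e. True)"
  unfolding dpred_def by (intro exI[of _ "Eq (Par 0) (Par 0)"]) auto

lemma dfn_rename:
  assumes "dfn M h"
  shows "dfn M (\<lambda>e. h (\<lambda>i. e (\<rho> i)))"
  unfolding dfn_def
  using dpred_rename[OF assms[unfolded dfn_def], where \<rho> = "case_nat 0 (\<lambda>i. Suc (\<rho> i))"] by simp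

lemma dfn_var: "dfn M (\<lambda>e. e i)"
  unfolding dfn_def dpred_def by (intro exI[of _ "Eq (Var 0) (Var (Suc i))"] exI[of _ "Suc (Suc i)"]) auto

lemma dfn_const: "dfn M (\<lambda>e. a)"
  unfolding dfn_def dpred_def by (intro exI[of _ "Eq (Var 0) (Par a)"] exI[of _ 1]) auto

lemma dpred_subst:
  assumes "dpred M (\<lambda>e. Q (e 0) (\<lambda>i. e (Suc i)))" "dfn M t"
  shows "dpred M (\<lambda>e. Q (t e) e)"
proof -
  have "dpred M (\<lambda>e. \<exists>a. a = t e \<and> Q a e)"
    by (intro dpred_ex dpred_conj assms(2)[unfolded dfn_def] assms(1))
  then show ?thesis by simp
qed

lemma dpred_eq:
  assumes "dfn M s" "dfn M t"
  shows "dpred M (\<lambda>e. s e = t e)"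
  using dpred_subst[of M "\<lambda>a e. a = t e", OF assms(2)[unfolded dfn_def] assms(1)] .

lemma dpred_subst2:
  assumes "dpred M (\<lambda>e. Q (e 0) (e 1))" "dfn M s" "dfn M t"
  shows "dpred M (\<lambda>e. Q (s e) (t e))"
proof (rule dpred_subst[OF _ assms(2), of "\<lambda>a e. Q a (t e)"])
  have "dpred M (\<lambda>e. Q (e 1) (e 0))"
    using dpred_rename[OF assms(1), of "\<lambda>i. if i = 0 then 1 else 0"] by simp
  then show "dpred M (\<lambda>e. Q (e 0) (t (\<lambda>i. e (Suc i))))"
    using dpred_subst[of M "\<lambda>a e. Q (e 0) a", OF _ dfn_rename[OF assms(3), of Suc]] by simp
qed

lemma dpred_less: "dfn M s \<Longrightarrow> dfn M t \<Longrightarrow> dpred M (\<lambda>e. s e < t e)"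
  by (rule dpred_subst2[of M "(<)"])
    (auto simp: dpred_def intro!: exI[of _ "Less (Var 0) (Var 1)"] exI[of _ 2])

lemma dpred_le: "dfn M s \<Longrightarrow> dfn M t \<Longrightarrow> dpred M (\<lambda>e. s e \<le> t e)"
  unfolding not_less[symmetric] by (intro dpred_neg dpred_less)

lemma dfn_binary:
  assumes "dpred M (\<lambda>e. e 0 = Q (e 1) (e 2))" "dfn M s" "dfn M t"
  shows "dfn M (\<lambda>e. Q (s e) (t e))"
  unfolding dfn_def
proof (rule dpred_subst[of M "\<lambda>a e. e 0 = Q a (t (\<lambda>i. e (Suc i)))"])
  have "dpred M (\<lambda>e. e 2 = Q (e 1) (e 0))"
    using dpred_rename[OF assms(1), of "\<lambda>i. if i = 0 then 2 else if i = 1 then 1 else 0"] by simp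
  then show "dpred M (\<lambda>e. e (Suc 0) = Q (e 0) (t (\<lambda>i. e (Suc (Suc i)))))"
    using dpred_subst[of M "\<lambda>a e. e 1 = Q (e 0) a", OF _ dfn_rename[OF assms(3), of "\<lambda>i. Suc (Suc i)"]]
    by (simp add: numeral_2_eq_2)
qed (rule dfn_rename[OF assms(2)])

lemma dfn_add: "dfn M s \<Longrightarrow> dfn M t \<Longrightarrow> dfn M (\<lambda>e. s e + t e)"
  by (rule dfn_binary)
    (auto simp: dpred_def intro!: exI[of _ "Eq (Var 0) (Plus (Var 1) (Var 2))"] exI[of _ 3])

lemma dfn_mult: "dfn M s \<Longrightarrow> dfn M t \<Longrightarrow> dfn M (\<lambda>e. s e * t e)"
  by (rule dfn_binary)
    (auto simp: dpred_def intro!: exI[of _ "Eq (Var 0) (Times (Var 1) (Var 2))"] exI[of _ 3])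

lemma dfn_minus: "dfn M s \<Longrightarrow> dfn M (\<lambda>e. - s e)"
  using dfn_mult[OF dfn_const[of M "-1"], of s] by simp

lemma dfn_diff: "dfn M s \<Longrightarrow> dfn M t \<Longrightarrow> dfn M (\<lambda>e. s e - t e)"
  using dfn_add[OF _ dfn_minus, of M s t] by simp

lemma dfn_power: "dfn M s \<Longrightarrow> dfn M (\<lambda>e. s e ^ k)"
  by (induction k) (auto intro: dfn_mult dfn_const)

lemma dfn_sum: "(\<And>k. k \<in> I \<Longrightarrow> dfn M (s k)) \<Longrightarrow> dfn M (\<lambda>e. \<Sum>k\<in>I. s k e)"
  by (induction I rule: infinite_finite_induct) (auto intro: dfn_add dfn_const)

lemma dfn_if:
  assumes "dpred M P" "dfn M s" "dfn M t"
  shows "dfn M (\<lambda>e. if P e then s e else t e)"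
proof -
  have "dpred M (\<lambda>e. (P (\<lambda>i. e (Suc i)) \<and> e 0 = s (\<lambda>i. e (Suc i))) \<or>
     (\<not> P (\<lambda>i. e (Suc i)) \<and> e 0 = t (\<lambda>i. e (Suc i))))"
    by (intro dpred_disj dpred_conj dpred_neg dpred_rename[OF assms(1), of Suc] assms(2,3)[unfolded dfn_def])
  then show ?thesis unfolding dfn_def by (rule back_subst[of "dpred M"]) auto
qed

lemma dfn_abs: "dfn M s \<Longrightarrow> dfn M (\<lambda>e. \<bar>s e\<bar>)"
  unfolding abs_if by (intro dfn_if dpred_less dfn_minus dfn_const)

section \<open>Finite conjunctions and blocks of variables\<close>

lemma dpred_conj_finite:
  "finite I \<Longrightarrow> (\<And>i. i \<in> I \<Longrightarrow> dpred M (P i)) \<Longrightarrow> dpred M (\<lambda>e. \<forall>i\<in>I. P i e)"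
  by (induction I rule: finite_induct) (auto intro: dpred_True dpred_conj)

text \<open>Only the first k entries of the sequence y are read, so the quantifier over sequences
  stands for k quantifiers over reals. In the induction the last entry of the block is bound by the
  outermost quantifier and reaches the inner formula as its first parameter.\<close>

lemma dpred_ex_block:
  assumes "dpred M P"
  shows "dpred M (\<lambda>e. \<exists>y. P (\<lambda>i. if i < k then y i else e (i - k)))"
  using assms
proof (induction k arbitrary: P)
  case 0
  then show ?case using dpred_rename[of M P "\<lambda>i. i"] by simp
next
  case (Suc k)
  have "dpred M (\<lambda>e. \<exists>a. \<exists>y. P (\<lambda>i. if i < k then y i else (case_nat a e) (i - k)))"
  proof (rule dpred_ex)
    have "case_nat (e 0) (\<lambda>i. e (Suc i)) j = e j" for e :: "nat \<Rightarrow> real" and j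
      by (auto split: nat.split)
    then show "dpred M (\<lambda>e. \<exists>y. P (\<lambda>i. if i < k then y i else case_nat (e 0) (\<lambda>i. e (Suc i)) (i - k)))"
      using Suc.IH[OF Suc.prems] by (simp cong: if_cong)
  qed
  moreover have "(\<exists>a. \<exists>y. P (\<lambda>i. if i < k then y i else (case_nat a e) (i - k))) \<longleftrightarrow>
      (\<exists>y. P (\<lambda>i. if i < Suc k then y i else e (i - Suc k)))" (is "?L \<longleftrightarrow> ?R") for e
  proof
    assume ?L
    then obtain a y where P: "P (\<lambda>i. if i < k then y i else (case_nat a e) (i - k))" by blast
    have "(\<lambda>i. if i < k then y i else (case_nat a e) (i - k)) =
        (\<lambda>i. if i < Suc k then (y(k := a)) i else e (i - Suc k))"
      by (auto simp: fun_eq_iff split: nat.split intro!: arg_cong[of _ _ e])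
    with P show ?R by metis
  next
    assume ?R
    then obtain y where P: "P (\<lambda>i. if i < Suc k then y i else e (i - Suc k))" by blast
    have "(\<lambda>i. if i < k then y i else (case_nat (y k) e) (i - k)) =
        (\<lambda>i. if i < Suc k then y i else e (i - Suc k))"
      by (auto simp: fun_eq_iff less_Suc_eq split: nat.split intro!: arg_cong[of _ _ e])
    with P show ?L by metis
  qed
  ultimately show ?case by simp
qed

text \<open>Simultaneous substitution: the new values are quantified as a block and constrained by
  equations, in which the old assignment is read with offset k so that block and parameters stay
  apart.\<close>

lemma dpred_subst_block:
  assumes "dpred M P" "\<And>i. i < k \<Longrightarrow> dfn M (t i)"
  shows "dpred M (\<lambda>e. P (\<lambda>i. if i < k then t i e else 0))"
proof -
  have "dpred M (\<lambda>e. P (\<lambda>i. if i < k then e i else 0) \<and> (\<forall>i\<in>{..<k}. e i = t i (\<lambda>j. e (k + j))))"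
  proof (rule dpred_conj)
    show "dpred M (\<lambda>e. P (\<lambda>i. if i < k then e i else 0))"
      using dpred_truncate[OF assms(1), of "{..<k}"] by simp
    have "dpred M (\<lambda>e. e i = t i (\<lambda>j. e (k + j)))" if "i < k" for i
      by (rule dpred_eq[OF dfn_var dfn_rename[OF assms(2)[OF that]]])
    then show "dpred M (\<lambda>e. \<forall>i\<in>{..<k}. e i = t i (\<lambda>j. e (k + j)))"
      by (intro dpred_conj_finite) auto
  qed
  from dpred_ex_block[OF this, of k]
  have "dpred M (\<lambda>e. \<exists>y. P (\<lambda>i. if i < k then y i else 0) \<and> (\<forall>i\<in>{..<k}. y i = t i e))"
    by (simp cong: if_cong conj_cong)
  moreover have "(\<exists>y. P (\<lambda>i. if i < k then y i else 0) \<and> (\<forall>i\<in>{..<k}. y i = t i e)) \<longleftrightarrow>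
     P (\<lambda>i. if i < k then t i e else 0)" for e
    by (auto cong: if_cong)
  ultimately show ?thesis by simp
qed

section \<open>Definable sets and definable real functions of tuples\<close>

lemma definable_iff_dpred: "definable M n A \<longleftrightarrow> (\<exists>P. dpred M P \<and> A = {x \<in> tuples n. P x})"
proof
  assume "definable M n A"
  then show "\<exists>P. dpred M P \<and> A = {x \<in> tuples n. P x}"
    unfolding definable_def dpred_def by blast
next
  assume "\<exists>P. dpred M P \<and> A = {x \<in> tuples n. P x}"
  then obtain \<phi> k where \<phi>: "wf_frm M k \<phi>" and A: "A = {x \<in> tuples n. sat M x \<phi>}"
    by (auto simp: dpred_def)
  \<comment> \<open>Variables from n on become the constant 0, which is their value on
    \<open>tuples n\<close>; the formula is then well-formed in n variables.\<close>
  let ?\<sigma> = "\<lambda>i. if i < n then Var i else Par 0 :: 'a trm"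
  have "wf_frm M n (subst_frm ?\<sigma> \<phi>)" by (rule wf_subst_frm[OF \<phi>]) auto
  moreover have "(\<lambda>i. eval_trm M x (?\<sigma> i)) = x" if "x \<in> tuples n" for x
    using that by (auto simp: tuples_def fun_eq_iff)
  ultimately show "definable M n A"
    unfolding definable_def A by (intro exI[of _ "subst_frm ?\<sigma> \<phi>"]) (auto simp: sat_subst_frm)
qed

lemma definableI: "dpred M P \<Longrightarrow> definable M n {x \<in> tuples n. P x}"
  using definable_iff_dpred by blast

text \<open>The point T e moves definably with the parameters. As a member of
  \<open>tuples n\<close> it is determined by its first n coordinates, so a block substitution into
  the defining predicate is enough.\<close>

lemma dpred_mem:
  assumes "definable M n A" "\<And>e. T e \<in> tuples n" "\<And>i. i < n \<Longrightarrow> dfn M (\<lambda>e. T e i)"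
  shows "dpred M (\<lambda>e. T e \<in> A)"
proof -
  obtain P where P: "dpred M P" and A: "A = {x \<in> tuples n. P x}"
    using assms(1) definable_iff_dpred by blast
  have "(\<lambda>i. if i < n then T e i else 0) = T e" for e
    using assms(2)[of e] by (auto simp: tuples_def fun_eq_iff)
  then have "T e \<in> A \<longleftrightarrow> P (\<lambda>i. if i < n then T e i else 0)" for e
    using assms(2) A by simp
  with dpred_subst_block[OF P, of n "\<lambda>i e. T e i"] assms(3) show ?thesis by simp
qed

lemma tuples_upd_Suc: "x \<in> tuples n \<Longrightarrow> x(n := a) \<in> tuples (Suc n)"
  by (auto simp: tuples_def)

lemma tuples_upd_0: "x \<in> tuples (Suc n) \<Longrightarrow> x(n := 0) \<in> tuples n"
  by (auto simp: tuples_def Suc_le_eq)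

text \<open>Coordinate n is 0 on \<open>tuples n\<close>, hence overwriting it by the value loses
  nothing and the argument can be read off from a point of the graph.\<close>

lemma upd_mem_graph_on:
  assumes "U \<subseteq> tuples n" "x \<in> tuples n"
  shows "x(n := a) \<in> graph_on n U f \<longleftrightarrow> x \<in> U \<and> a = f x"
proof -
  have "y = x" if "y \<in> U" "x(n := a) = y(n := b)" for y b
  proof -
    have "y n = x n" using assms that by (auto simp: tuples_def subset_iff)
    then show ?thesis using that by (metis fun_upd_triv fun_upd_upd)
  qed
  then show ?thesis unfolding graph_on_def using assms by (auto dest: fun_upd_eqD)
qed

lemma mem_graph_on:
  assumes "U \<subseteq> tuples n"
  shows "x \<in> graph_on n U f \<longleftrightarrow> x \<in> tuples (Suc n) \<and> x(n := 0) \<in> U \<and> x n = f (x(n := 0))"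
proof -
  have "graph_on n U f \<subseteq> tuples (Suc n)"
    using assms tuples_upd_Suc by (auto simp: graph_on_def)
  moreover have "x \<in> graph_on n U f \<longleftrightarrow> x(n := 0) \<in> U \<and> x n = f (x(n := 0))" if "x \<in> tuples (Suc n)"
    using upd_mem_graph_on[OF assms tuples_upd_0[OF that], of "x n" f] by simp
  ultimately show ?thesis by blast
qed

text \<open>The domain is the projection of the graph. Since \<open>dfn\<close> speaks of total
  functions, f is continued by the default value 0 outside U.\<close>

lemma dpred_dom_definable_fun:
  assumes "definable_fun M n U f" "\<And>e. T e \<in> tuples n" "\<And>i. i < n \<Longrightarrow> dfn M (\<lambda>e. T e i)"
  shows "dpred M (\<lambda>e. T e \<in> U)" "dfn M (\<lambda>e. if T e \<in> U then f (T e) else 0)"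
proof -
  have U: "U \<subseteq> tuples n" and G: "definable M (Suc n) (graph_on n U f)"
    using assms(1) by (auto simp: definable_fun_def)
  have mem: "(T e)(n := a) \<in> graph_on n U f \<longleftrightarrow> T e \<in> U \<and> a = f (T e)" for e a
    using upd_mem_graph_on[OF U assms(2)] .
  have "dfn M (\<lambda>e. ((T (\<lambda>i. e (Suc i)))(n := e 0)) i)" if "i < Suc n" for i
  proof (cases "i = n")
    case False
    then show ?thesis using that dfn_rename[OF assms(3)[of i], of Suc] by simp
  qed (simp add: dfn_var)
  then have *: "dpred M (\<lambda>e. (T (\<lambda>i. e (Suc i)))(n := e 0) \<in> graph_on n U f)"
    by (intro dpred_mem[OF G]) (auto intro: tuples_upd_Suc assms(2))
  from dpred_ex[of M "\<lambda>a e. (T e)(n := a) \<in> graph_on n U f", OF *]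
  show U: "dpred M (\<lambda>e. T e \<in> U)" by (simp add: mem)
  have "dpred M (\<lambda>e. (T (\<lambda>i. e (Suc i)))(n := e 0) \<in> graph_on n U f \<or>
      (\<not> T (\<lambda>i. e (Suc i)) \<in> U \<and> e 0 = 0))"
    by (intro dpred_disj * dpred_conj dpred_neg dpred_rename[OF U] dpred_eq dfn_var dfn_const)
  then show "dfn M (\<lambda>e. if T e \<in> U then f (T e) else 0)"
    unfolding dfn_def by (rule back_subst[of "dpred M"]) (auto simp: mem)
qed

lemma dpred_upd0: "dpred M P \<Longrightarrow> dpred M (\<lambda>e. P (e(n := 0)))"
  by (drule dpred_truncate[of _ _ "- {n}"], erule back_subst[of "dpred M"])
    (auto simp: fun_eq_iff intro!: arg_cong[of _ _ P])

lemma dfn_upd0: "dfn M h \<Longrightarrow> dfn M (\<lambda>e. h (e(n := 0)))"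
  unfolding dfn_def
  by (drule dpred_upd0[of _ _ "Suc n"]) (simp add: fun_upd_def)

lemma definable_funI:
  assumes "dpred M P" "dfn M h" "\<And>x. x \<in> tuples n \<Longrightarrow> P x \<Longrightarrow> f x = h x"
  shows "definable_fun M n {x \<in> tuples n. P x} f"
proof -
  have "dpred M (\<lambda>x. P (x(n := 0)) \<and> x n = h (x(n := 0)))"
    by (intro dpred_conj dpred_upd0 assms(1) dpred_eq dfn_var dfn_upd0 assms(2))
  moreover have "graph_on n {x \<in> tuples n. P x} f =
      {x \<in> tuples (Suc n). P (x(n := 0)) \<and> x n = h (x(n := 0))}"
    using assms(3) tuples_upd_0 by (subst set_eq_iff, subst mem_graph_on) auto
  ultimately show ?thesis
    unfolding definable_fun_def using definableI by fastforce
qed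

section \<open>Definable complex functions in real coordinates\<close>

definition unrealify :: "(nat \<Rightarrow> real) \<Rightarrow> nat \<Rightarrow> complex" where
  "unrealify y i = Complex (y (2 * i)) (y (2 * i + 1))"

lemma unrealify_realify [simp]: "unrealify (realify z) = z"
  by (auto simp: unrealify_def realify_def fun_eq_iff complex_eq_iff)

lemma realify_unrealify [simp]: "realify (unrealify y) = y"
proof
  fix i
  show "realify (unrealify y) i = y i"
    by (cases "even i") (auto simp: unrealify_def realify_def elim!: evenE oddE)
qed

lemma mem_realify_image: "y \<in> realify ` X \<longleftrightarrow> unrealify y \<in> X"
  by (metis image_iff realify_unrealify unrealify_realify)

lemma realify_mem_tuples [simp]: "realify z \<in> tuples (2 * n) \<longleftrightarrow> z \<in> tuples n"
proof
  assume "realify z \<in> tuples (2 * n)"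
  then have "realify z (2 * i) = 0 \<and> realify z (2 * i + 1) = 0" if "i \<ge> n" for i
    using that by (simp add: tuples_def)
  then show "z \<in> tuples n" by (auto simp: tuples_def realify_def complex_eq_iff)
next
  assume "z \<in> tuples n"
  moreover have "i div 2 \<ge> n" if "i \<ge> 2 * n" for i using that by auto
  ultimately show "realify z \<in> tuples (2 * n)" by (auto simp: tuples_def realify_def)
qed

lemma unrealify_upd: "unrealify (y(2 * n := a, Suc (2 * n) := b)) = (unrealify y)(n := Complex a b)"
  by (rule ext) (auto simp: unrealify_def)

lemma realify_upd: "realify (z(n := Complex a b)) = (realify z)(2 * n := a, Suc (2 * n) := b)"
  by (metis realify_unrealify unrealify_realify unrealify_upd)

lemma dpred_dom_definable_cfun:
  assumes "definable_cfun M n V F" "\<And>e. Z e \<in> tuples n"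
    "\<And>i. i < n \<Longrightarrow> dfn M (\<lambda>e. Re (Z e i))" "\<And>i. i < n \<Longrightarrow> dfn M (\<lambda>e. Im (Z e i))"
  shows "dpred M (\<lambda>e. Z e \<in> V)"
    "dfn M (\<lambda>e. Re (if Z e \<in> V then F (Z e) else 0))"
    "dfn M (\<lambda>e. Im (if Z e \<in> V then F (Z e) else 0))"
proof -
  let ?G = "realify ` graph_on n V F"
  let ?S = "\<lambda>e i. e (Suc i)"
  have V: "V \<subseteq> tuples n" and G: "definable M (2 * Suc n) ?G"
    using assms(1) by (auto simp: definable_cfun_def)
  have mem: "realify ((Z e)(n := Complex a b)) \<in> ?G \<longleftrightarrow> Z e \<in> V \<and> Complex a b = F (Z e)" for e a b
    using upd_mem_graph_on[OF V assms(2)] by (simp add: mem_realify_image)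
  \<comment> \<open>The two value coordinates are kept at arbitrary indices j and k, because the
    domain, the real part and the imaginary part quantify different ones of them.\<close>
  have *: "dpred M (\<lambda>e. realify ((Z (\<lambda>i. e (r i)))(n := Complex (e j) (e k))) \<in> ?G)" for r j k
  proof (rule dpred_mem[OF G])
    fix i assume "i < 2 * Suc n"
    then have "i div 2 < n \<or> i = 2 * n \<or> i = Suc (2 * n)" by presburger
    then consider "i div 2 < n" | "i = 2 * n" | "i = Suc (2 * n)" by blast
    then show "dfn M (\<lambda>e. realify ((Z (\<lambda>i. e (r i)))(n := Complex (e j) (e k))) i)"
    proof cases
      case 1
      then show ?thesis
        using dfn_rename[OF assms(3)[OF 1], of r] dfn_rename[OF assms(4)[OF 1], of r]
        by (cases "even i") (simp_all add: realify_def)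
    qed (simp_all add: realify_def dfn_var)
  qed (unfold realify_mem_tuples, intro tuples_upd_Suc assms(2))
  have "dpred M (\<lambda>e. \<exists>a b. realify ((Z e)(n := Complex a b)) \<in> ?G)"
    by (intro dpred_ex) (rule *)
  moreover have "(\<exists>a b. realify ((Z e)(n := Complex a b)) \<in> ?G) \<longleftrightarrow> Z e \<in> V" for e
    unfolding mem by (metis complex.collapse)
  ultimately show dV: "dpred M (\<lambda>e. Z e \<in> V)" by simp
  have dV': "dpred M (\<lambda>e. \<not> Z (?S e) \<in> V \<and> e 0 = 0)"
    by (intro dpred_conj dpred_neg dpred_rename[OF dV] dpred_eq dfn_var dfn_const)
  have "dpred M (\<lambda>e. (\<exists>b. realify ((Z (?S e))(n := Complex (e 0) b)) \<in> ?G) \<or> (\<not> Z (?S e) \<in> V \<and> e 0 = 0))"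
    by (intro dpred_disj dpred_ex dV') (rule *)
  moreover have "((\<exists>b. realify ((Z (?S e))(n := Complex (e 0) b)) \<in> ?G) \<or> (\<not> Z (?S e) \<in> V \<and> e 0 = 0)) \<longleftrightarrow>
      e 0 = Re (if Z (?S e) \<in> V then F (Z (?S e)) else 0)" for e
    unfolding mem by (auto simp: complex_eq_iff)
  ultimately show "dfn M (\<lambda>e. Re (if Z e \<in> V then F (Z e) else 0))"
    by (simp add: dfn_def)
  have "dpred M (\<lambda>e. (\<exists>b. realify ((Z (?S e))(n := Complex b (e 0))) \<in> ?G) \<or> (\<not> Z (?S e) \<in> V \<and> e 0 = 0))"
    by (intro dpred_disj dpred_ex dV') (rule *)
  moreover have "((\<exists>b. realify ((Z (?S e))(n := Complex b (e 0))) \<in> ?G) \<or> (\<not> Z (?S e) \<in> V \<and> e 0 = 0)) \<longleftrightarrow>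
      e 0 = Im (if Z (?S e) \<in> V then F (Z (?S e)) else 0)" for e
    unfolding mem by (auto simp: complex_eq_iff)
  ultimately show "dfn M (\<lambda>e. Im (if Z e \<in> V then F (Z e) else 0))"
    by (simp add: dfn_def)
qed

lemma definable_cfunI:
  assumes "dpred M P" "dfn M h" "dfn M k"
    "\<And>z. z \<in> tuples n \<Longrightarrow> P (realify z) \<Longrightarrow> F z = Complex (h (realify z)) (k (realify z))"
  shows "definable_cfun M n {z \<in> tuples n. P (realify z)} F"
proof -
  let ?V = "{z \<in> tuples n. P (realify z)}"
  let ?r = "\<lambda>x. x(2 * n := 0, Suc (2 * n) := 0) :: nat \<Rightarrow> real"
  have "dpred M (\<lambda>x. P (?r x) \<and> x (2 * n) = h (?r x) \<and> x (Suc (2 * n)) = k (?r x))"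
    by (intro dpred_conj dpred_eq dfn_var dpred_upd0[OF dpred_upd0] dfn_upd0[OF dfn_upd0] assms(1-3))
  moreover have "realify ` graph_on n ?V F =
    {x \<in> tuples (2 * Suc n). P (?r x) \<and> x (2 * n) = h (?r x) \<and> x (Suc (2 * n)) = k (?r x)}"
  proof -
    have "y \<in> realify ` graph_on n ?V F \<longleftrightarrow> y \<in> tuples (2 * Suc n) \<and>
        P (?r y) \<and> y (2 * n) = h (?r y) \<and> y (Suc (2 * n)) = k (?r y)" for y
    proof -
      let ?z = "unrealify y"
      have z: "realify (?z(n := 0)) = ?r y"
        using realify_upd[of ?z n 0 0] by (simp add: zero_complex.code)
      have "y \<in> tuples (2 * Suc n) \<longleftrightarrow> ?z \<in> tuples (Suc n)"
        using realify_mem_tuples[of ?z "Suc n"] by simp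
      moreover have "?z \<in> graph_on n ?V F \<longleftrightarrow> ?z \<in> tuples (Suc n) \<and> ?z(n := 0) \<in> ?V \<and> ?z n = F (?z(n := 0))"
        by (rule mem_graph_on) auto
      moreover have "?z n = Complex (y (2 * n)) (y (Suc (2 * n)))" by (simp add: unrealify_def)
      ultimately show ?thesis
        unfolding mem_realify_image using assms(4)[of "?z(n := 0)"] tuples_upd_0[of ?z n]
        by (auto simp: z)
    qed
    then show ?thesis by blast
  qed
  ultimately show ?thesis unfolding definable_cfun_def using definableI by fastforce
qed

section \<open>Polydiscs\<close>

definition polydisc :: "nat \<Rightarrow> (nat \<Rightarrow> real) \<Rightarrow> (nat \<Rightarrow> 'a::real_normed_vector) set" where
  "polydisc n r = {z \<in> tuples n. \<forall>i<n. norm (z i) < r i}"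

abbreviation cube :: "nat \<Rightarrow> real \<Rightarrow> (nat \<Rightarrow> 'a::real_normed_vector) set" where
  "cube n \<epsilon> \<equiv> polydisc n (\<lambda>_. \<epsilon>)"

lemma polydisc_mono: "(\<And>i. i < n \<Longrightarrow> r i \<le> s i) \<Longrightarrow> polydisc n r \<subseteq> polydisc n s"
  by (force simp: polydisc_def)

lemma polydisc_upd: "z \<in> polydisc n r \<Longrightarrow> i < n \<Longrightarrow> z(i := w) \<in> polydisc n r \<longleftrightarrow> norm w < r i"
  by (auto simp: polydisc_def tuples_def)

lemma polydisc_Suc_upd: "z \<in> polydisc n r \<Longrightarrow> norm w < r n \<Longrightarrow> z(n := w) \<in> polydisc (Suc n) r"
  by (auto simp: polydisc_def tuples_def)

lemma polydisc_Suc_upd_0: "z \<in> polydisc (Suc n) r \<Longrightarrow> z(n := 0) \<in> polydisc n r"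
  by (auto simp: polydisc_def tuples_def Suc_le_eq)

lemma polydisc_subset_Suc: "0 < r n \<Longrightarrow> polydisc n r \<subseteq> polydisc (Suc n) r"
  by (auto simp: polydisc_def tuples_def less_Suc_eq)

lemma polydisc_radius_pos: "z \<in> polydisc n r \<Longrightarrow> i < n \<Longrightarrow> 0 < r i"
  using order_le_less_trans[OF norm_ge_zero] by (auto simp: polydisc_def)

lemma zero_mem_polydisc: "(\<And>i. i < n \<Longrightarrow> 0 < r i) \<Longrightarrow> (\<lambda>_. 0) \<in> polydisc n r"
  by (auto simp: polydisc_def tuples_def)

lemma continuous_on_proj: "continuous_on S (\<lambda>z. z i :: 'a::topological_space)"
  by (rule continuous_on_subset[OF continuous_on_product_coordinates]) simp

lemma continuous_on_upd:
  fixes c :: "'a::topological_space"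
  shows "continuous_on S (\<lambda>z. z(m := c))"
proof (rule continuous_on_coordinatewise_then_product)
  fix i show "continuous_on S (\<lambda>z. (z(m := c)) i)"
    by (cases "i = m") (auto intro: continuous_on_proj)
qed

lemma open_in_space_translated_polydisc:
  fixes a :: "nat \<Rightarrow> 'a::real_normed_vector"
  shows "open_in_space n {z \<in> tuples n. \<forall>i<n. norm (z i - a i) < r i}"
proof -
  have "open (\<Inter>i<n. {z :: nat \<Rightarrow> 'a. norm (z i - a i) < r i})"
    by (intro open_INT ballI open_Collect_less continuous_intros continuous_on_proj) auto
  moreover have "{z \<in> tuples n. \<forall>i<n. norm (z i - a i) < r i} =
      tuples n \<inter> (\<Inter>i<n. {z. norm (z i - a i) < r i})" by auto
  ultimately show ?thesis using openin_open_Int by simp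
qed

lemma open_in_space_polydisc: "open_in_space n (polydisc n r)"
  using open_in_space_translated_polydisc[of n "\<lambda>_. 0" r] by (simp add: polydisc_def)

lemma open_in_space_contains_polydisc:
  fixes a :: "nat \<Rightarrow> 'a::real_normed_vector"
  assumes "open_in_space n U" "a \<in> U"
  shows "\<exists>\<epsilon>>0. \<forall>z\<in>cube n \<epsilon>. (\<lambda>i. a i + z i) \<in> U"
proof -
  obtain T where T: "open T" "U = tuples n \<inter> T" using assms(1) by (metis openin_open)
  then have "openin (product_topology (\<lambda>_. euclidean) UNIV) T" "a \<in> T"
    using assms(2) by (auto simp: open_fun_def)
  from product_topology_open_contains_basis[OF this] obtain X
    where X: "a \<in> Pi\<^sub>E UNIV X" "\<And>i. open (X i)" "Pi\<^sub>E UNIV X \<subseteq> T" by auto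
  have "\<exists>e>0. ball (a i) e \<subseteq> X i" for i
    using X(1,2) by (meson PiE_mem UNIV_I open_contains_ball)
  then obtain e where e: "\<And>i. e i > 0" "\<And>i. ball (a i) (e i) \<subseteq> X i" by metis
  \<comment> \<open>The inserted 1 keeps the set nonempty for n = 0.\<close>
  define \<epsilon> where "\<epsilon> = Min (insert 1 (e ` {..<n}))"
  have "\<epsilon> > 0" unfolding \<epsilon>_def using e(1) by (subst Min_gr_iff) auto
  moreover have "(\<lambda>i. a i + z i) \<in> U" if z: "z \<in> cube n \<epsilon>" for z
  proof -
    have a: "a \<in> tuples n" using assms(2) T(2) by auto
    \<comment> \<open>There are infinitely many factors, but from n on z vanishes and a already lies
      in the box.\<close>
    have "a i + z i \<in> X i" for i
    proof (cases "i < n")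
      case True
      then have "\<epsilon> \<le> e i" unfolding \<epsilon>_def by (intro Min_le) auto
      then have "a i + z i \<in> ball (a i) (e i)"
        using z True by (force simp: polydisc_def dist_norm)
      then show ?thesis using e(2) by blast
    next
      case False
      then show ?thesis using z X(1) by (auto simp: polydisc_def tuples_def PiE_iff)
    qed
    then have "(\<lambda>i. a i + z i) \<in> T" using X(3) by (auto simp: PiE_iff)
    moreover have "(\<lambda>i. a i + z i) \<in> tuples n" using z a by (auto simp: polydisc_def tuples_def)
    ultimately show ?thesis using T(2) by blast
  qed
  ultimately show ?thesis by blast
qed

lemma open_in_space_contains_polydisc0:
  assumes "open_in_space n U" "(\<lambda>_. 0) \<in> U"
  shows "\<exists>\<epsilon>>0. cube n \<epsilon> \<subseteq> U"
  using open_in_space_contains_polydisc[OF assms] by (auto simp: subset_iff)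

section \<open>Calculus of separately holomorphic functions\<close>

abbreviation C_diff_on :: "nat \<Rightarrow> (nat \<Rightarrow> complex) set \<Rightarrow> ((nat \<Rightarrow> complex) \<Rightarrow> complex) \<Rightarrow> bool" where
  "C_diff_on \<equiv> C_differentiable_on"

lemma C_diff_on_subset:
  "C_diff_on n V F \<Longrightarrow> W \<subseteq> V \<Longrightarrow> C_diff_on n W F"
  by (auto simp: C_differentiable_on_def intro: continuous_on_subset)

lemma C_diff_on_le: "C_diff_on n V F \<Longrightarrow> m \<le> n \<Longrightarrow> C_diff_on m V F"
  by (auto simp: C_differentiable_on_def)

lemma C_diff_on_const: "C_diff_on n V (\<lambda>_. c)"
  by (auto simp: C_differentiable_on_def)

lemma C_diff_on_add:
  "C_diff_on n V F \<Longrightarrow> C_diff_on n V G \<Longrightarrow> C_diff_on n V (\<lambda>z. F z + G z)"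
  by (auto simp: C_differentiable_on_def intro!: continuous_intros field_differentiable_add)

lemma C_diff_on_mult:
  "C_diff_on n V F \<Longrightarrow> C_diff_on n V G \<Longrightarrow> C_diff_on n V (\<lambda>z. F z * G z)"
  by (auto simp: C_differentiable_on_def intro!: continuous_intros field_differentiable_mult)

lemma C_diff_on_minus: "C_diff_on n V F \<Longrightarrow> C_diff_on n V (\<lambda>z. - F z)"
  by (auto simp: C_differentiable_on_def intro!: continuous_intros field_differentiable_minus)

lemma C_diff_on_diff:
  "C_diff_on n V F \<Longrightarrow> C_diff_on n V G \<Longrightarrow> C_diff_on n V (\<lambda>z. F z - G z)"
  by (auto simp: C_differentiable_on_def intro!: continuous_intros field_differentiable_diff)

lemma C_diff_on_sum:
  "(\<And>k. k \<in> I \<Longrightarrow> C_diff_on n V (F k)) \<Longrightarrow> C_diff_on n V (\<lambda>z. \<Sum>k\<in>I. F k z)"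
  by (induction I rule: infinite_finite_induct)
    (auto intro: C_diff_on_add C_diff_on_const)

lemma C_diff_on_holomorphic_coord:
  assumes "h holomorphic_on S" "open S" "\<And>z. z \<in> V \<Longrightarrow> z m \<in> S"
  shows "C_diff_on n V (\<lambda>z. h (z m))"
  unfolding C_differentiable_on_def
proof (intro conjI ballI allI impI)
  show "continuous_on V (\<lambda>z. h (z m))"
    by (rule continuous_on_compose2[OF holomorphic_on_imp_continuous_on[OF assms(1)]])
      (use assms(3) in \<open>auto intro: continuous_on_proj\<close>)
  fix z i assume "z \<in> V"
  then have "h field_differentiable at (z m)"
    using assms holomorphic_on_imp_differentiable_at by blast
  then show "(\<lambda>w. h ((z(i := w)) m)) field_differentiable at (z i)"
    by (cases "i = m") auto
qed

lemma C_diff_on_coord: "C_diff_on n V (\<lambda>z. z m)"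
  by (rule C_diff_on_holomorphic_coord[of "\<lambda>w. w" UNIV]) auto

lemma C_diff_on_power: "C_diff_on n V F \<Longrightarrow> C_diff_on n V (\<lambda>z. F z ^ k)"
  by (induction k) (auto intro: C_diff_on_mult C_diff_on_const)

lemma C_diff_on_line:
  assumes "C_diff_on n (polydisc n r) F" "z \<in> polydisc n r" "i < n"
  shows "(\<lambda>w. F (z(i := w))) holomorphic_on ball 0 (r i)"
proof (unfold holomorphic_on_open[OF open_ball], intro ballI)
  fix w :: complex assume "w \<in> ball 0 (r i)"
  then have "z(i := w) \<in> polydisc n r" using polydisc_upd[OF assms(2,3)] by auto
  then have "(\<lambda>v. F ((z(i := w))(i := v))) field_differentiable at ((z(i := w)) i)"
    using assms unfolding C_differentiable_on_def by blast
  then show "\<exists>f'. ((\<lambda>w. F (z(i := w))) has_field_derivative f') (at w)"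
    by (simp add: field_differentiable_def)
qed

lemma holomorphic_on_uniform_limit:
  assumes "\<forall>\<^sub>F k in G. f k holomorphic_on S" "uniform_limit S f g G" "G \<noteq> bot" "open S"
  shows "g holomorphic_on S"
proof (unfold holomorphic_on_open[OF assms(4)], intro ballI)
  fix z assume "z \<in> S"
  then obtain e where e: "e > 0" "cball z e \<subseteq> S" using assms(4) open_contains_cball by blast
  have "g holomorphic_on ball z e"
  proof (rule holomorphic_uniform_limit)
    show "\<forall>\<^sub>F k in G. continuous_on (cball z e) (f k) \<and> f k holomorphic_on ball z e"
      using assms(1) by eventually_elim
        (use e(2) in \<open>auto intro!: holomorphic_on_imp_continuous_on elim!: holomorphic_on_subset\<close>)
    show "uniform_limit (cball z e) f g G" by (rule uniform_limit_on_subset[OF assms(2) e(2)])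
  qed (use assms(3) in auto)
  then show "\<exists>f'. (g has_field_derivative f') (at z)"
    using e(1) by (simp add: holomorphic_on_open)
qed

lemma C_diff_on_uniform_limit:
  assumes f: "\<forall>\<^sub>F k in G. C_diff_on n (polydisc n r) (f k)"
    and ul: "uniform_limit (polydisc n r) f g G" and G: "G \<noteq> bot"
  shows "C_diff_on n (polydisc n r) g"
  unfolding C_differentiable_on_def
proof (intro conjI ballI allI impI)
  show "continuous_on (polydisc n r) g"
    by (rule uniform_limit_theorem[OF _ ul])
      (use f G in \<open>auto simp: C_differentiable_on_def elim: eventually_mono\<close>)
  fix z :: "nat \<Rightarrow> complex" and i assume z: "z \<in> polydisc n r" "i < n"
  have "(\<lambda>w. g (z(i := w))) holomorphic_on ball 0 (r i)"
  proof (rule holomorphic_on_uniform_limit[OF _ _ G open_ball])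
    show "\<forall>\<^sub>F k in G. (\<lambda>w. f k (z(i := w))) holomorphic_on ball 0 (r i)"
      using f by eventually_elim (rule C_diff_on_line[OF _ z])
    show "uniform_limit (ball 0 (r i)) (\<lambda>k w. f k (z(i := w))) (\<lambda>w. g (z(i := w))) G"
      by (rule uniform_limit_compose'[OF ul]) (use polydisc_upd[OF z] in auto)
  qed
  moreover have "z i \<in> ball 0 (r i)" using z by (auto simp: polydisc_def)
  ultimately show "(\<lambda>w. g (z(i := w))) field_differentiable at (z i)"
    using holomorphic_on_imp_differentiable_at by blast
qed

section \<open>Difference quotients with respect to one variable\<close>

text \<open>The rescaled function (h(\<rho> \<zeta>) - h(0)) / (3 B) fixes 0 and maps the unit disc
  into itself: the numerator is at most 2 B, and 3 B instead of 2 B gives the strict inequality of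
  the Schwarz lemma.\<close>

lemma Schwarz_bounds:
  assumes hol: "h holomorphic_on ball 0 \<rho>" and \<rho>: "\<rho> > 0"
    and B: "\<And>w. norm w < \<rho> \<Longrightarrow> norm (h w) \<le> B" "B > 0"
  shows "norm w < \<rho> \<Longrightarrow> norm (h w - h 0) \<le> 3 * B / \<rho> * norm w"
    and "norm (deriv h 0) \<le> 3 * B / \<rho>"
proof -
  define f where "f = (\<lambda>\<zeta>. (h (of_real \<rho> * \<zeta>) - h 0) / of_real (3 * B))"
  have in_ball: "norm (of_real \<rho> * \<zeta>) < \<rho>" if "norm \<zeta> < 1" for \<zeta> :: complex
    using that \<rho> by (simp add: norm_mult)
  have "(\<lambda>\<zeta>. h (of_real \<rho> * \<zeta>)) holomorphic_on ball 0 1"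
  proof (rule holomorphic_on_compose_gen[of "\<lambda>\<zeta>. of_real \<rho> * \<zeta>" "ball 0 1" h "ball 0 \<rho>", unfolded o_def])
    show "(\<lambda>\<zeta>::complex. of_real \<rho> * \<zeta>) ` ball 0 1 \<subseteq> ball 0 \<rho>"
      using \<rho> by (auto simp: norm_mult)
  qed (auto intro!: holomorphic_intros hol)
  then have f: "f holomorphic_on ball 0 1"
    unfolding f_def using B(2) by (auto intro!: holomorphic_intros)
  have f1: "norm (f \<zeta>) < 1" if "norm \<zeta> < 1" for \<zeta>
  proof -
    have "norm (h (of_real \<rho> * \<zeta>) - h 0) \<le> B + B"
      using B(1)[OF in_ball[OF that]] B(1)[of 0] \<rho> norm_triangle_ineq4 by (smt (verit) norm_zero)
    then show ?thesis unfolding f_def using B(2) by (simp add: norm_divide field_simps)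
  qed
  have f0: "f 0 = 0" by (simp add: f_def)
  have deriv: "deriv f 0 = of_real \<rho> * deriv h 0 / of_real (3 * B)"
  proof (rule DERIV_imp_deriv)
    have "(h has_field_derivative deriv h 0) (at (of_real \<rho> * 0))"
      using hol \<rho> by (auto intro!: holomorphic_derivI[of h "ball 0 \<rho>"])
    then have "((\<lambda>\<zeta>. h (of_real \<rho> * \<zeta>)) has_field_derivative deriv h 0 * of_real \<rho>) (at 0)"
      by (rule DERIV_chain'[where f = "\<lambda>\<zeta>. of_real \<rho> * \<zeta>", rotated]) (auto intro!: derivative_eq_intros)
    then show "(f has_field_derivative of_real \<rho> * deriv h 0 / of_real (3 * B)) (at 0)"
      unfolding f_def using B(2) by (auto intro!: derivative_eq_intros)
  qed
  have "norm (deriv f 0) \<le> 1"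
    by (rule Schwarz_Lemma(2)[OF f f0 f1, of 0]) auto
  then show "norm (deriv h 0) \<le> 3 * B / \<rho>"
    using B(2) \<rho> by (simp add: deriv norm_mult norm_divide field_simps)
  show "norm (h w - h 0) \<le> 3 * B / \<rho> * norm w" if "norm w < \<rho>"
  proof -
    have "norm (f (w / of_real \<rho>)) \<le> norm (w / of_real \<rho>)"
      by (rule Schwarz_Lemma(1)[OF f f0 f1]) (use that \<rho> in \<open>auto simp: norm_divide\<close>)
    then show ?thesis
      unfolding f_def using B(2) \<rho> by (simp add: norm_divide field_simps)
  qed
qed

text \<open>The derivative fills the removable singularity at z m = 0. Iteration strips off Taylor
  coefficients in the variable z m one by one.\<close>

definition diff_quot :: "nat \<Rightarrow> ((nat \<Rightarrow> complex) \<Rightarrow> complex) \<Rightarrow> (nat \<Rightarrow> complex) \<Rightarrow> complex" where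
  "diff_quot m K z =
     (if z m = 0 then deriv (\<lambda>w. K (z(m := w))) 0 else (K z - K (z(m := 0))) / z m)"

lemma diff_quot_eq: "K z = K (z(m := 0)) + z m * diff_quot m K z"
  by (cases "z m = 0") (auto simp: diff_quot_def fun_upd_idem)

lemma diff_quot_upd:
  "diff_quot m K (z(m := w)) =
     (if w = 0 then deriv (\<lambda>w. K (z(m := w))) 0 else (K (z(m := w)) - K (z(m := 0))) / (w - 0))"
  by (simp add: diff_quot_def)

lemma diff_quot_line:
  assumes "C_diff_on n (polydisc n r) K" "z \<in> polydisc n r" "m < n"
  shows "(\<lambda>w. diff_quot m K (z(m := w))) holomorphic_on ball 0 (r m)"
  unfolding diff_quot_upd
  by (rule pole_lemma[OF C_diff_on_line[OF assms]])
    (use polydisc_radius_pos[OF assms(2,3)] in simp)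

lemma diff_quot_bound:
  assumes K: "C_diff_on n (polydisc n r) K" and B: "\<And>z. z \<in> polydisc n r \<Longrightarrow> norm (K z) \<le> B" "B > 0"
    and z: "z \<in> polydisc n r" and m: "m < n"
  shows "norm (diff_quot m K z) \<le> 3 * B / r m"
proof -
  note r = polydisc_radius_pos[OF z m]
  have B': "norm (K (z(m := w))) \<le> B" if "norm w < r m" for w
    using B(1) polydisc_upd[OF z m] that by blast
  note S = Schwarz_bounds[OF C_diff_on_line[OF K z m] r B' B(2)]
  show ?thesis
  proof (cases "z m = 0")
    case True
    then show ?thesis using S(2) by (simp add: diff_quot_def)
  next
    case False
    have "norm (K (z(m := z m)) - K (z(m := 0))) \<le> 3 * B / r m * norm (z m)"
      by (rule S(1)) (use z m in \<open>auto simp: polydisc_def\<close>)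
    then show ?thesis using False by (simp add: diff_quot_def norm_divide divide_le_eq)
  qed
qed

text \<open>The Schwarz estimate is applied a second time, to the quotient with its own bound 3 B /
  \<open>r m\<close>. The resulting Lipschitz constant is uniform in the other variables, which
  controls the quotient near the hyperplane z m = 0.\<close>

lemma diff_quot_diff_bound:
  assumes K: "C_diff_on n (polydisc n r) K" and B: "\<And>z. z \<in> polydisc n r \<Longrightarrow> norm (K z) \<le> B" "B > 0"
    and z: "z \<in> polydisc n r" and m: "m < n"
  shows "norm (diff_quot m K z - diff_quot m K (z(m := 0))) \<le> 9 * B / (r m)\<^sup>2 * norm (z m)"
proof -
  note r = polydisc_radius_pos[OF z m]
  have "norm (diff_quot m K (z(m := z m)) - diff_quot m K (z(m := 0))) \<le> 3 * (3 * B / r m) / r m * norm (z m)"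
  proof (rule Schwarz_bounds(1)[OF diff_quot_line[OF K z m] r])
    show "norm (diff_quot m K (z(m := w))) \<le> 3 * B / r m" if "norm w < r m" for w
      by (rule diff_quot_bound[OF K B _ m]) (use polydisc_upd[OF z m] that in auto)
  qed (use B r z m in \<open>auto simp: polydisc_def\<close>)
  then show ?thesis by (simp add: power2_eq_square)
qed

text \<open>Off the hyperplane z m = 0 the quotient is visibly continuous and holomorphic in each
  variable, and in the direction m the singularity is removable. On the hyperplane, continuity and
  holomorphy in the other directions are inherited from nearby parallel slices z m = \<eta>, since
  the Lipschitz bound makes the convergence for \<eta> to 0 uniform.\<close>

lemma C_diff_on_diff_quot:
  assumes K: "C_diff_on n (polydisc n r) K" and B: "\<And>z. z \<in> polydisc n r \<Longrightarrow> norm (K z) \<le> B" "B > 0"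
    and m: "m < n"
  shows "C_diff_on n (polydisc n r) (diff_quot m K)"
proof -
  let ?P = "polydisc n r :: (nat \<Rightarrow> complex) set"
  let ?S = "diff_quot m K"
  have upd0: "z(m := 0) \<in> ?P" if "z \<in> ?P" for z
    using polydisc_upd[OF that m] polydisc_radius_pos[OF that m] by simp
  define c where "c = 9 * B / (r m)\<^sup>2"
  have bd: "norm (?S z - ?S (z(m := 0))) \<le> c * norm (z m)" if "z \<in> ?P" for z
    unfolding c_def by (rule diff_quot_diff_bound[OF K _ B(2) that m]) (rule B(1))
  have contK: "continuous_on ?P K" using K by (simp add: C_differentiable_on_def)
  have contK0: "continuous_on ?P (\<lambda>z. K (z(m := 0)))"
    by (rule continuous_on_compose2[OF contK continuous_on_upd]) (use upd0 in auto)
  have cont_ne: "(?S \<longlongrightarrow> ?S z) (at z within ?P)" if z: "z \<in> ?P" "z m \<noteq> 0" for z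
  proof -
    have proj: "((\<lambda>z. z m) \<longlongrightarrow> z m) (at z within ?P)"
      using continuous_on_proj[of ?P m] z(1) by (auto simp: continuous_on_def)
    have "((\<lambda>z. (K z - K (z(m := 0))) / z m) \<longlongrightarrow> (K z - K (z(m := 0))) / z m) (at z within ?P)"
      by (intro tendsto_divide tendsto_diff proj z(2))
        (use contK contK0 z(1) in \<open>auto simp: continuous_on_def\<close>)
    moreover have "\<forall>\<^sub>F z in at z within ?P. (K z - K (z(m := 0))) / z m = ?S z"
      using tendsto_imp_eventually_ne[OF proj z(2)] by eventually_elim (simp add: diff_quot_def)
    ultimately show ?thesis
      using z(2) by (auto simp: diff_quot_def[of m K z] intro: Lim_transform_eventually)
  qed
  have diff_ne: "(\<lambda>w. ?S (z(i := w))) field_differentiable at (z i)"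
    if z: "z \<in> ?P" "z m \<noteq> 0" "i < n" "i \<noteq> m" for z i
  proof -
    have "(\<lambda>w. K (z(i := w))) field_differentiable at (z i)"
      "(\<lambda>w. K ((z(m := 0))(i := w))) field_differentiable at ((z(m := 0)) i)"
      using K z upd0[of z] unfolding C_differentiable_on_def by blast+
    then have "(\<lambda>w. (K (z(i := w)) - K ((z(m := 0))(i := w))) / z m) field_differentiable at (z i)"
      using z by (intro field_differentiable_divide field_differentiable_diff) auto
    moreover have "?S (z(i := w)) = (K (z(i := w)) - K ((z(m := 0))(i := w))) / z m" for w
      using z by (simp add: diff_quot_def fun_upd_twist)
    ultimately show ?thesis by simp
  qed
  have "(?S \<longlongrightarrow> ?S z) (at z within ?P)" if z: "z \<in> ?P" for z
  proof (cases "z m = 0")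
    case False
    then show ?thesis by (rule cont_ne[OF z])
  next
    case True
    note r = polydisc_radius_pos[OF z m]
    have c: "c > 0" using B r by (simp add: c_def)
    show ?thesis
    proof (rule tendstoI)
      fix e :: real assume e: "e > 0"
      \<comment> \<open>The height \<eta> of the auxiliary slice stays inside the polydisc and makes
        each Lipschitz error at most e / 4.\<close>
      define \<eta> where "\<eta> = min (r m / 2) (e / (4 * c))"
      have \<eta>: "\<eta> > 0" "\<eta> < r m" "c * \<eta> \<le> e / 4"
        using r e c by (auto simp: \<eta>_def min_def field_simps)
      let ?u = "\<lambda>y :: nat \<Rightarrow> complex. y(m := of_real \<eta>)"
      have u: "?u y \<in> ?P" if "y \<in> ?P" for y using polydisc_upd[OF that m] \<eta> by simp
      have "continuous_on ?P (\<lambda>y. ?S (?u y))"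
      proof (rule continuous_on_compose2[of "?P \<inter> {y. y m \<noteq> 0}" ?S])
        show "continuous_on (?P \<inter> {y. y m \<noteq> 0}) ?S"
          unfolding continuous_on_def using cont_ne
          by (auto intro: tendsto_within_subset)
      qed (use u \<eta> in \<open>auto intro: continuous_on_upd\<close>)
      then have "((\<lambda>y. ?S (?u y)) \<longlongrightarrow> ?S (?u z)) (at z within ?P)"
        using z by (auto simp: continuous_on_def)
      from tendstoD[OF this, of "e / 4"] e
      have 1: "\<forall>\<^sub>F y in at z within ?P. dist (?S (?u y)) (?S (?u z)) < e / 4" by simp
      have "((\<lambda>z. z m) \<longlongrightarrow> z m) (at z within ?P)"
        using continuous_on_proj[of ?P m] z by (auto simp: continuous_on_def)
      from tendstoD[OF this \<eta>(1)] True
      have 2: "\<forall>\<^sub>F y in at z within ?P. norm (y m) < \<eta>" by simp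
      have 3: "\<forall>\<^sub>F y in at z within ?P. y \<in> ?P" by (simp add: eventually_at_filter)
      show "\<forall>\<^sub>F y in at z within ?P. dist (?S y) (?S z) < e"
        using 1 2 3
      proof eventually_elim
        case (elim y)
        have z0: "z(m := 0) = z" using True by (simp add: fun_upd_idem)
        have "norm (?S y - ?S (y(m := 0))) \<le> c * norm (y m)" using bd elim(3) by blast
        also have "\<dots> \<le> c * \<eta>" using elim(2) c by simp
        finally have a: "norm (?S y - ?S (y(m := 0))) \<le> e / 4" using \<eta>(3) by linarith
        have b: "norm (?S (?u y) - ?S (y(m := 0))) \<le> e / 4"
          using bd[OF u[OF elim(3)]] \<eta> by simp
        have d: "norm (?S (?u z) - ?S z) \<le> e / 4"
          using bd[OF u[OF z]] \<eta> z0 by simp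
        \<comment> \<open>The path from y to z runs through y(m := 0), then up to height \<eta>,
          across the slice, and down to z. Three moves are vertical and use the Lipschitz bound; the
          one across uses continuity off the hyperplane.\<close>
        have "?S y - ?S z = (?S y - ?S (y(m := 0))) - (?S (?u y) - ?S (y(m := 0))) +
            (?S (?u y) - ?S (?u z)) + (?S (?u z) - ?S z)" by simp
        then have "norm (?S y - ?S z) \<le> norm (?S y - ?S (y(m := 0))) + norm (?S (?u y) - ?S (y(m := 0))) +
            norm (?S (?u y) - ?S (?u z)) + norm (?S (?u z) - ?S z)"
          by (smt (verit) norm_triangle_ineq norm_triangle_ineq4)
        then show ?case using a b d elim(1) by (simp add: dist_norm)
      qed
    qed
  qed
  moreover have "(\<lambda>w. ?S (z(i := w))) field_differentiable at (z i)" if z: "z \<in> ?P" "i < n" for z i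
  proof -
    consider "i = m" | "i \<noteq> m" "z m \<noteq> 0" | "i \<noteq> m" "z m = 0" by blast
    then show ?thesis
    proof cases
      case 1
      have "z m \<in> ball 0 (r m)" using z(1) m by (auto simp: polydisc_def)
      then show ?thesis
        using diff_quot_line[OF K z(1) m] 1 holomorphic_on_imp_differentiable_at by blast
    next
      case 2
      then show ?thesis using diff_ne z by blast
    next
      case 3
      \<comment> \<open>The whole line in direction i lies in the hyperplane, so it is approximated
        by the parallel lines at heights \<open>\<eta> j\<close>, on which \<open>diff_ne\<close>
        applies.\<close>
      note r = polydisc_radius_pos[OF z(1) m]
      have c: "c > 0" using B r by (simp add: c_def)
      \<comment> \<open>With 2 in the denominator already \<open>\<eta> 0\<close> is strictly below
        \<open>r m\<close>.\<close>
      define \<eta> where "\<eta> = (\<lambda>j. r m / (real j + 2))"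
      have \<eta>: "0 < \<eta> j" "\<eta> j < r m" for j using r by (auto simp: \<eta>_def field_simps intro: add_pos_nonneg)
      have \<eta>_lim: "\<eta> \<longlonglongrightarrow> 0" unfolding \<eta>_def by real_asymp
      have zw: "z(i := w) \<in> ?P" if "norm w < r i" for w using polydisc_upd[OF z] that by blast
      have zwm: "(z(i := w))(m := of_real (\<eta> j)) \<in> ?P" if "norm w < r i" for w j
        using polydisc_upd[OF zw[OF that] m] \<eta>[of j] by simp
      have "(\<lambda>w. ?S (z(i := w))) holomorphic_on ball 0 (r i)"
      proof (rule holomorphic_on_uniform_limit[where G = sequentially])
        have "(\<lambda>w. ?S ((z(i := w))(m := of_real (\<eta> j)))) holomorphic_on ball 0 (r i)" for j
        proof (unfold holomorphic_on_open[OF open_ball], intro ballI)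
          fix w :: complex assume "w \<in> ball 0 (r i)"
          then have "(z(i := w))(m := of_real (\<eta> j)) \<in> ?P" using zwm by simp
          from diff_ne[OF this _ z(2) 3(1)] \<eta>[of j] 3(1)
          have "(\<lambda>v. ?S (((z(i := w))(m := of_real (\<eta> j)))(i := v))) field_differentiable at w"
            by (simp del: fun_upd_upd)
          moreover have "((z(i := w))(m := of_real (\<eta> j)))(i := v) = (z(i := v))(m := of_real (\<eta> j))" for v
            using 3(1) by auto
          ultimately show "\<exists>f'. ((\<lambda>w. ?S ((z(i := w))(m := of_real (\<eta> j)))) has_field_derivative f') (at w)"
            by (simp add: field_differentiable_def)
        qed
        then show "\<forall>\<^sub>F j in sequentially. (\<lambda>w. ?S ((z(i := w))(m := of_real (\<eta> j)))) holomorphic_on ball 0 (r i)"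
          by simp
        show "uniform_limit (ball 0 (r i)) (\<lambda>j w. ?S ((z(i := w))(m := of_real (\<eta> j)))) (\<lambda>w. ?S (z(i := w))) sequentially"
        proof (rule uniform_limitI)
          fix e :: real assume e: "e > 0"
          have "(\<lambda>j. c * \<eta> j) \<longlonglongrightarrow> 0" using tendsto_mult_right_zero[OF \<eta>_lim] .
          then have "\<forall>\<^sub>F j in sequentially. c * \<eta> j < e"
            using e by (auto dest: order_tendstoD)
          then show "\<forall>\<^sub>F j in sequentially. \<forall>w\<in>ball 0 (r i).
              dist (?S ((z(i := w))(m := of_real (\<eta> j)))) (?S (z(i := w))) < e"
          proof eventually_elim
            case (elim j)
            show ?case
            proof
              fix w :: complex assume "w \<in> ball 0 (r i)"
              then have w: "norm w < r i" by simp
              have "(z(i := w))(m := 0) = z(i := w)" using 3 by auto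
              with bd[OF zwm[OF w, of j]]
              have "norm (?S ((z(i := w))(m := of_real (\<eta> j))) - ?S (z(i := w))) \<le> c * \<eta> j"
                using \<eta>[of j] by simp
              then show "dist (?S ((z(i := w))(m := of_real (\<eta> j)))) (?S (z(i := w))) < e"
                using elim by (simp add: dist_norm)
            qed
          qed
        qed
      qed auto
      moreover have "z i \<in> ball 0 (r i)" using z by (auto simp: polydisc_def)
      ultimately show ?thesis using holomorphic_on_imp_differentiable_at by blast
    qed
  qed
  ultimately show ?thesis by (simp add: C_differentiable_on_def continuous_on_def)
qed

section \<open>Power series expansions\<close>

lemma diff_quot_iter:
  assumes "C_diff_on n (polydisc n r) K" "\<And>z. z \<in> polydisc n r \<Longrightarrow> norm (K z) \<le> B" "B > 0"
    and "m < n" "r m > 0"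
  shows "C_diff_on n (polydisc n r) ((diff_quot m ^^ k) K)"
    and "\<And>z. z \<in> polydisc n r \<Longrightarrow> norm ((diff_quot m ^^ k) K z) \<le> B * (3 / r m) ^ k"
proof -
  have "C_diff_on n (polydisc n r) ((diff_quot m ^^ k) K) \<and>
    (\<forall>z\<in>polydisc n r. norm ((diff_quot m ^^ k) K z) \<le> B * (3 / r m) ^ k)"
  proof (induction k)
    case 0
    then show ?case using assms by simp
  next
    case (Suc k)
    let ?L = "(diff_quot m ^^ k) K"
    have L: "C_diff_on n (polydisc n r) ?L" "\<And>z. z \<in> polydisc n r \<Longrightarrow> norm (?L z) \<le> B * (3 / r m) ^ k"
      and pos: "B * (3 / r m) ^ k > 0"
      using Suc assms by auto
    have "norm (diff_quot m ?L z) \<le> 3 * (B * (3 / r m) ^ k) / r m" if "z \<in> polydisc n r" for z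
      by (rule diff_quot_bound[OF L(1) _ pos that assms(4)]) (rule L(2))
    moreover have "C_diff_on n (polydisc n r) (diff_quot m ?L)"
      by (rule C_diff_on_diff_quot[OF L(1) _ pos assms(4)]) (rule L(2))
    ultimately show ?case by (simp add: field_simps)
  qed
  then show "C_diff_on n (polydisc n r) ((diff_quot m ^^ k) K)"
    "\<And>z. z \<in> polydisc n r \<Longrightarrow> norm ((diff_quot m ^^ k) K z) \<le> B * (3 / r m) ^ k" by auto
qed

text \<open>Taylor's formula with exact remainder; it is purely algebraic, being the iteration of
  \<open>diff_quot_eq\<close>.\<close>

lemma diff_quot_expand:
  "K z = (\<Sum>k<N. (diff_quot m ^^ k) K (z(m := 0)) * z m ^ k) + z m ^ N * (diff_quot m ^^ N) K z"
proof (induction N)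
  case (Suc N)
  show ?case
    by (subst Suc, subst diff_quot_eq[of "(diff_quot m ^^ N) K" z m]) (simp add: algebra_simps)
qed simp

text \<open>The N-th remainder is at most B q ^ N with q = 3 |z m| / \<open>r m\<close>, and q < 1
  is exactly the condition |z m| < \<open>r m\<close> / 3.\<close>

lemma diff_quot_has_sum:
  assumes K: "C_diff_on n (polydisc n r) K" "\<And>z. z \<in> polydisc n r \<Longrightarrow> norm (K z) \<le> B" "B > 0"
    and m: "m < n" "r m > 0" and z: "z \<in> polydisc n r" "norm (z m) < r m / 3"
  shows "((\<lambda>k. (diff_quot m ^^ k) K (z(m := 0)) * z m ^ k) has_sum K z) UNIV"
proof (rule norm_summable_imp_has_sum)
  define q where "q = 3 * norm (z m) / r m"
  have q: "0 \<le> q" "q < 1" using z m by (auto simp: q_def field_simps)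
  have bd: "norm ((diff_quot m ^^ k) K y * z m ^ k) \<le> B * q ^ k" if "y \<in> polydisc n r" for y k
  proof -
    have "norm ((diff_quot m ^^ k) K y) * norm (z m) ^ k \<le> B * (3 / r m) ^ k * norm (z m) ^ k"
      by (intro mult_right_mono diff_quot_iter(2)[OF K(1) _ K(3) m that] K(2)) auto
    also have "\<dots> = B * q ^ k" by (simp add: q_def power_mult_distrib power_divide)
    finally show ?thesis by (simp add: norm_mult norm_power)
  qed
  have z0: "z(m := 0) \<in> polydisc n r" using polydisc_upd[OF z(1) m(1)] m(2) by simp
  have sq: "summable (\<lambda>k. B * q ^ k)" using q by (intro summable_mult summable_geometric) simp
  show "summable (\<lambda>k. norm ((diff_quot m ^^ k) K (z(m := 0)) * z m ^ k))"
    by (rule summable_comparison_test'[OF sq]) (use bd[OF z0] in simp)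
  show "(\<lambda>k. (diff_quot m ^^ k) K (z(m := 0)) * z m ^ k) sums K z"
    unfolding sums_def
  proof (rule Lim_transform[OF tendsto_const], rule Lim_null_comparison)
    show "\<forall>\<^sub>F N in sequentially. norm ((\<Sum>k<N. (diff_quot m ^^ k) K (z(m := 0)) * z m ^ k) - K z) \<le> B * q ^ N"
    proof (intro always_eventually allI)
      fix N
      have "(\<Sum>k<N. (diff_quot m ^^ k) K (z(m := 0)) * z m ^ k) - K z = - ((diff_quot m ^^ N) K z * z m ^ N)"
        by (subst diff_quot_expand[of K z m N]) simp
      then show "norm ((\<Sum>k<N. (diff_quot m ^^ k) K (z(m := 0)) * z m ^ k) - K z) \<le> B * q ^ N"
        using bd[OF z(1), of N] by (simp only: norm_minus_cancel)
    qed
    show "(\<lambda>N. B * q ^ N) \<longlonglongrightarrow> 0"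
      using q by (intro tendsto_mult_right_zero LIMSEQ_power_zero) simp
  qed
qed

lemma bij_betw_tuples_Suc:
  "bij_betw (\<lambda>(k, \<alpha>). \<alpha>(n := k)) (UNIV \<times> tuples n) (tuples (Suc n) :: (nat \<Rightarrow> 'a::zero) set)"
proof (rule bij_betwI[where g = "\<lambda>\<alpha>. (\<alpha> n, \<alpha>(n := 0))"])
  show "(\<lambda>(k, \<alpha>). \<alpha>(n := k)) \<in> UNIV \<times> tuples n \<rightarrow> (tuples (Suc n) :: (nat \<Rightarrow> 'a) set)"
    using tuples_upd_Suc by auto
  show "(\<lambda>\<alpha>. (\<alpha> n, \<alpha>(n := 0))) \<in> tuples (Suc n) \<rightarrow> UNIV \<times> (tuples n :: (nat \<Rightarrow> 'a) set)"
    using tuples_upd_0 by auto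
qed (auto simp: tuples_def fun_eq_iff)

lemma tuples_0: "tuples 0 = {\<lambda>_. 0}"
  by (auto simp: tuples_def)

lemma summable_on_geometric_multi:
  fixes q :: "nat \<Rightarrow> real"
  assumes "\<And>i. i < n \<Longrightarrow> 0 \<le> q i" "\<And>i. i < n \<Longrightarrow> q i < 1"
  shows "(\<lambda>\<alpha>. \<Prod>i<n. q i ^ \<alpha> i) summable_on tuples n"
  using assms
proof (induction n)
  case 0
  then show ?case by (simp add: tuples_0)
next
  case (Suc n)
  let ?f = "\<lambda>\<alpha>. \<Prod>i<n. q i ^ \<alpha> i"
  have IH: "?f summable_on tuples n" using Suc by simp
  have nn: "?f \<alpha> \<ge> 0" for \<alpha> using Suc.prems(1) by (intro prod_nonneg) auto
  have geo: "(\<lambda>k. q n ^ k) summable_on UNIV"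
    using Suc.prems[of n] by (intro norm_summable_imp_summable_on) (auto intro: summable_geometric)
  have "(\<lambda>p. norm ((\<lambda>(k, \<alpha>). q n ^ k * ?f \<alpha>) p)) summable_on (UNIV \<times> tuples n)"
    unfolding Infinite_Sum.abs_summable_on_Sigma_iff
  proof (intro conjI ballI)
    have norm_eq: "norm (case (k, \<alpha>) of (k, \<alpha>) \<Rightarrow> q n ^ k * ?f \<alpha>) = q n ^ k * ?f \<alpha>" for k \<alpha>
      using nn Suc.prems(1)[of n] by (simp add: abs_mult)
    show "(\<lambda>\<alpha>. norm (case (k, \<alpha>) of (k, \<alpha>) \<Rightarrow> q n ^ k * ?f \<alpha>)) summable_on tuples n" for k
      unfolding norm_eq by (rule summable_on_cmult_right[OF IH])
    have "(\<Sum>\<^sub>\<infinity>\<alpha>\<in>tuples n. q n ^ k * ?f \<alpha>) = q n ^ k * infsum ?f (tuples n)" for k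
      by (rule infsum_cmult_right')
    then show "(\<lambda>k. norm (\<Sum>\<^sub>\<infinity>\<alpha>\<in>tuples n. norm (case (k, \<alpha>) of (k, \<alpha>) \<Rightarrow> q n ^ k * ?f \<alpha>))) summable_on UNIV"
      unfolding norm_eq
      using summable_on_iff_abs_summable_on_real[THEN iffD1, OF summable_on_cmult_left[OF geo, of "infsum ?f (tuples n)"]]
      by simp
  qed
  then have "(\<lambda>(k, \<alpha>). q n ^ k * ?f \<alpha>) summable_on (UNIV \<times> tuples n)"
    by (rule abs_summable_summable)
  moreover have "(\<lambda>(k, \<alpha>). q n ^ k * ?f \<alpha>) = (\<lambda>p. \<Prod>i<Suc n. q i ^ (case p of (k, \<alpha>) \<Rightarrow> \<alpha>(n := k)) i)"
    by (auto simp: fun_eq_iff)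
  ultimately show ?case
    using summable_on_reindex_bij_betw[OF bij_betw_tuples_Suc[of n], where f = "\<lambda>\<alpha>. \<Prod>i<Suc n. q i ^ \<alpha> i"] by simp
qed

text \<open>Induction on the number of variables: K is expanded in the last one, and the
  coefficients are functions of the others, bounded by B (3 / \<open>r n\<close>) ^ k, to which the
  hypothesis applies with this new bound. The bound on the coefficients belongs to the claim because
  it makes the combined family absolutely summable.\<close>

lemma polydisc_power_series:
  assumes "C_diff_on n (polydisc n r) K" "\<And>z. z \<in> polydisc n r \<Longrightarrow> norm (K z) \<le> B" "B > 0"
    and "\<And>i. i < n \<Longrightarrow> r i > 0"
  shows "\<exists>c. (\<forall>\<alpha>\<in>tuples n. norm (c \<alpha>) \<le> B * (\<Prod>i<n. (3 / r i) ^ \<alpha> i)) \<and>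
    (\<forall>z\<in>polydisc n (\<lambda>i. r i / 3). ((\<lambda>\<alpha>. c \<alpha> * (\<Prod>i<n. z i ^ \<alpha> i)) has_sum K z) (tuples n))"
  using assms
proof (induction n arbitrary: K B)
  case 0
  have "((\<lambda>\<alpha>. K (\<lambda>_. 0)) has_sum K (\<lambda>_. 0)) {\<lambda>_. 0 :: nat}"
    by (rule has_sum_finiteI) auto
  then show ?case
    using 0 by (intro exI[of _ "\<lambda>_. K (\<lambda>_. 0)"]) (auto simp: polydisc_def tuples_0)
next
  case (Suc n)
  have rn: "r n > 0" using Suc.prems(4) by simp
  let ?D = "\<lambda>k. (diff_quot n ^^ k) K"
  have sub: "polydisc n r \<subseteq> (polydisc (Suc n) r :: (nat \<Rightarrow> complex) set)"
    using polydisc_subset_Suc[of r n] rn by blast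
  have "\<exists>c. (\<forall>\<alpha>\<in>tuples n. norm (c \<alpha>) \<le> B * (3 / r n) ^ k * (\<Prod>i<n. (3 / r i) ^ \<alpha> i)) \<and>
    (\<forall>z\<in>polydisc n (\<lambda>i. r i / 3). ((\<lambda>\<alpha>. c \<alpha> * (\<Prod>i<n. z i ^ \<alpha> i)) has_sum ?D k z) (tuples n))" for k
  proof (rule Suc.IH)
    show "C_diff_on n (polydisc n r) (?D k)"
      by (rule C_diff_on_le[OF C_diff_on_subset[OF
          diff_quot_iter(1)[OF Suc.prems(1) _ Suc.prems(3) lessI rn] sub]]) (auto intro: Suc.prems(2))
    show "norm (?D k z) \<le> B * (3 / r n) ^ k" if "z \<in> polydisc n r" for z
      by (rule diff_quot_iter(2)[OF Suc.prems(1) _ Suc.prems(3) lessI rn])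
        (use that sub Suc.prems(2) in auto)
  qed (use Suc.prems rn in auto)
  then have "\<forall>k. \<exists>c. (\<forall>\<alpha>\<in>tuples n. norm (c \<alpha>) \<le> B * (3 / r n) ^ k * (\<Prod>i<n. (3 / r i) ^ \<alpha> i)) \<and>
    (\<forall>z\<in>polydisc n (\<lambda>i. r i / 3). ((\<lambda>\<alpha>. c \<alpha> * (\<Prod>i<n. z i ^ \<alpha> i)) has_sum ?D k z) (tuples n))" ..
  from choice[OF this] obtain c where c: "\<And>k \<alpha>. \<alpha> \<in> tuples n \<Longrightarrow> norm (c k \<alpha>) \<le> B * (3 / r n) ^ k * (\<Prod>i<n. (3 / r i) ^ \<alpha> i)"
    "\<And>k z. z \<in> polydisc n (\<lambda>i. r i / 3) \<Longrightarrow> ((\<lambda>\<alpha>. c k \<alpha> * (\<Prod>i<n. z i ^ \<alpha> i)) has_sum ?D k z) (tuples n)"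
    by blast
  define C where "C \<alpha> = c (\<alpha> n) (\<alpha>(n := 0))" for \<alpha>
  have C_bd: "norm (C \<alpha>) \<le> B * (\<Prod>i<Suc n. (3 / r i) ^ \<alpha> i)" if "\<alpha> \<in> tuples (Suc n)" for \<alpha>
    using c(1)[OF tuples_upd_0[OF that], of "\<alpha> n"] by (simp add: C_def mult_ac)
  moreover have "((\<lambda>\<alpha>. C \<alpha> * (\<Prod>i<Suc n. z i ^ \<alpha> i)) has_sum K z) (tuples (Suc n))"
    if z: "z \<in> polydisc (Suc n) (\<lambda>i. r i / 3)" for z
  proof -
    let ?g = "\<lambda>\<alpha>. C \<alpha> * (\<Prod>i<Suc n. z i ^ \<alpha> i)"
    have zr: "z \<in> polydisc (Suc n) r"
    proof -
      have "polydisc (Suc n) (\<lambda>i. r i / 3) \<subseteq> (polydisc (Suc n) r :: (nat \<Rightarrow> complex) set)"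
        using Suc.prems(4) by (intro polydisc_mono) (simp add: less_imp_le)
      then show ?thesis using z by blast
    qed
    have "(\<lambda>\<alpha>. norm (?g \<alpha>)) summable_on tuples (Suc n)"
    proof (rule Infinite_Sum.abs_summable_on_comparison_test)
      have "(\<lambda>\<alpha>. \<Prod>i<Suc n. (3 * norm (z i) / r i) ^ \<alpha> i) summable_on tuples (Suc n)"
      proof (rule summable_on_geometric_multi)
        fix i assume "i < Suc n"
        then have "r i > 0" "norm (z i) < r i / 3" using Suc.prems(4) z by (auto simp: polydisc_def)
        then show "0 \<le> 3 * norm (z i) / r i" "3 * norm (z i) / r i < 1" by (auto simp: field_simps)
      qed
      from summable_on_iff_abs_summable_on_real[THEN iffD1, OF summable_on_cmult_right[OF this, of B]]
      show "(\<lambda>\<alpha>. norm (B * (\<Prod>i<Suc n. (3 * norm (z i) / r i) ^ \<alpha> i))) summable_on tuples (Suc n)" .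
      fix \<alpha> :: "nat \<Rightarrow> nat" assume \<alpha>: "\<alpha> \<in> tuples (Suc n)"
      have "norm (?g \<alpha>) \<le> B * (\<Prod>i<Suc n. (3 / r i) ^ \<alpha> i) * (\<Prod>i<Suc n. norm (z i) ^ \<alpha> i)"
        unfolding norm_mult prod_norm[symmetric] norm_power
        by (intro mult_right_mono C_bd[OF \<alpha>] prod_nonneg) auto
      also have "\<dots> = B * (\<Prod>i<Suc n. (3 * norm (z i) / r i) ^ \<alpha> i)"
        by (simp only: mult.assoc prod.distrib[symmetric] power_mult_distrib[symmetric]) simp
      finally show "norm (?g \<alpha>) \<le> norm (B * (\<Prod>i<Suc n. (3 * norm (z i) / r i) ^ \<alpha> i))"
        by simp
    qed
    then have summ: "?g summable_on tuples (Suc n)" by (rule abs_summable_summable)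
    then obtain S where S: "(?g has_sum S) (tuples (Suc n))" by (auto simp: summable_on_def)
    have S1: "((\<lambda>p. ?g (case p of (k, \<alpha>) \<Rightarrow> \<alpha>(n := k))) has_sum S) (UNIV \<times> tuples n)"
      using S has_sum_reindex_bij_betw[OF bij_betw_tuples_Suc[of n], where f = ?g and S = S] by simp
    have S2: "((\<lambda>\<alpha>. ?g (case (k, \<alpha>) of (k, \<alpha>) \<Rightarrow> \<alpha>(n := k))) has_sum (?D k (z(n := 0)) * z n ^ k)) (tuples n)" for k
    proof -
      have z0: "z(n := 0) \<in> polydisc n (\<lambda>i. r i / 3)" using polydisc_Suc_upd_0[OF z] .
      have "((\<lambda>\<alpha>. c k \<alpha> * (\<Prod>i<n. z i ^ \<alpha> i) * z n ^ k) has_sum (?D k (z(n := 0)) * z n ^ k)) (tuples n)"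
        using has_sum_cmult_left[OF c(2)[OF z0, of k], of "z n ^ k"] by simp
      then show ?thesis
      proof (rule has_sum_cong[THEN iffD1, rotated])
        fix \<alpha> :: "nat \<Rightarrow> nat" assume "\<alpha> \<in> tuples n"
        then have "\<alpha>(n := 0) = \<alpha>" by (simp add: tuples_def fun_upd_idem)
        then show "c k \<alpha> * (\<Prod>i<n. z i ^ \<alpha> i) * z n ^ k = ?g (case (k, \<alpha>) of (k, \<alpha>) \<Rightarrow> \<alpha>(n := k))"
          by (simp add: C_def mult_ac)
      qed
    qed
    \<comment> \<open>Summing over the first n exponents first turns the total S into the
      one-variable expansion, whose value is K z.\<close>
    have "((\<lambda>k. ?D k (z(n := 0)) * z n ^ k) has_sum S) UNIV"
      by (rule has_sum_Sigma[OF isUCont_plus S1]) (rule S2)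
    moreover have "((\<lambda>k. ?D k (z(n := 0)) * z n ^ k) has_sum K z) UNIV"
      by (rule diff_quot_has_sum[OF Suc.prems(1) _ Suc.prems(3) lessI rn zr])
        (use Suc.prems(2) z in \<open>auto simp: polydisc_def\<close>)
    ultimately have "S = K z" by (rule has_sum_unique)
    then show ?thesis using S by simp
  qed
  ultimately show ?case by blast
qed

section \<open>From separate holomorphy to real analyticity and back\<close>

lemma C_diff_on_locally_bounded:
  assumes "C_diff_on n V F" "open_in_space n V" "a \<in> V"
  shows "\<exists>\<epsilon>>0. \<forall>z\<in>cube n \<epsilon>. (\<lambda>i. a i + z i) \<in> V \<and> norm (F (\<lambda>i. a i + z i)) \<le> norm (F a) + 1"
proof -
  have "openin (top_of_set V) (V \<inter> F -` ball 0 (norm (F a) + 1))"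
    using assms(1) by (intro continuous_openin_preimage_gen) (auto simp: C_differentiable_on_def)
  then have "open_in_space n (V \<inter> F -` ball 0 (norm (F a) + 1))"
    using assms(2) openin_trans by blast
  from open_in_space_contains_polydisc[OF this, of a] show ?thesis
    using assms(3) by (auto intro: less_imp_le)
qed

lemma C_diff_on_translate:
  assumes "C_diff_on n V F" "\<And>z. z \<in> S \<Longrightarrow> (\<lambda>i. a i + z i) \<in> V"
  shows "C_diff_on n S (\<lambda>z. F (\<lambda>i. a i + z i))"
  unfolding C_differentiable_on_def
proof (intro conjI ballI allI impI)
  have "continuous_on S (\<lambda>z i. a i + z i)"
    by (intro continuous_on_coordinatewise_then_product continuous_intros continuous_on_proj)
  then show "continuous_on S (\<lambda>z. F (\<lambda>i. a i + z i))"
    by (intro continuous_on_compose2[of V F S "\<lambda>z i. a i + z i"])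
      (use assms in \<open>auto simp: C_differentiable_on_def\<close>)
  fix z j assume z: "z \<in> S" "j < n"
  let ?y = "\<lambda>i. a i + z i"
  have "(\<lambda>w. F (?y(j := w))) field_differentiable at (a j + z j)"
    using assms z unfolding C_differentiable_on_def by blast
  then have "((\<lambda>w. F (?y(j := w))) \<circ> (\<lambda>w. a j + w)) field_differentiable at (z j)"
    by (intro field_differentiable_compose field_differentiable_add) auto
  moreover have "(\<lambda>i. a i + (z(j := w)) i) = ?y(j := a j + w)" for w by auto
  ultimately show "(\<lambda>w. F (\<lambda>i. a i + (z(j := w)) i)) field_differentiable at (z j)"
    by (simp add: o_def)
qed

text \<open>Monomials in x - a are real at real points, so the real parts of the complex
  coefficients expand the real part of F. Hence F itself may be non-real on W.\<close>

lemma C_diff_on_imp_real_analytic_on: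
  assumes F: "C_diff_on n V F" "open_in_space n V"
    and W: "open_in_space n W" "(\<lambda>x. complex_of_real \<circ> x) ` W \<subseteq> V"
    and f: "\<And>x. x \<in> W \<Longrightarrow> Re (F (complex_of_real \<circ> x)) = f x"
  shows "real_analytic_on n W f"
  unfolding real_analytic_on_def
proof
  fix a assume a: "a \<in> W"
  let ?a = "complex_of_real \<circ> a"
  obtain \<epsilon> where \<epsilon>: "\<epsilon> > 0" "\<And>z. z \<in> cube n \<epsilon> \<Longrightarrow> (\<lambda>i. ?a i + z i) \<in> V"
    "\<And>z. z \<in> cube n \<epsilon> \<Longrightarrow> norm (F (\<lambda>i. ?a i + z i)) \<le> norm (F ?a) + 1"
    using C_diff_on_locally_bounded[OF F, of ?a] a W(2) by blast
  let ?K = "\<lambda>z. F (\<lambda>i. ?a i + z i)"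
  have "C_diff_on n (cube n \<epsilon>) ?K"
    by (rule C_diff_on_translate[OF F(1) \<epsilon>(2)])
  then have "\<exists>c. (\<forall>\<alpha>\<in>tuples n. norm (c \<alpha>) \<le> (norm (F ?a) + 1) * (\<Prod>i<n. (3 / \<epsilon>) ^ \<alpha> i)) \<and>
    (\<forall>z\<in>polydisc n (\<lambda>i. \<epsilon> / 3). ((\<lambda>\<alpha>. c \<alpha> * (\<Prod>i<n. z i ^ \<alpha> i)) has_sum ?K z) (tuples n))"
    by (rule polydisc_power_series) (use \<epsilon> in \<open>auto simp: add_nonneg_pos\<close>)
  then obtain c where c: "\<And>z. z \<in> polydisc n (\<lambda>i. \<epsilon> / 3) \<Longrightarrow>
    ((\<lambda>\<alpha>. c \<alpha> * (\<Prod>i<n. z i ^ \<alpha> i)) has_sum ?K z) (tuples n)" by blast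
  let ?W = "W \<inter> {x \<in> tuples n. \<forall>i<n. norm (x i - a i) < \<epsilon> / 3}"
  have "open_in_space n ?W"
    by (intro openin_Int W(1) open_in_space_translated_polydisc)
  moreover have "a \<in> tuples n" using a openin_imp_subset[OF W(1)] by blast
  then have "a \<in> ?W" using a \<epsilon>(1) by simp
  moreover have "((\<lambda>\<alpha>. Re (c \<alpha>) * (\<Prod>i<n. (x i - a i) ^ \<alpha> i)) has_sum f x) (tuples n)" if x: "x \<in> ?W" for x
  proof -
    let ?z = "\<lambda>i. complex_of_real (x i - a i)"
    have "?z \<in> polydisc n (\<lambda>i. \<epsilon> / 3)"
      using x \<open>a \<in> tuples n\<close> by (auto simp: polydisc_def tuples_def simp flip: of_real_diff)
    from has_sum_Re[OF c[OF this]]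
    have "((\<lambda>\<alpha>. Re (c \<alpha> * (\<Prod>i<n. ?z i ^ \<alpha> i))) has_sum Re (?K ?z)) (tuples n)" .
    moreover have "Re (c \<alpha> * (\<Prod>i<n. ?z i ^ \<alpha> i)) = Re (c \<alpha>) * (\<Prod>i<n. (x i - a i) ^ \<alpha> i)" for \<alpha>
      proof -
      have "(\<Prod>i<n. ?z i ^ \<alpha> i) = complex_of_real (\<Prod>i<n. (x i - a i) ^ \<alpha> i)" by simp
      then show ?thesis by (simp only: times_complex.sel Re_complex_of_real Im_complex_of_real mult_zero_right diff_zero)
    qed
    moreover have "?K ?z = F (complex_of_real \<circ> x)" by (simp add: o_def)
    ultimately show ?thesis using f[of x] x by simp
  qed
  ultimately show "\<exists>W' c. open_in_space n W' \<and> a \<in> W' \<and> W' \<subseteq> W \<and>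
      (\<forall>x\<in>W'. ((\<lambda>\<alpha>. c \<alpha> * (\<Prod>i<n. (x i - a i) ^ \<alpha> i)) has_sum f x) (tuples n))"
    by (intro exI[of _ ?W] exI[of _ "\<lambda>\<alpha>. Re (c \<alpha>)"]) blast
qed

lemma C_diff_on_prod:
  "(\<And>k. k \<in> I \<Longrightarrow> C_diff_on n V (F k)) \<Longrightarrow> C_diff_on n V (\<lambda>z. \<Prod>k\<in>I. F k z)"
  by (induction I rule: infinite_finite_induct)
    (auto intro: C_diff_on_mult C_diff_on_const)

text \<open>The power series is summed at complex arguments. The clause about curves \<gamma> goes
  beyond \<open>C_diff_on\<close>, which only knows coordinate directions: in F(x + t y) a change of
  t moves many coordinates at once. It holds because the partial sums are polynomials and converge
  uniformly.\<close>

lemma real_analytic_on_imp_holomorphic_extension: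
  assumes "real_analytic_on n U f" "(\<lambda>_. 0) \<in> U"
  shows "\<exists>\<rho>>0. \<exists>F. cube n \<rho> \<subseteq> U \<and>
    (\<forall>x\<in>cube n \<rho>. F (complex_of_real \<circ> x) = complex_of_real (f x)) \<and>
    C_diff_on n (cube n \<rho>) F \<and>
    (\<forall>S \<gamma>. open S \<longrightarrow> (\<forall>i<n. (\<lambda>w. \<gamma> w i) holomorphic_on S) \<longrightarrow>
       (\<forall>w\<in>S. \<gamma> w \<in> cube n \<rho>) \<longrightarrow> (\<lambda>w. F (\<gamma> w)) holomorphic_on S)"
proof -
  obtain W c where W: "open_in_space n W" "(\<lambda>_. 0) \<in> W" "W \<subseteq> U"
    and c: "\<And>x. x \<in> W \<Longrightarrow> ((\<lambda>\<alpha>. c \<alpha> * (\<Prod>i<n. x i ^ \<alpha> i)) has_sum f x) (tuples n)"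
    using assms unfolding real_analytic_on_def by fastforce
  obtain \<epsilon> where \<epsilon>: "\<epsilon> > 0" "cube n \<epsilon> \<subseteq> W"
    using open_in_space_contains_polydisc0[OF W(1,2)] by blast
  \<comment> \<open>The corner with all coordinates equal to \<rho> must still lie in W.\<close>
  define \<rho> where "\<rho> = \<epsilon> / 2"
  have \<rho>: "\<rho> > 0" "\<rho> < \<epsilon>" using \<epsilon>(1) by (auto simp: \<rho>_def)
  let ?P = "cube n \<rho> :: (nat \<Rightarrow> complex) set"
  have PW: "cube n \<rho> \<subseteq> W"
    using polydisc_mono[of n "\<lambda>_. \<rho>" "\<lambda>_. \<epsilon>"] \<rho> \<epsilon>(2) by fastforce
  have "(\<lambda>i. if i < n then \<rho> else 0) \<in> cube n \<epsilon>"
    using \<rho> by (auto simp: polydisc_def tuples_def)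
  with c \<epsilon>(2) have "(\<lambda>\<alpha>. c \<alpha> * (\<Prod>i<n. (if i < n then \<rho> else 0) ^ \<alpha> i)) summable_on tuples n"
    unfolding summable_on_def by blast
  then have "(\<lambda>\<alpha>. c \<alpha> * (\<Prod>i<n. \<rho> ^ \<alpha> i)) summable_on tuples n" by simp
  \<comment> \<open>Summability of real families is absolute, so convergence at this single corner
    majorises the series on the whole complex polydisc.\<close>
  then have M: "(\<lambda>\<alpha>. norm (c \<alpha> * (\<Prod>i<n. \<rho> ^ \<alpha> i))) summable_on tuples n"
    by (rule summable_on_iff_abs_summable_on_real[THEN iffD1])
  define t where "t \<alpha> z = complex_of_real (c \<alpha>) * (\<Prod>i<n. z i ^ \<alpha> i)" for \<alpha> and z :: "nat \<Rightarrow> complex"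
  define F where "F z = (\<Sum>\<^sub>\<infinity>\<alpha>\<in>tuples n. t \<alpha> z)" for z
  have t_bd: "norm (t \<alpha> z) \<le> norm (c \<alpha> * (\<Prod>i<n. \<rho> ^ \<alpha> i))" if "z \<in> ?P" for \<alpha> z
  proof -
    have "(\<Prod>i<n. norm (z i) ^ \<alpha> i) \<le> (\<Prod>i<n. \<rho> ^ \<alpha> i)"
      using that by (intro prod_mono conjI power_mono) (auto simp: polydisc_def less_imp_le)
    moreover have "norm (\<Prod>i<n. \<rho> ^ \<alpha> i) = (\<Prod>i<n. \<rho> ^ \<alpha> i)"
      using \<rho> by (simp add: prod_nonneg)
    ultimately show ?thesis
      unfolding t_def norm_mult prod_norm[symmetric] norm_power norm_of_real
      by (intro mult_mono) (auto simp: prod_nonneg)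
  qed
  have ul: "uniform_limit ?P (\<lambda>X z. \<Sum>\<alpha>\<in>X. t \<alpha> z) F (finite_subsets_at_top (tuples n))"
    unfolding F_def by (rule Weierstrass_m_test_general[OF t_bd M])
  show ?thesis
  proof (intro exI[of _ \<rho>] exI[of _ F] conjI ballI allI impI)
    show "\<rho> > 0" by fact
    show "cube n \<rho> \<subseteq> U" using PW W(3) by blast
    show "F (complex_of_real \<circ> x) = complex_of_real (f x)" if "x \<in> cube n \<rho>" for x
    proof -
      have "((\<lambda>\<alpha>. c \<alpha> * (\<Prod>i<n. x i ^ \<alpha> i)) has_sum f x) (tuples n)" using c that PW by blast
      from has_sum_of_real[OF this, where 'a = complex]
      have "((\<lambda>\<alpha>. t \<alpha> (complex_of_real \<circ> x)) has_sum complex_of_real (f x)) (tuples n)"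
        by (simp add: t_def)
      then show ?thesis by (simp add: F_def infsumI)
    qed
    show "C_diff_on n ?P F"
      by (rule C_diff_on_uniform_limit[OF always_eventually ul])
        (auto simp: t_def intro!: C_diff_on_sum C_diff_on_mult C_diff_on_const
          C_diff_on_prod C_diff_on_power C_diff_on_coord)
    fix S :: "complex set" and \<gamma>
    assume S: "open S" and \<gamma>: "\<forall>i<n. (\<lambda>w. \<gamma> w i) holomorphic_on S" "\<forall>w\<in>S. \<gamma> w \<in> ?P"
    show "(\<lambda>w. F (\<gamma> w)) holomorphic_on S"
    proof (rule holomorphic_on_uniform_limit[OF _ _ _ S])
      show "uniform_limit S (\<lambda>X w. \<Sum>\<alpha>\<in>X. t \<alpha> (\<gamma> w)) (\<lambda>w. F (\<gamma> w)) (finite_subsets_at_top (tuples n))"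
        by (rule uniform_limit_compose'[OF ul]) (use \<gamma> in auto)
      show "\<forall>\<^sub>F X in finite_subsets_at_top (tuples n). (\<lambda>w. \<Sum>\<alpha>\<in>X. t \<alpha> (\<gamma> w)) holomorphic_on S"
        unfolding t_def using \<gamma>(1) by (intro always_eventually allI holomorphic_intros) auto
    qed simp
  qed
qed

section \<open>Germs\<close>

lemma open_nbhd0_polydisc: "\<epsilon> > 0 \<Longrightarrow> open_nbhd0 n (cube n \<epsilon>)"
  by (simp add: open_nbhd0_def open_in_space_polydisc zero_mem_polydisc)

lemma open_nbhd0_Int: "open_nbhd0 n U \<Longrightarrow> open_nbhd0 n V \<Longrightarrow> open_nbhd0 n (U \<inter> V)"
  by (auto simp: open_nbhd0_def)

lemma open_nbhd0_contains_polydisc: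
  assumes "open_nbhd0 n U"
  shows "\<exists>\<epsilon>>0. \<forall>\<delta>\<le>\<epsilon>. cube n \<delta> \<subseteq> U"
proof -
  obtain \<epsilon> where \<epsilon>: "\<epsilon> > 0" "cube n \<epsilon> \<subseteq> U"
    using open_in_space_contains_polydisc0 assms unfolding open_nbhd0_def by blast
  then have "cube n \<delta> \<subseteq> U" if "\<delta> \<le> \<epsilon>" for \<delta>
    using polydisc_mono[of n "\<lambda>_. \<delta>" "\<lambda>_. \<epsilon>"] that by blast
  with \<epsilon>(1) show ?thesis by blast
qed

lemma germ_at0_eq_iff: "germ_at0 n f = germ_at0 n g \<longleftrightarrow> (\<exists>W. open_nbhd0 n W \<and> (\<forall>x\<in>W. f x = g x))"
proof
  assume "germ_at0 n f = germ_at0 n g"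
  moreover have "f \<in> germ_at0 n f"
    using open_nbhd0_polydisc[of 1 n] by (auto simp: germ_at0_def)
  ultimately show "\<exists>W. open_nbhd0 n W \<and> (\<forall>x\<in>W. f x = g x)" by (simp add: germ_at0_def)
next
  assume "\<exists>W. open_nbhd0 n W \<and> (\<forall>x\<in>W. f x = g x)"
  then obtain W where W: "open_nbhd0 n W" "\<And>x. x \<in> W \<Longrightarrow> f x = g x" by blast
  have "(\<exists>V. open_nbhd0 n V \<and> (\<forall>x\<in>V. h x = f x)) = (\<exists>V. open_nbhd0 n V \<and> (\<forall>x\<in>V. h x = g x))" for h
  proof
    assume "\<exists>V. open_nbhd0 n V \<and> (\<forall>x\<in>V. h x = f x)"
    then obtain V where "open_nbhd0 n V" "\<forall>x\<in>V. h x = f x" by blast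
    then show "\<exists>V. open_nbhd0 n V \<and> (\<forall>x\<in>V. h x = g x)"
      using W(2) by (intro exI[of _ "V \<inter> W"]) (auto intro: open_nbhd0_Int[OF _ W(1)])
  next
    assume "\<exists>V. open_nbhd0 n V \<and> (\<forall>x\<in>V. h x = g x)"
    then obtain V where "open_nbhd0 n V" "\<forall>x\<in>V. h x = g x" by blast
    then show "\<exists>V. open_nbhd0 n V \<and> (\<forall>x\<in>V. h x = f x)"
      using W(2) by (intro exI[of _ "V \<inter> W"]) (auto intro: open_nbhd0_Int[OF _ W(1)])
  qed
  then show "germ_at0 n f = germ_at0 n g" by (simp add: germ_at0_def)
qed

section \<open>Definability and analyticity on cubes\<close>

lemma dpred_polydisc: "dpred M (\<lambda>e. \<forall>i\<in>{..<n}. \<bar>e i\<bar> < r i)"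
  by (intro dpred_conj_finite dpred_less dfn_abs dfn_var dfn_const) auto

lemma polydisc_eq_real: "polydisc n r = {x \<in> tuples n. \<forall>i\<in>{..<n}. \<bar>x i\<bar> < r i}"
  by (auto simp: polydisc_def)

lemma definable_polydisc: "definable M n (polydisc n r)"
  unfolding polydisc_eq_real by (rule definableI[OF dpred_polydisc])

lemma definable_fun_comp:
  assumes f: "definable_fun M n U f"
    and T: "\<And>i. i < n \<Longrightarrow> dfn M (\<lambda>x. T x i)" "\<And>x. T x \<in> tuples n"
    and sub: "\<And>x. x \<in> polydisc k r \<Longrightarrow> T x \<in> U" "\<And>x. x \<in> polydisc k r \<Longrightarrow> g x = f (T x)"
  shows "definable_fun M k (polydisc k r) g"
  unfolding polydisc_eq_real
  by (rule definable_funI[OF dpred_polydisc dpred_dom_definable_fun(2)[OF f T(2) T(1)]])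
    (use sub in \<open>auto simp: polydisc_eq_real\<close>)

lemma definable_fun_restrict:
  assumes f: "definable_fun M n U f"
    and sub: "polydisc n r \<subseteq> U" "\<And>x. x \<in> polydisc n r \<Longrightarrow> g x = f x"
  shows "definable_fun M n (polydisc n r) g"
\<comment> \<open>Truncation puts the point in \<open>tuples n\<close> for every assignment x and
  changes nothing on the polydisc.\<close>
proof (rule definable_fun_comp[OF f, where T = "\<lambda>x i. if i < n then x i else 0"])
  have "(\<lambda>i. if i < n then x i else 0) = x" if "x \<in> polydisc n r" for x :: "nat \<Rightarrow> real"
    using that by (auto simp: polydisc_def tuples_def fun_eq_iff)
  then show "(\<lambda>i. if i < n then x i else 0) \<in> U" "g x = f (\<lambda>i. if i < n then x i else 0)"
    if "x \<in> polydisc n r" for x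
    using sub that by auto
qed (auto simp: tuples_def dfn_var)

lemma definable_cfun_translate:
  assumes F: "definable_cfun M n V F" and \<epsilon>: "\<epsilon> > 0" and b: "b \<in> tuples n"
    and sub: "\<And>z. z \<in> cube n \<epsilon> \<Longrightarrow> z \<in> V"
  shows "definable_cfun M n {z \<in> tuples n. \<forall>i<n. norm (z i - complex_of_real (b i)) < \<epsilon>}
    (\<lambda>z. F (\<lambda>i. z i - complex_of_real (b i)))"
proof -
  \<comment> \<open>The squared norm is a polynomial in the real coordinates, hence definable at
    once.\<close>
  define P where "P y \<longleftrightarrow> (\<forall>i\<in>{..<n}. (y (2 * i) - b i)\<^sup>2 + (y (2 * i + 1))\<^sup>2 < \<epsilon>\<^sup>2)" for y :: "nat \<Rightarrow> real"
  define Z where "Z y i = (if i < n then Complex (y (2 * i) - b i) (y (2 * i + 1)) else 0)" for y i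
  have P: "dpred M P"
    unfolding P_def by (intro dpred_conj_finite dpred_less dfn_add dfn_power dfn_diff dfn_var dfn_const) auto
  have Z: "Z y \<in> tuples n" for y by (auto simp: Z_def tuples_def)
  have dZ: "dfn M (\<lambda>y. Re (Z y i))" "dfn M (\<lambda>y. Im (Z y i))" if "i < n" for i
    using that by (auto simp: Z_def intro!: dfn_diff dfn_var dfn_const)
  have eq: "{z \<in> tuples n. \<forall>i<n. norm (z i - complex_of_real (b i)) < \<epsilon>} = {z \<in> tuples n. P (realify z)}"
  proof -
    have "norm (w - complex_of_real c) < \<epsilon> \<longleftrightarrow> (Re w - c)\<^sup>2 + (Im w)\<^sup>2 < \<epsilon>\<^sup>2" for w c
      using \<epsilon> real_sqrt_less_iff[of "(Re w - c)\<^sup>2 + (Im w)\<^sup>2" "\<epsilon>\<^sup>2"] by (simp add: cmod_def)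
    then show ?thesis by (auto simp: P_def realify_def)
  qed
  have Zeq: "Z (realify z) = (\<lambda>i. z i - complex_of_real (b i))" if "z \<in> tuples n" for z
    using that b by (auto simp: Z_def realify_def fun_eq_iff tuples_def complex_eq_iff)
  show ?thesis unfolding eq
  proof (rule definable_cfunI[OF P dpred_dom_definable_cfun(2,3)[OF F Z dZ]])
    fix z :: "nat \<Rightarrow> complex" assume z: "z \<in> tuples n" "P (realify z)"
    then have "(\<lambda>i. z i - complex_of_real (b i)) \<in> cube n \<epsilon>"
      using eq b by (auto simp: polydisc_def tuples_def)
    then show "F (\<lambda>i. z i - complex_of_real (b i)) =
      Complex (Re (if Z (realify z) \<in> V then F (Z (realify z)) else 0))
        (Im (if Z (realify z) \<in> V then F (Z (realify z)) else 0))"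
      using sub by (simp add: Zeq[OF z(1)])
  qed
qed

lemma definable_cfun_restrict:
  assumes "definable_cfun M n V F" "\<epsilon> > 0" "cube n \<epsilon> \<subseteq> V"
  shows "definable_cfun M n (cube n \<epsilon>) F"
  using definable_cfun_translate[OF assms(1,2), of "\<lambda>_. 0"] assms(3)
  by (auto simp: tuples_def polydisc_def)

lemma real_analytic_on_subset:
  assumes "real_analytic_on n U f" "open_in_space n W" "W \<subseteq> U" "\<And>x. x \<in> W \<Longrightarrow> f x = g x"
  shows "real_analytic_on n W g"
  unfolding real_analytic_on_def
proof
  fix a assume a: "a \<in> W"
  then have "a \<in> U" using assms(3) by blast
  from bspec[OF assms(1)[unfolded real_analytic_on_def] this]
  obtain V c where V: "open_in_space n V" "a \<in> V"
    and c: "\<forall>x\<in>V. ((\<lambda>\<alpha>. c \<alpha> * (\<Prod>i<n. (x i - a i) ^ \<alpha> i)) has_sum f x) (tuples n)"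
    by (elim exE conjE)
  have "((\<lambda>\<alpha>. c \<alpha> * (\<Prod>i<n. (x i - a i) ^ \<alpha> i)) has_sum g x) (tuples n)" if "x \<in> V \<inter> W" for x
    using bspec[OF c, of x] assms(4)[of x] that by simp
  moreover have "open_in_space n (V \<inter> W)" using V(1) assms(2) by (rule openin_Int)
  ultimately show "\<exists>W' c. open_in_space n W' \<and> a \<in> W' \<and> W' \<subseteq> W \<and>
      (\<forall>x\<in>W'. ((\<lambda>\<alpha>. c \<alpha> * (\<Prod>i<n. (x i - a i) ^ \<alpha> i)) has_sum g x) (tuples n))"
    using V(2) a by (intro exI[of _ "V \<inter> W"] exI[of _ c] conjI ballI) simp_all
qed

text \<open>Having all smaller cubes at disposal lets several germs be represented on a common
  one.\<close>

lemma mem_definable_germs: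
  "germ_at0 n f \<in> definable_germs M n \<longleftrightarrow> (\<exists>\<epsilon>>0. \<forall>\<delta>\<le>\<epsilon>. definable_fun M n (cube n \<delta>) f)"
proof
  assume "germ_at0 n f \<in> definable_germs M n"
  then obtain g U W where U: "open_nbhd0 n U" and g: "definable_fun M n U g"
    and W0: "open_nbhd0 n W" and W: "\<forall>x\<in>W. f x = g x"
    by (auto simp: definable_germs_def germ_at0_eq_iff)
  obtain \<epsilon> where \<epsilon>: "\<epsilon> > 0" "\<And>\<delta>. \<delta> \<le> \<epsilon> \<Longrightarrow> cube n \<delta> \<subseteq> U \<inter> W"
    using open_nbhd0_contains_polydisc[OF open_nbhd0_Int[OF U W0]] by blast
  then have "definable_fun M n (cube n \<delta>) f" if "\<delta> \<le> \<epsilon>" for \<delta>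
    using that W by (intro definable_fun_restrict[OF g]) blast+
  then show "\<exists>\<epsilon>>0. \<forall>\<delta>\<le>\<epsilon>. definable_fun M n (cube n \<delta>) f" using \<epsilon>(1) by blast
next
  assume "\<exists>\<epsilon>>0. \<forall>\<delta>\<le>\<epsilon>. definable_fun M n (cube n \<delta>) f"
  then show "germ_at0 n f \<in> definable_germs M n"
    unfolding definable_germs_def using open_nbhd0_polydisc by blast
qed

lemma mem_analytic_germs:
  "germ_at0 n f \<in> analytic_germs n \<longleftrightarrow> (\<exists>U. open_nbhd0 n U \<and> real_analytic_on n U f)"
proof
  assume "germ_at0 n f \<in> analytic_germs n"
  then obtain g U W where U: "open_nbhd0 n U" "real_analytic_on n U g"
    and W: "open_nbhd0 n W" "\<forall>x\<in>W. f x = g x"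
    by (auto simp: analytic_germs_def germ_at0_eq_iff)
  note UW = open_nbhd0_Int[OF U(1) W(1)]
  have "real_analytic_on n (U \<inter> W) f"
    by (rule real_analytic_on_subset[OF U(2)]) (use UW W(2) in \<open>auto simp: open_nbhd0_def\<close>)
  then show "\<exists>U. open_nbhd0 n U \<and> real_analytic_on n U f" using UW by blast
next
  assume "\<exists>U. open_nbhd0 n U \<and> real_analytic_on n U f"
  then show "germ_at0 n f \<in> analytic_germs n" by (auto simp: analytic_germs_def)
qed

lemma R_analytic_on_polydisc:
  assumes "\<epsilon> > 0" "definable_cfun M n (cube n \<epsilon>) F" "C_diff_on n (cube n \<epsilon>) F"
    "\<And>x. x \<in> cube n \<epsilon> \<Longrightarrow> F (complex_of_real \<circ> x) = complex_of_real (f x)"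
  shows "R_analytic_on M n (cube n \<epsilon>) f"
  unfolding R_analytic_on_def
proof
  fix a :: "nat \<Rightarrow> real" assume "a \<in> cube n \<epsilon>"
  moreover have "(\<lambda>x. complex_of_real \<circ> x) ` cube n \<epsilon> \<subseteq> cube n \<epsilon>"
    by (auto simp: polydisc_def tuples_def)
  ultimately show "\<exists>W V F. open_in_space n W \<and> a \<in> W \<and> W \<subseteq> cube n \<epsilon> \<and>
        open_in_space n V \<and> (\<lambda>x. complex_of_real \<circ> x) ` W \<subseteq> V \<and>
        definable_cfun M n V F \<and> C_diff_on n V F \<and>
        (\<forall>x\<in>W. F (complex_of_real \<circ> x) = complex_of_real (f x))"
    using assms(2-4)
    by (intro exI[of _ "cube n \<epsilon>"] exI[of _ F] conjI ballI) (simp_all add: open_in_space_polydisc)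
qed

text \<open>One extension around 0 suffices: on a cube the same F serves as local extension at every
  point.\<close>

lemma mem_R_analytic_germs:
  "germ_at0 n f \<in> R_analytic_germs M n \<longleftrightarrow>
    (\<exists>\<epsilon>>0. \<exists>F. definable_fun M n (cube n \<epsilon>) f \<and> definable_cfun M n (cube n \<epsilon>) F \<and>
       C_diff_on n (cube n \<epsilon>) F \<and>
       (\<forall>x\<in>cube n \<epsilon>. F (complex_of_real \<circ> x) = complex_of_real (f x)))"
    (is "_ \<longleftrightarrow> ?R")
proof
  assume "germ_at0 n f \<in> R_analytic_germs M n"
  then obtain g U W where U: "open_nbhd0 n U" and g: "definable_fun M n U g" "R_analytic_on M n U g"
    and W: "open_nbhd0 n W" "\<forall>x\<in>W. f x = g x"
    by (auto simp: R_analytic_germs_def germ_at0_eq_iff)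
  have "(\<lambda>_. 0) \<in> U" using U by (simp add: open_nbhd0_def)
  from bspec[OF g(2)[unfolded R_analytic_on_def] this]
  obtain W' V F where "open_in_space n W'" "(\<lambda>_. 0) \<in> W'" "W' \<subseteq> U"
    and V: "open_in_space n V" "(\<lambda>x. complex_of_real \<circ> x) ` W' \<subseteq> V"
    and F: "definable_cfun M n V F" "C_diff_on n V F"
      "\<forall>x\<in>W'. F (complex_of_real \<circ> x) = complex_of_real (g x)"
    by (elim exE conjE)
  then have W': "open_nbhd0 n W'" "W' \<subseteq> U" by (simp_all add: open_nbhd0_def)
  have "complex_of_real \<circ> (\<lambda>_. 0) \<in> V" using V(2) W'(1) unfolding open_nbhd0_def by blast
  then have "(\<lambda>_. 0) \<in> V" by (simp add: o_def)
  with V(1) obtain \<epsilon>1 where \<epsilon>1: "\<epsilon>1 > 0" "cube n \<epsilon>1 \<subseteq> V"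
    using open_in_space_contains_polydisc0 by blast
  obtain \<epsilon>2 where \<epsilon>2: "\<epsilon>2 > 0" "\<And>\<delta>. \<delta> \<le> \<epsilon>2 \<Longrightarrow> cube n \<delta> \<subseteq> W \<inter> W'"
    using open_nbhd0_contains_polydisc[OF open_nbhd0_Int[OF W(1) W'(1)]] by blast
  define \<epsilon> where "\<epsilon> = min \<epsilon>1 \<epsilon>2"
  have \<epsilon>: "\<epsilon> > 0" using \<epsilon>1 \<epsilon>2 by (simp add: \<epsilon>_def)
  have PV: "cube n \<epsilon> \<subseteq> V"
    using polydisc_mono[of n "\<lambda>_. \<epsilon>" "\<lambda>_. \<epsilon>1"] \<epsilon>1(2) by (auto simp: \<epsilon>_def)
  have PW: "cube n \<epsilon> \<subseteq> W \<inter> W'" by (rule \<epsilon>2(2)) (simp add: \<epsilon>_def)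
  have "definable_fun M n (cube n \<epsilon>) f"
    by (rule definable_fun_restrict[OF g(1)]) (use PW W' W in blast)+
  moreover have "definable_cfun M n (cube n \<epsilon>) F"
    by (rule definable_cfun_restrict[OF F(1) \<epsilon> PV])
  moreover have "C_diff_on n (cube n \<epsilon>) F"
    by (rule C_diff_on_subset[OF F(2) PV])
  moreover have "F (complex_of_real \<circ> x) = complex_of_real (f x)" if "x \<in> cube n \<epsilon>" for x
  proof -
    have "x \<in> W" "x \<in> W'" using PW that by blast+
    then show ?thesis using F(3) W(2) by simp
  qed
  ultimately show ?R
    using \<epsilon> by blast
next
  assume ?R
  then obtain \<epsilon> F where "\<epsilon> > 0" "definable_fun M n (cube n \<epsilon>) f"
    and F: "definable_cfun M n (cube n \<epsilon>) F" "C_diff_on n (cube n \<epsilon>) F"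
       "\<forall>x\<in>cube n \<epsilon>. F (complex_of_real \<circ> x) = complex_of_real (f x)"
    by (elim exE conjE)
  moreover have "R_analytic_on M n (cube n \<epsilon>) f"
    by (rule R_analytic_on_polydisc[OF \<open>\<epsilon> > 0\<close> F(1,2)]) (use F(3) in blast)
  ultimately have "\<epsilon> > 0" "definable_fun M n (cube n \<epsilon>) f" "R_analytic_on M n (cube n \<epsilon>) f"
    by simp_all
  then show "germ_at0 n f \<in> R_analytic_germs M n"
    unfolding R_analytic_germs_def using open_nbhd0_polydisc definable_polydisc by blast
qed

text \<open>The same F and B work for all small \<delta>, so that divisor and dividend can share a
  radius; the bound B is what the Schwarz estimates start from.\<close>

lemma R_analytic_germ_extension:
  assumes "germ_at0 n f \<in> R_analytic_germs M n"
  shows "\<exists>\<epsilon>>0. \<exists>F B. 0 < B \<and> (\<forall>\<delta>. 0 < \<delta> \<longrightarrow> \<delta> \<le> \<epsilon> \<longrightarrow>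
    definable_fun M n (cube n \<delta>) f \<and> definable_cfun M n (cube n \<delta>) F \<and>
    C_diff_on n (cube n \<delta>) F \<and>
    (\<forall>x\<in>cube n \<delta>. F (complex_of_real \<circ> x) = complex_of_real (f x)) \<and>
    (\<forall>z\<in>cube n \<delta>. norm (F z) \<le> B))"
    (is "\<exists>\<epsilon>>0. \<exists>F B. 0 < B \<and> (\<forall>\<delta>. 0 < \<delta> \<longrightarrow> \<delta> \<le> \<epsilon> \<longrightarrow> ?E F B \<delta>)")
proof -
  obtain \<epsilon>1 F where \<epsilon>1: "\<epsilon>1 > 0" and f: "definable_fun M n (cube n \<epsilon>1) f"
    and F: "definable_cfun M n (cube n \<epsilon>1) F" "C_diff_on n (cube n \<epsilon>1) F"
      "\<forall>x\<in>cube n \<epsilon>1. F (complex_of_real \<circ> x) = complex_of_real (f x)"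
    using assms unfolding mem_R_analytic_germs by blast
  obtain \<epsilon>2 where \<epsilon>2: "\<epsilon>2 > 0" "\<And>z. z \<in> cube n \<epsilon>2 \<Longrightarrow> norm (F z) \<le> norm (F (\<lambda>_. 0)) + 1"
    using C_diff_on_locally_bounded[OF F(2) open_in_space_polydisc zero_mem_polydisc] \<epsilon>1 by auto
  have "?E F (norm (F (\<lambda>_. 0)) + 1) \<delta>"
    if \<delta>: "0 < \<delta>" "\<delta> \<le> min \<epsilon>1 \<epsilon>2" for \<delta>
  proof -
    have sub: "cube n \<delta> \<subseteq> (cube n \<epsilon>1 :: (nat \<Rightarrow> real) set)"
      "cube n \<delta> \<subseteq> (cube n \<epsilon>1 :: (nat \<Rightarrow> complex) set)"
      "cube n \<delta> \<subseteq> (cube n \<epsilon>2 :: (nat \<Rightarrow> complex) set)"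
      using \<delta>(2) by (auto intro!: polydisc_mono)
    show ?thesis
      using definable_fun_restrict[OF f sub(1)] definable_cfun_restrict[OF F(1) \<delta>(1) sub(2)]
        C_diff_on_subset[OF F(2) sub(2)] F(3) sub(1,3) \<epsilon>2(2) by (intro conjI) blast+
  qed
  moreover have "norm (F (\<lambda>_. 0)) + 1 > 0" by (simp add: add_nonneg_pos)
  moreover have "min \<epsilon>1 \<epsilon>2 > 0" using \<epsilon>1 \<epsilon>2(1) by simp
  ultimately show ?thesis
    by (intro exI[of _ "min \<epsilon>1 \<epsilon>2"] exI[of _ F] exI[of _ "norm (F (\<lambda>_. 0)) + 1"] conjI allI impI) simp_all
qed

lemma analytic_germ_if_holomorphic_extension:
  assumes "\<And>i. i < n \<Longrightarrow> r i > 0" "C_diff_on n (polydisc n r) F"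
    "\<And>x. x \<in> polydisc n r \<Longrightarrow> Re (F (complex_of_real \<circ> x)) = f x"
  shows "germ_at0 n f \<in> analytic_germs n"
proof -
  have "real_analytic_on n (polydisc n r) f"
    by (rule C_diff_on_imp_real_analytic_on[OF assms(2) open_in_space_polydisc open_in_space_polydisc _ assms(3)])
      (auto simp: polydisc_def tuples_def)
  then show ?thesis
    unfolding mem_analytic_germs open_nbhd0_def
    by (intro exI[of _ "polydisc n r"] conjI open_in_space_polydisc zero_mem_polydisc assms(1))
qed

lemma R_analytic_germs_subset: "R_analytic_germs M n \<subseteq> definable_germs M n \<inter> analytic_germs n"
proof
  fix X assume X: "X \<in> R_analytic_germs M n"
  then obtain f where f: "X = germ_at0 n f" by (auto simp: R_analytic_germs_def)
  with X obtain \<epsilon> F where \<epsilon>: "\<epsilon> > 0" and "definable_fun M n (cube n \<epsilon>) f"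
    and F: "C_diff_on n (cube n \<epsilon>) F"
      "\<forall>x\<in>cube n \<epsilon>. F (complex_of_real \<circ> x) = complex_of_real (f x)"
    by (auto simp: mem_R_analytic_germs)
  then have "X \<in> definable_germs M n"
    unfolding definable_germs_def f using open_nbhd0_polydisc by blast
  moreover have "X \<in> analytic_germs n"
    unfolding f by (rule analytic_germ_if_holomorphic_extension[OF _ F(1)]) (use \<epsilon> F(2) in auto)
  ultimately show "X \<in> definable_germs M n \<inter> analytic_germs n" by blast
qed

lemma mem_definable_analytic_germs:
  assumes "X \<in> definable_germs M n \<inter> analytic_germs n"
  obtains f \<epsilon> where "X = germ_at0 n f" "\<epsilon> > 0" "\<And>\<delta>. \<delta> \<le> \<epsilon> \<Longrightarrow> definable_fun M n (cube n \<delta>) f"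
    "real_analytic_on n (cube n \<epsilon>) f"
proof -
  obtain f where f: "X = germ_at0 n f" using assms by (auto simp: definable_germs_def)
  then obtain \<epsilon>1 U where 1: "\<epsilon>1 > 0" "\<forall>\<delta>\<le>\<epsilon>1. definable_fun M n (cube n \<delta>) f"
    and U: "open_nbhd0 n U" "real_analytic_on n U f"
    using assms by (auto simp: mem_definable_germs mem_analytic_germs)
  obtain \<epsilon>2 where 2: "\<epsilon>2 > 0" "\<And>\<delta>. \<delta> \<le> \<epsilon>2 \<Longrightarrow> cube n \<delta> \<subseteq> U"
    using open_nbhd0_contains_polydisc[OF U(1)] by blast
  have "real_analytic_on n (polydisc n (\<lambda>_. min \<epsilon>1 \<epsilon>2)) f"
    by (rule real_analytic_on_subset[OF U(2) open_in_space_polydisc 2(2)]) auto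
  then show thesis using that[OF f, of "min \<epsilon>1 \<epsilon>2"] 1 2 by auto
qed

section \<open>Complexification and equality of germ rings\<close>

lemma germs_eq_if_complexification:
  assumes "has_complexification M"
  shows "definable_germs M n \<inter> analytic_germs n = R_analytic_germs M n"
proof (intro equalityI subsetI)
  fix X assume "X \<in> definable_germs M n \<inter> analytic_germs n"
  then obtain f \<epsilon> where f: "X = germ_at0 n f" "\<epsilon> > 0" "definable_fun M n (cube n \<epsilon>) f"
    "real_analytic_on n (cube n \<epsilon>) f"
    by (rule mem_definable_analytic_germs) blast
  then have "R_analytic_on M n (cube n \<epsilon>) f"
    using assms open_in_space_polydisc definable_polydisc unfolding has_complexification_def by blast
  then show "X \<in> R_analytic_germs M n"
    unfolding R_analytic_germs_def using f open_nbhd0_polydisc definable_polydisc by blast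
qed (use R_analytic_germs_subset in blast)

lemma real_analytic_on_translate:
  assumes f: "real_analytic_on n U f" and W: "open_in_space n W" "\<And>x. x \<in> W \<Longrightarrow> (\<lambda>i. a i + x i) \<in> U"
    and a: "a \<in> tuples n"
  shows "real_analytic_on n W (\<lambda>x. f (\<lambda>i. a i + x i))"
  unfolding real_analytic_on_def
proof
  fix b assume b: "b \<in> W"
  let ?T = "\<lambda>x i. a i + x i :: real"
  from bspec[OF f[unfolded real_analytic_on_def] W(2)[OF b]]
  obtain V c where V: "open_in_space n V" "?T b \<in> V"
    and c: "\<forall>x\<in>V. ((\<lambda>\<alpha>. c \<alpha> * (\<Prod>i<n. (x i - ?T b i) ^ \<alpha> i)) has_sum f x) (tuples n)"
    by (elim exE conjE)
  have "continuous_on W ?T"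
    by (intro continuous_on_coordinatewise_then_product continuous_intros continuous_on_proj)
  moreover have "?T \<in> W \<rightarrow> tuples n"
    using a openin_imp_subset[OF W(1)] by (auto simp: tuples_def)
  ultimately have "openin (top_of_set W) (W \<inter> ?T -` V)"
    using V(1) continuous_openin_preimage by blast
  then have "open_in_space n (W \<inter> ?T -` V)" using W(1) openin_trans by blast
  moreover have "((\<lambda>\<alpha>. c \<alpha> * (\<Prod>i<n. (x i - b i) ^ \<alpha> i)) has_sum f (?T x)) (tuples n)"
    if "x \<in> W \<inter> ?T -` V" for x
    using bspec[OF c, of "?T x"] that by simp
  ultimately show "\<exists>W' c. open_in_space n W' \<and> b \<in> W' \<and> W' \<subseteq> W \<and>
      (\<forall>x\<in>W'. ((\<lambda>\<alpha>. c \<alpha> * (\<Prod>i<n. (x i - b i) ^ \<alpha> i)) has_sum f (?T x)) (tuples n))"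
    using V(2) b by (intro exI[of _ "W \<inter> ?T -` V"] exI[of _ c] conjI ballI) simp_all
qed

lemma complexification_if_germs_eq:
  assumes "\<And>n. definable_germs M n \<inter> analytic_germs n = R_analytic_germs M n"
  shows "has_complexification M"
  unfolding has_complexification_def R_analytic_on_def
proof (intro allI impI ballI, elim conjE)
  fix n U f a
  assume U: "open_in_space n U" and f: "definable_fun M n U f" "real_analytic_on n U f" and a: "a \<in> U"
  have at: "a \<in> tuples n" using a openin_imp_subset[OF U] by blast
  obtain \<epsilon>0 where \<epsilon>0: "\<epsilon>0 > 0" "\<And>x. x \<in> cube n \<epsilon>0 \<Longrightarrow> (\<lambda>i. a i + x i) \<in> U"
    using open_in_space_contains_polydisc[OF U a] by blast
  let ?g = "\<lambda>x. f (\<lambda>i. a i + x i)"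
  have "definable_fun M n (cube n \<epsilon>0) ?g"
  proof (rule definable_fun_comp[OF f(1), where T = "\<lambda>x i. if i < n then a i + x i else 0"])
    have "(\<lambda>i. if i < n then a i + x i else 0) = (\<lambda>i. a i + x i)" if "x \<in> cube n \<epsilon>0" for x
      using that at by (auto simp: polydisc_def tuples_def fun_eq_iff)
    then show "(\<lambda>i. if i < n then a i + x i else 0) \<in> U" "?g x = f (\<lambda>i. if i < n then a i + x i else 0)"
      if "x \<in> cube n \<epsilon>0" for x
      using that \<epsilon>0 by auto
  qed (auto simp: tuples_def intro!: dfn_add dfn_var dfn_const)
  moreover have "real_analytic_on n (cube n \<epsilon>0) ?g"
    by (rule real_analytic_on_translate[OF f(2) open_in_space_polydisc \<epsilon>0(2) at])
  ultimately have "germ_at0 n ?g \<in> definable_germs M n \<inter> analytic_germs n"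
    unfolding definable_germs_def analytic_germs_def using open_nbhd0_polydisc[OF \<epsilon>0(1)] by blast
  then have "germ_at0 n ?g \<in> R_analytic_germs M n" using assms by simp
  then obtain \<epsilon> F where \<epsilon>: "\<epsilon> > 0" and F: "definable_cfun M n (cube n \<epsilon>) F"
    "C_diff_on n (cube n \<epsilon>) F"
    "\<forall>x\<in>cube n \<epsilon>. F (complex_of_real \<circ> x) = complex_of_real (?g x)"
    by (auto simp: mem_R_analytic_germs)
  let ?W = "U \<inter> {x \<in> tuples n. \<forall>i<n. norm (x i - a i) < \<epsilon>}"
  let ?V = "{z \<in> tuples n. \<forall>i<n. norm (z i - complex_of_real (a i)) < \<epsilon>}"
  let ?F = "\<lambda>z. F (\<lambda>i. z i - complex_of_real (a i))"
  have "open_in_space n ?W" by (intro openin_Int U open_in_space_translated_polydisc)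
  moreover have "a \<in> ?W" using a at \<epsilon> by auto
  moreover have "open_in_space n ?V" by (rule open_in_space_translated_polydisc)
  moreover have "(\<lambda>x. complex_of_real \<circ> x) ` ?W \<subseteq> ?V"
    by (auto simp: tuples_def simp flip: of_real_diff)
  moreover have "definable_cfun M n ?V ?F"
    by (rule definable_cfun_translate[OF F(1) \<epsilon> at]) auto
  moreover have "C_diff_on n ?V ?F"
  proof -
    have "C_diff_on n ?V (\<lambda>z. F (\<lambda>i. - complex_of_real (a i) + z i))"
      by (rule C_diff_on_translate[OF F(2)]) (use at in \<open>auto simp: polydisc_def tuples_def\<close>)
    then show ?thesis by simp
  qed
  moreover have "?F (complex_of_real \<circ> x) = complex_of_real (f x)" if x: "x \<in> ?W" for x
  proof -
    have "(\<lambda>i. x i - a i) \<in> cube n \<epsilon>"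
      using x at by (auto simp: polydisc_def tuples_def)
    with F(3) have "F (complex_of_real \<circ> (\<lambda>i. x i - a i)) = complex_of_real (f (\<lambda>i. a i + (x i - a i)))"
      by blast
    then show ?thesis by (simp add: o_def)
  qed
  ultimately show "\<exists>W V F. open_in_space n W \<and> a \<in> W \<and> W \<subseteq> U \<and>
        open_in_space n V \<and> (\<lambda>x. complex_of_real \<circ> x) ` W \<subseteq> V \<and>
        definable_cfun M n V F \<and> C_diff_on n V F \<and>
        (\<forall>x\<in>W. F (complex_of_real \<circ> x) = complex_of_real (f x))"
    by (intro exI[of _ ?W] exI[of _ ?V] exI[of _ ?F] conjI ballI) simp_all
qed

section \<open>Complexification from Weierstrass division\<close>

text \<open>The coordinates of the \<open>(2n + 2)\<close>-tuple are \<open>(x, y, s, t)\<close>; the value is \<open>x + t y\<close>.\<close>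

definition shear :: "nat \<Rightarrow> (nat \<Rightarrow> 'a::comm_semiring_1) \<Rightarrow> nat \<Rightarrow> 'a" where
  "shear n z i = (if i < n then z i + z (2 * n + 1) * z (n + i) else 0)"

lemma shear_mem_polydisc:
  fixes z :: "nat \<Rightarrow> 'a::real_normed_field"
  assumes "z \<in> cube (2 * n + 2) \<epsilon>" "\<epsilon> \<le> 1" "2 * \<epsilon> \<le> \<delta>"
  shows "shear n z \<in> cube n \<delta>"
proof -
  have "norm (z i + z (2 * n + 1) * z (n + i)) < \<delta>" if "i < n" for i
  proof -
    have z: "norm (z i) < \<epsilon>" "norm (z (2 * n + 1)) < \<epsilon>" "norm (z (n + i)) < \<epsilon>"
      using assms(1) that by (auto simp: polydisc_def)
    have "norm (z i + z (2 * n + 1) * z (n + i)) \<le> norm (z i) + norm (z (2 * n + 1)) * norm (z (n + i))"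
      by (metis norm_mult norm_triangle_ineq)
    also have "\<dots> \<le> norm (z i) + 1 * norm (z (n + i))"
      by (intro add_left_mono mult_right_mono) (use z assms(2) in auto)
    finally show ?thesis using z assms(3) by linarith
  qed
  then show ?thesis by (auto simp: polydisc_def tuples_def shear_def)
qed

lemma of_real_shear: "complex_of_real \<circ> shear n x = shear n (complex_of_real \<circ> x)"
  by (auto simp: shear_def fun_eq_iff)

lemma shear_line_holomorphic: "(\<lambda>w. shear n (z(j := w)) i) holomorphic_on S"
proof -
  have "(\<lambda>w. (z(j := w)) k) holomorphic_on S" for k
    by (cases "k = j") auto
  then show ?thesis unfolding shear_def
    by (cases "i < n") (auto intro!: holomorphic_intros simp del: fun_upd_apply)
qed

lemma continuous_on_shear: "continuous_on S (shear n :: (nat \<Rightarrow> complex) \<Rightarrow> _)"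
proof (rule continuous_on_coordinatewise_then_product)
  fix i show "continuous_on S (\<lambda>z. shear n z i :: complex)"
    unfolding shear_def by (cases "i < n") (auto intro!: continuous_intros continuous_on_proj)
qed

lemma regular_sum_squares: "k \<noteq> m \<Longrightarrow> regular_of_order m 2 (\<lambda>x. (x k)\<^sup>2 + (x m)\<^sup>2)"
proof -
  assume "k \<noteq> m"
  then have eq: "(\<lambda>t. (((\<lambda>_. 0)(m := t)) k)\<^sup>2 + (((\<lambda>_. 0)(m := t)) m)\<^sup>2) = (\<lambda>t::real. t\<^sup>2)" by simp
  have d1: "deriv (\<lambda>t::real. t\<^sup>2) = (\<lambda>t. 2 * t)"
    by (rule ext, rule DERIV_imp_deriv) (auto intro!: derivative_eq_intros)
  have d2: "deriv (\<lambda>t::real. 2 * t) = (\<lambda>t. 2)"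
    by (rule ext, rule DERIV_imp_deriv) (auto intro!: derivative_eq_intros)
  define D where "D j = (deriv ^^ j) (\<lambda>t::real. t\<^sup>2) 0" for j
  have "D 0 = 0" "D (Suc 0) = 0" "D (Suc (Suc 0)) = 2" by (simp_all add: D_def d1 d2)
  then have "(\<forall>j<2. D j = 0) \<and> D 2 \<noteq> 0" by (simp add: numeral_2_eq_2 less_Suc_eq)
  then show "regular_of_order m 2 (\<lambda>x. (x k)\<^sup>2 + (x m)\<^sup>2)"
    unfolding regular_of_order_def eq D_def .
qed

text \<open>The proof uses the quotient only as an analytic germ, which is continued to complex t
  and then killed by s^2 + t^2 at t = i s, and the remainder only as a pair of definable germs,
  which are evaluated at real points and never continued.\<close>

lemma germs_eq_if_Weierstrass_division:
  assumes "Weierstrass_division (\<lambda>n. definable_germs M n \<inter> analytic_germs n)"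
  shows "definable_germs M n \<inter> analytic_germs n = R_analytic_germs M n"
proof (intro equalityI subsetI)
  fix X assume X: "X \<in> definable_germs M n \<inter> analytic_germs n"
  obtain f \<epsilon>0 where f: "X = germ_at0 n f" and \<epsilon>0: "\<epsilon>0 > 0"
    and f_def: "\<And>\<delta>. \<delta> \<le> \<epsilon>0 \<Longrightarrow> definable_fun M n (cube n \<delta>) f"
    and f_an: "real_analytic_on n (cube n \<epsilon>0) f"
    using mem_definable_analytic_germs[OF X] by blast
  have zero: "(\<lambda>_. 0) \<in> cube n \<epsilon>0" using \<epsilon>0 by (simp add: zero_mem_polydisc)
  obtain \<rho> F where \<rho>: "\<rho> > 0"
    and F0: "\<forall>x\<in>cube n \<rho>. F (complex_of_real \<circ> x) = complex_of_real (f x)"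
      "C_diff_on n (cube n \<rho>) F"
      "\<forall>S \<gamma>. open S \<longrightarrow> (\<forall>i<n. (\<lambda>w. \<gamma> w i) holomorphic_on S) \<longrightarrow>
         (\<forall>w\<in>S. \<gamma> w \<in> cube n \<rho>) \<longrightarrow> (\<lambda>w. F (\<gamma> w)) holomorphic_on S"
    using real_analytic_on_imp_holomorphic_extension[OF f_an zero] by (elim exE conjE) (rule that)
  note F = F0(1)[rule_format] F0(2) F0(3)[rule_format]
  define m where "m = 2 * n + 1"
  have m: "2 * n + 2 = Suc m" "m = 2 * n + 1" by (simp_all add: m_def)
  \<comment> \<open>As |t| < 1, the map x + t y sends the cube of radius \<epsilon> into the one of
    radius 2 \<epsilon>; the halves allow for that, once for definability of f and once for its
    extension F.\<close>
  define \<epsilon> where "\<epsilon> = min 1 (min (\<epsilon>0 / 2) (\<rho> / 2))"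
  have \<epsilon>: "\<epsilon> > 0" "\<epsilon> \<le> 1" "2 * \<epsilon> \<le> \<epsilon>0" "2 * \<epsilon> \<le> \<rho>" using \<epsilon>0 \<rho> by (auto simp: \<epsilon>_def)
  have shear\<rho>: "shear n z \<in> cube n \<rho>" if "z \<in> cube (Suc m) \<epsilon>" for z :: "nat \<Rightarrow> complex"
    by (rule shear_mem_polydisc[OF that[folded m(1)] \<epsilon>(2,4)])
  have shear\<rho>': "shear n z \<in> cube n \<rho>" if "z \<in> cube (Suc m) \<epsilon>" for z :: "nat \<Rightarrow> real"
    by (rule shear_mem_polydisc[OF that[folded m(1)] \<epsilon>(2,4)])
  define g where "g = (\<lambda>x. f (shear n x))"
  define p where "p = (\<lambda>x :: nat \<Rightarrow> real. (x (2 * n))\<^sup>2 + (x m)\<^sup>2)"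
  have "definable_fun M (Suc m) (cube (Suc m) \<epsilon>) g"
  proof (rule definable_fun_comp[OF f_def[OF order_refl], where T = "shear n"])
    show "shear n x \<in> cube n \<epsilon>0" if "x \<in> cube (Suc m) \<epsilon>" for x :: "nat \<Rightarrow> real"
      by (rule shear_mem_polydisc[OF that[folded m(1)] \<epsilon>(2,3)])
    show "dfn M (\<lambda>x. shear n x i)" if "i < n" for i
      using that unfolding shear_def by (auto intro!: dfn_add dfn_mult dfn_var)
  qed (auto simp: g_def shear_def tuples_def)
  then have g1: "germ_at0 (Suc m) g \<in> definable_germs M (Suc m)"
    unfolding definable_germs_def using open_nbhd0_polydisc[OF \<epsilon>(1)] by blast
  have "C_diff_on (Suc m) (cube (Suc m) \<epsilon>) (\<lambda>z. F (shear n z))"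
    unfolding C_differentiable_on_def
  proof (intro conjI ballI allI impI)
    have contF: "continuous_on (cube n \<rho>) F" using F(2) by (simp add: C_differentiable_on_def)
    show "continuous_on (cube (Suc m) \<epsilon>) (\<lambda>z. F (shear n z))"
      by (rule continuous_on_compose2[OF contF continuous_on_shear]) (use shear\<rho> in blast)
    fix z :: "nat \<Rightarrow> complex" and i assume z: "z \<in> cube (Suc m) \<epsilon>" "i < Suc m"
    have "(\<lambda>w. F (shear n (z(i := w)))) holomorphic_on ball 0 \<epsilon>"
      by (rule F(3)) (use polydisc_upd[OF z] shear\<rho> in \<open>auto intro: shear_line_holomorphic\<close>)
    moreover have "z i \<in> ball 0 \<epsilon>" using z by (auto simp: polydisc_def)
    ultimately show "(\<lambda>w. F (shear n (z(i := w)))) field_differentiable at (z i)"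
      using holomorphic_on_imp_differentiable_at by blast
  qed
  then have g2: "germ_at0 (Suc m) g \<in> analytic_germs (Suc m)"
  proof (rule analytic_germ_if_holomorphic_extension[rotated])
    fix x :: "nat \<Rightarrow> real" assume "x \<in> cube (Suc m) \<epsilon>"
    then show "Re (F (shear n (complex_of_real \<circ> x))) = g x"
      using F(1)[OF shear\<rho>'] by (simp add: g_def of_real_shear[symmetric])
  qed (use \<epsilon> in simp)
  have "definable_fun M (Suc m) (cube (Suc m) \<epsilon>) p"
    unfolding polydisc_eq_real
    by (rule definable_funI[OF dpred_polydisc, where h = p])
      (auto simp: p_def intro!: dfn_add dfn_power dfn_var)
  then have p1: "germ_at0 (Suc m) p \<in> definable_germs M (Suc m)"
    unfolding definable_germs_def using open_nbhd0_polydisc[OF \<epsilon>(1)] by blast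
  have p2: "germ_at0 (Suc m) p \<in> analytic_germs (Suc m)"
    by (rule analytic_germ_if_holomorphic_extension[where r = "\<lambda>_. 1" and F = "\<lambda>z. (z (2 * n))\<^sup>2 + (z m)\<^sup>2"])
      (auto simp: p_def simp flip: of_real_power
        intro!: C_diff_on_add C_diff_on_power C_diff_on_coord)
  have p3: "regular_of_order m 2 p" unfolding p_def by (rule regular_sum_squares) (simp add: m_def)
  from assms[unfolded Weierstrass_division_def, rule_format, of m p 2 g] g1 g2 p1 p2 p3
  obtain q r where q: "germ_at0 (Suc m) q \<in> analytic_germs (Suc m)"
    and r: "\<forall>k<2. germ_at0 m (r k) \<in> definable_germs M m"
    and eq: "germ_at0 (Suc m) g = germ_at0 (Suc m) (\<lambda>x. q x * p x + (\<Sum>k<2. r k (x(m := 0)) * x m ^ k))"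
    by auto
  from eq obtain W where W: "open_nbhd0 (Suc m) W"
    "\<And>x. x \<in> W \<Longrightarrow> g x = q x * p x + (\<Sum>k<2. r k (x(m := 0)) * x m ^ k)"
    unfolding germ_at0_eq_iff by blast
  obtain \<sigma>1 where \<sigma>1: "\<sigma>1 > 0" "\<And>\<delta>. \<delta> \<le> \<sigma>1 \<Longrightarrow> cube (Suc m) \<delta> \<subseteq> W"
    using open_nbhd0_contains_polydisc[OF W(1)] by blast
  obtain Uq where "open_nbhd0 (Suc m) Uq" and Uq: "real_analytic_on (Suc m) Uq q"
    using q unfolding mem_analytic_germs by blast
  then have "(\<lambda>_. 0) \<in> Uq" by (simp add: open_nbhd0_def)
  from real_analytic_on_imp_holomorphic_extension[OF Uq this] obtain \<sigma>2 Q where \<sigma>2: "\<sigma>2 > 0"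
    and Q0: "\<forall>x\<in>cube (Suc m) \<sigma>2. Q (complex_of_real \<circ> x) = complex_of_real (q x)"
      "C_diff_on (Suc m) (cube (Suc m) \<sigma>2) Q"
    by (elim exE conjE) (rule that)
  note Q = Q0(1)[rule_format] Q0(2)
  obtain \<sigma>3 where \<sigma>3: "\<sigma>3 > 0" "\<And>\<delta>. \<delta> \<le> \<sigma>3 \<Longrightarrow> definable_fun M m (cube m \<delta>) (r 0)"
    using r[rule_format, of 0] unfolding mem_definable_germs by auto
  obtain \<sigma>4 where \<sigma>4: "\<sigma>4 > 0" "\<And>\<delta>. \<delta> \<le> \<sigma>4 \<Longrightarrow> definable_fun M m (cube m \<delta>) (r 1)"
    using r[rule_format, of 1] unfolding mem_definable_germs by auto
  define \<sigma> where "\<sigma> = Min {\<epsilon>, \<sigma>1, \<sigma>2, \<sigma>3, \<sigma>4}"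
  have \<sigma>: "\<sigma> > 0" "\<sigma> \<le> \<epsilon>" "\<sigma> \<le> \<sigma>1" "\<sigma> \<le> \<sigma>2" "\<sigma> \<le> \<sigma>3" "\<sigma> \<le> \<sigma>4"
    using \<epsilon>(1) \<sigma>1(1) \<sigma>2 \<sigma>3(1) \<sigma>4(1) by (auto simp: \<sigma>_def)
  let ?c = "\<lambda>x. complex_of_real \<circ> x"
  have key: "F (shear n ((?c x)(m := \<i> * of_real (x (2 * n))))) =
      of_real (r 0 x) + of_real (r 1 x) * (\<i> * of_real (x (2 * n)))"
    if x: "x \<in> cube m \<sigma>" for x
  proof -
    \<comment> \<open>With real x, y, s fixed the remainder is a polynomial in t, so D is
      holomorphic in t alone. It vanishes for real t by the division, hence on the disc by the
      identity theorem.\<close>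
    define D where "D t = F (shear n ((?c x)(m := t))) -
      (Q ((?c x)(m := t)) * (of_real ((x (2 * n))\<^sup>2) + t\<^sup>2) + (of_real (r 0 x) + of_real (r 1 x) * t))" for t
    have xc: "?c x \<in> cube m \<sigma>" using x by (auto simp: polydisc_def tuples_def)
    have upd: "(?c x)(m := t) \<in> cube (Suc m) \<sigma>" if "norm t < \<sigma>" for t
      using polydisc_Suc_upd[OF xc] that by simp
    have up_mono: "cube (Suc m) \<sigma> \<subseteq> cube (Suc m) s" if "\<sigma> \<le> s" for s
      using that by (intro polydisc_mono) simp
    have "(\<lambda>t. F (shear n ((?c x)(m := t)))) holomorphic_on ball 0 \<sigma>"
      by (rule F(3)) (use upd up_mono[OF \<sigma>(2)] shear\<rho> in \<open>auto intro: shear_line_holomorphic\<close>)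
    moreover have "(\<lambda>t. Q ((?c x)(m := t))) holomorphic_on ball 0 \<sigma>"
    proof -
      have "?c x \<in> cube (Suc m) \<sigma>2"
        using xc polydisc_subset_Suc[of "\<lambda>_. \<sigma>" m] up_mono[OF \<sigma>(4)] \<sigma>(1) by blast
      from C_diff_on_line[OF Q(2) this lessI] show ?thesis
        by (rule holomorphic_on_subset) (use \<sigma>(4) in auto)
    qed
    ultimately have hol: "D holomorphic_on ball 0 \<sigma>"
      unfolding D_def by (intro holomorphic_intros)
    have zero: "D (of_real t) = 0" if t: "\<bar>t\<bar> < \<sigma>" for t
    proof -
      let ?x = "x(m := t)"
      have x': "?x \<in> cube (Suc m) \<sigma>" using polydisc_Suc_upd[OF x] t by simp
      have c: "(?c x)(m := of_real t) = ?c ?x" by auto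
      have mem: "?x \<in> cube (Suc m) \<sigma>2" "?x \<in> cube (Suc m) \<epsilon>" "?x \<in> W"
        using x' polydisc_mono[of "Suc m" "\<lambda>_. \<sigma>" "\<lambda>_. \<sigma>2"] polydisc_mono[of "Suc m" "\<lambda>_. \<sigma>" "\<lambda>_. \<epsilon>"]
          \<sigma>1(2)[OF \<sigma>(3)] \<sigma>(2,4) by auto
      have "x m = 0" using x by (auto simp: polydisc_def tuples_def)
      then have "?x(m := 0) = x" by (simp add: fun_upd_idem)
      then have "g ?x = q ?x * ((x (2 * n))\<^sup>2 + t\<^sup>2) + (r 0 x + r 1 x * t)"
        using W(2)[OF mem(3)] by (simp add: p_def m_def numeral_2_eq_2)
      moreover have "F (shear n (?c ?x)) = of_real (g ?x)"
        using F(1)[OF shear\<rho>'[OF mem(2)]] by (simp add: g_def of_real_shear)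
      ultimately show ?thesis
        unfolding D_def c Q(1)[OF mem(1)] by simp
    qed
    have "D t = 0" if t: "t \<in> ball 0 \<sigma>" for t
    proof (rule analytic_continuation[OF hol open_ball connected_ball _ _ _ _ t])
      show "complex_of_real ` {t. \<bar>t\<bar> < \<sigma>} \<subseteq> ball 0 \<sigma>" by auto
      show "(0::complex) \<in> ball 0 \<sigma>" using \<sigma> by simp
      show "(0::complex) islimpt complex_of_real ` {t. \<bar>t\<bar> < \<sigma>}"
        unfolding islimpt_approachable
      proof (intro allI impI)
        fix e :: real assume "e > 0"
        then show "\<exists>w\<in>complex_of_real ` {t. \<bar>t\<bar> < \<sigma>}. w \<noteq> 0 \<and> dist w 0 < e"
          using \<sigma>(1) by (intro bexI[of _ "complex_of_real (min \<sigma> e / 2)"] imageI conjI) auto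
      qed
    qed (use zero in auto)
    moreover have "\<bar>x (2 * n)\<bar> < \<sigma>" using x by (auto simp: polydisc_def m_def)
    ultimately have "D (\<i> * of_real (x (2 * n))) = 0" by (simp add: norm_mult)
    then show ?thesis by (simp add: D_def power_mult_distrib)
  qed
  \<comment> \<open>With s fixed, (x, y) are real coordinates for the complex point x + i s
    y.\<close>
  define s where "s = \<sigma> / 2"
  have s: "s > 0" "s < \<sigma>" using \<sigma> by (auto simp: s_def)
  \<comment> \<open>The entry y = Im z / s has to stay below \<sigma>, hence the bound \<sigma> s;
    \<epsilon>0 keeps f definable on the final cube.\<close>
  define \<tau> where "\<tau> = min \<epsilon>0 (min \<sigma> (\<sigma> * s))"
  have \<tau>: "\<tau> > 0" "\<tau> \<le> \<epsilon>0" "\<tau> \<le> \<sigma>" "\<tau> \<le> \<sigma> * s" using \<sigma>(1) s(1) \<epsilon>0 by (auto simp: \<tau>_def)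
  \<comment> \<open>The m-tuple (Re z, Im z / s, s) in the order (x, y, s), read from the
    interleaved real coordinates of z.\<close>
  define Y where "Y y j = (if j < n then y (2 * j) else if j < 2 * n then inverse s * y (2 * (j - n) + 1)
    else if j = 2 * n then s else 0)" for y :: "nat \<Rightarrow> real" and j
  have Y1: "Y y \<in> tuples m" for y by (auto simp: Y_def m_def tuples_def)
  have Y2: "dfn M (\<lambda>y. Y y j)" for j
    unfolding Y_def by (cases "j < n"; cases "j < 2 * n"; cases "j = 2 * n")
      (auto intro!: dfn_mult dfn_var dfn_const)
  have FY: "F z = Complex (r 0 (Y (realify z))) (s * r 1 (Y (realify z)))" "Y (realify z) \<in> cube m \<sigma>"
    if z: "z \<in> cube n \<tau>" for z
  proof -
    let ?x = "Y (realify z)"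
    have zb: "\<bar>Re (z i)\<bar> < \<tau>" "\<bar>Im (z i)\<bar> < \<tau>" if "i < n" for i
      using z that abs_Re_le_cmod[of "z i"] abs_Im_le_cmod[of "z i"] by (auto simp: polydisc_def)
    have "\<bar>?x j\<bar> < \<sigma>" if j: "j < m" for j
    proof -
      consider "j < n" | "n \<le> j" "j < 2 * n" | "j = 2 * n" using j m_def by linarith
      then show ?thesis
      proof cases
        case 1
        then show ?thesis using zb(1)[of j] \<tau>(3) by (auto simp: Y_def realify_def)
      next
        case 2
        then have "j - n < n" by linarith
        from zb(2)[OF this] have "\<bar>Im (z (j - n))\<bar> < \<sigma> * s" using \<tau>(4) by linarith
        moreover have "\<bar>?x j\<bar> = \<bar>Im (z (j - n))\<bar> / s"
          using 2 s(1) by (simp add: Y_def realify_def abs_mult divide_inverse mult.commute)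
        ultimately show ?thesis using s(1) by (simp add: pos_divide_less_eq)
      next
        case 3
        then show ?thesis using s by (simp add: Y_def)
      qed
    qed
    then show x: "?x \<in> cube m \<sigma>" using Y1 by (simp add: polydisc_def)
    have x2n: "?x (2 * n) = s" by (simp add: Y_def)
    have "shear n ((?c ?x)(m := \<i> * of_real s)) = z"
    proof
      fix i
      show "shear n ((?c ?x)(m := \<i> * of_real s)) i = z i"
      proof (cases "i < n")
        case True
        then have "?x i = Re (z i)" "?x (n + i) = inverse s * Im (z i)" "i \<noteq> m" "n + i \<noteq> m"
          by (auto simp: Y_def realify_def m_def)
        moreover have "Suc (2 * n) = m" by (simp add: m_def)
        ultimately show ?thesis using True s(1)
          by (simp add: shear_def complex_eq_iff power2_eq_square)
      next
        case False
        then show ?thesis using z by (auto simp: shear_def polydisc_def tuples_def)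
      qed
    qed
    with key[OF x] show "F z = Complex (r 0 ?x) (s * r 1 ?x)"
      by (simp add: x2n complex_eq_iff)
  qed
  have "definable_cfun M n (cube n \<tau>) F"
  proof -
    let ?R = "\<lambda>k y. if Y y \<in> cube m \<sigma> then r k (Y y) else 0"
    let ?P = "\<lambda>y :: nat \<Rightarrow> real. \<forall>i\<in>{..<n}. (y (2 * i))\<^sup>2 + (y (2 * i + 1))\<^sup>2 < \<tau>\<^sup>2"
    have P: "dpred M ?P"
      by (intro dpred_conj_finite dpred_less dfn_add dfn_power dfn_var dfn_const) auto
    have "norm w < \<tau> \<longleftrightarrow> (Re w)\<^sup>2 + (Im w)\<^sup>2 < \<tau>\<^sup>2" for w
      using \<tau>(1) real_sqrt_less_iff[of "(Re w)\<^sup>2 + (Im w)\<^sup>2" "\<tau>\<^sup>2"] by (simp add: cmod_def)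
    then have Peq: "cube n \<tau> = {z \<in> tuples n. ?P (realify z)}"
      by (auto simp: polydisc_def realify_def)
    have "dfn M (?R 0)"
      by (rule dpred_dom_definable_fun(2)[OF \<sigma>3(2)[OF \<sigma>(5)] Y1 Y2])
    moreover have "dfn M (?R 1)"
      by (rule dpred_dom_definable_fun(2)[OF \<sigma>4(2)[OF \<sigma>(6)] Y1 Y2])
    then have "dfn M (\<lambda>y. s * ?R 1 y)" by (intro dfn_mult dfn_const)
    ultimately show ?thesis
      unfolding Peq
      by (rule definable_cfunI[OF P]) (use FY in \<open>auto simp: Peq\<close>)
  qed
  moreover have "cube n \<tau> \<subseteq> (cube n \<rho> :: (nat \<Rightarrow> complex) set)"
    using \<tau>(3) \<sigma>(2) \<epsilon> by (intro polydisc_mono) linarith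
  then have "C_diff_on n (cube n \<tau>) F" by (rule C_diff_on_subset[OF F(2)])
  moreover have "cube n \<tau> \<subseteq> (cube n \<rho> :: (nat \<Rightarrow> real) set)"
    using \<tau>(3) \<sigma>(2) \<epsilon> by (intro polydisc_mono) linarith
  then have "\<forall>x\<in>cube n \<tau>. F (complex_of_real \<circ> x) = complex_of_real (f x)" using F(1) by blast
  ultimately show "X \<in> R_analytic_germs M n"
    unfolding f mem_R_analytic_germs using \<tau>(1) f_def[OF \<tau>(2)]
    by (intro exI[of _ \<tau>] exI[of _ F] conjI)
qed (use R_analytic_germs_subset in blast)

section \<open>Weierstrass division for holomorphic functions\<close>

lemma continuous_eq_at_0:
  fixes a b :: "complex \<Rightarrow> complex"
  assumes "continuous_on (ball 0 \<rho>) a" "continuous_on (ball 0 \<rho>) b" "\<rho> > 0"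
    and eq: "\<And>w. w \<in> ball 0 \<rho> \<Longrightarrow> w \<noteq> 0 \<Longrightarrow> a w = b w"
  shows "a 0 = b 0"
proof -
  have "(a \<longlongrightarrow> a 0) (at 0)" "(b \<longlongrightarrow> b 0) (at 0)"
    using assms(1-3) by (auto simp: continuous_on_eq_continuous_at isCont_def)
  moreover have "\<forall>\<^sub>F w in at 0. a w = b w"
    unfolding eventually_at using assms(3) eq by (intro exI[of _ \<rho>]) (auto simp: dist_norm)
  ultimately show ?thesis
    using Lim_transform_eventually tendsto_unique trivial_limit_at by blast
qed

text \<open>At the origin the equation gives p 0 = 0; a factor w is cancelled and d drops by one.
  The equation is only assumed for w \<noteq> 0 because cancelling w loses the origin, which
  continuity then restores.\<close>

lemma truncation_unique:
  fixes h :: "complex \<Rightarrow> complex"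
  assumes "continuous_on (ball 0 \<rho>) h" "\<rho> > 0"
    and "\<And>w. w \<in> ball 0 \<rho> \<Longrightarrow> w \<noteq> 0 \<Longrightarrow> (\<Sum>k<d. p k * w ^ k) = w ^ d * h w"
  shows "(\<forall>k<d. p k = 0) \<and> (\<forall>w\<in>ball 0 \<rho>. h w = 0)"
  using assms
proof (induction d arbitrary: p)
  case 0
  then have nz: "h w = 0" if "w \<in> ball 0 \<rho>" "w \<noteq> 0" for w using that by simp
  have "h 0 = 0" by (rule continuous_eq_at_0[OF 0(1) continuous_on_const 0(2)]) (rule nz)
  with nz show ?case by blast
next
  case (Suc d)
  have cont: "continuous_on (ball 0 \<rho>) (\<lambda>w. w ^ Suc d * h w)"
    by (intro continuous_intros Suc.prems(1))
  have "(\<lambda>w. \<Sum>k<Suc d. p k * w ^ k) 0 = (\<lambda>w. w ^ Suc d * h w) 0"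
    by (rule continuous_eq_at_0[OF _ cont Suc.prems(2)]) (intro continuous_intros, rule Suc.prems(3))
  then have p0: "p 0 = 0" by (simp add: sum.lessThan_Suc_shift)
  have "(\<Sum>k<d. p (Suc k) * w ^ k) = w ^ d * h w" if "w \<in> ball 0 \<rho>" "w \<noteq> 0" for w
  proof -
    have "(\<Sum>k<Suc d. p k * w ^ k) = w * (\<Sum>k<d. p (Suc k) * w ^ k)"
      by (subst sum.lessThan_Suc_shift) (simp add: p0 sum_distrib_left mult_ac)
    then have "w * (\<Sum>k<d. p (Suc k) * w ^ k) = w * (w ^ d * h w)"
      using Suc.prems(3)[OF that] by (simp add: mult_ac)
    then show ?thesis using that(2) by simp
  qed
  from Suc.IH[OF Suc.prems(1,2) this] have "\<forall>k<d. p (Suc k) = 0" "\<forall>w\<in>ball 0 \<rho>. h w = 0" by auto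
  then show ?case using p0 by (auto simp: less_Suc_eq_0_disj)
qed

text \<open>Zeros of E are isolated since E is not identically zero on the disc, and P / E is
  bounded near each of them, so Riemann's removable singularity theorem applies locally.\<close>

lemma bounded_quotient_holomorphic:
  assumes P: "P holomorphic_on ball 0 \<rho>" and E: "E holomorphic_on ball 0 \<rho>"
    and nz: "v \<in> ball 0 \<rho>" "E v \<noteq> 0"
    and le: "\<And>w. w \<in> ball 0 \<rho> \<Longrightarrow> norm (P w) \<le> C * norm (E w)"
  shows "\<exists>H. H holomorphic_on ball 0 \<rho> \<and> (\<forall>w\<in>ball 0 \<rho>. norm (H w) \<le> C \<and> P w = H w * E w)"
proof -
  define f where "f w = P w / E w" for w
  \<comment> \<open>Taking the limit gives a value at the zeros of E that is independent of the
    local extension, so the local pieces agree.\<close>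
  define H where "H w = Lim (at w) f" for w
  have loc: "\<exists>e>0. \<exists>g. ball a e \<subseteq> ball 0 \<rho> \<and> g holomorphic_on ball a e \<and> (\<forall>w\<in>ball a e. H w = g w) \<and>
      norm (g a) \<le> C \<and> P a = g a * E a" if a: "a \<in> ball 0 \<rho>" for a
  proof -
    obtain e where e: "e > 0" "ball a e \<subseteq> ball 0 \<rho>" "\<And>w. w \<in> ball a e \<Longrightarrow> w \<noteq> a \<Longrightarrow> E w \<noteq> 0"
    proof (cases "E a = 0")
      case True
      obtain e where "e > 0" "ball a e \<subseteq> ball 0 \<rho>" "\<And>w. w \<in> ball a e - {a} \<Longrightarrow> E w \<noteq> 0"
        by (rule isolated_zeros[OF E open_ball connected_ball a True nz]) blast
      then show thesis using that by blast
    next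
      case False
      have "isCont E a" using E a
        by (meson continuous_on_eq_continuous_at holomorphic_on_imp_continuous_on open_ball)
      then have "\<forall>\<^sub>F w in at a. E w \<noteq> 0"
        using False by (intro tendsto_imp_eventually_ne) (auto simp: isCont_def)
      then obtain e1 where e1: "e1 > 0" "\<And>w. w \<noteq> a \<Longrightarrow> dist w a < e1 \<Longrightarrow> E w \<noteq> 0"
        by (auto simp: eventually_at)
      obtain e2 where e2: "e2 > 0" "ball a e2 \<subseteq> ball 0 \<rho>" by (rule openE[OF open_ball a])
      show thesis
      proof (rule that[of "min e1 e2"])
        show "ball a (min e1 e2) \<subseteq> ball 0 \<rho>" using e2(2) by auto
        show "E w \<noteq> 0" if "w \<in> ball a (min e1 e2)" "w \<noteq> a" for w
          using that e1(2)[of w] by (simp add: dist_commute)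
      qed (use e1 e2 in auto)
    qed
    have fC: "norm (f w) \<le> C" if "w \<in> ball a e" "w \<noteq> a" for w
    proof -
      have "norm (P w) \<le> C * norm (E w)" using that e(2) le by blast
      then show ?thesis using e(3)[OF that] by (simp add: f_def norm_divide divide_le_eq)
    qed
    have "f holomorphic_on ball a e - {a}"
      unfolding f_def using e P E by (intro holomorphic_on_divide) (auto elim!: holomorphic_on_subset)
    moreover have "a \<in> interior (ball a e)" using e(1) by simp
    moreover have "\<exists>B. \<forall>\<^sub>F w in at a. norm (f w) \<le> B"
      unfolding eventually_at using e(1) fC
      by (intro exI[of _ C] exI[of _ e]) (auto simp: dist_commute)
    ultimately obtain g where g: "g holomorphic_on ball a e" "\<forall>w\<in>ball a e - {a}. g w = f w"
      using holomorphic_on_extend_bounded[of f "ball a e" a] by blast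
    have gcont: "(g \<longlongrightarrow> g w) (at w)" if "w \<in> ball a e" for w
      using g(1) that by (meson continuous_on_eq_continuous_at holomorphic_on_imp_continuous_on isCont_def open_ball)
    have ev: "\<forall>\<^sub>F v in at w. v \<in> ball a e - {a}" if "w \<in> ball a e" for w
    proof -
      have "\<forall>\<^sub>F v in at w. v \<in> ball a e" using that by (intro eventually_at_in_open') auto
      moreover have "\<forall>\<^sub>F v in at w. v \<noteq> a" by (rule eventually_neq_at_within)
      ultimately show ?thesis by eventually_elim auto
    qed
    have flim: "(f \<longlongrightarrow> g w) (at w)" if "w \<in> ball a e" for w
      by (rule Lim_transform_eventually[OF gcont[OF that]])
        (use ev[OF that] g(2) in \<open>auto elim: eventually_mono\<close>)
    have Hg: "H w = g w" if "w \<in> ball a e" for w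
      unfolding H_def by (rule tendsto_Lim[OF _ flim[OF that]]) simp
    have a': "a \<in> ball a e" using e(1) by simp
    have "norm (g a) \<le> C"
    proof (rule tendsto_upperbound[OF tendsto_norm[OF flim[OF a']]])
      show "\<forall>\<^sub>F w in at a. norm (f w) \<le> C"
        using ev[OF a'] by eventually_elim (use fC in auto)
    qed simp
    moreover have "P a = g a * E a"
    proof (rule tendsto_unique[of "at a"])
      show "(P \<longlongrightarrow> P a) (at a)"
        using P a by (meson continuous_on_eq_continuous_at holomorphic_on_imp_continuous_on isCont_def open_ball)
      have "(E \<longlongrightarrow> E a) (at a)"
        using E a by (meson continuous_on_eq_continuous_at holomorphic_on_imp_continuous_on isCont_def open_ball)
      then have "((\<lambda>w. f w * E w) \<longlongrightarrow> g a * E a) (at a)" by (intro tendsto_mult flim[OF a'])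
      then show "(P \<longlongrightarrow> g a * E a) (at a)"
        by (rule Lim_transform_eventually)
          (use ev[OF a'] in \<open>eventually_elim, use e(3) in \<open>auto simp: f_def\<close>\<close>)
    qed simp
    ultimately show ?thesis using e(1,2) g(1) Hg by blast
  qed
  have "H holomorphic_on ball 0 \<rho>"
  proof (unfold holomorphic_on_open[OF open_ball], intro ballI)
    fix a :: complex assume "a \<in> ball 0 \<rho>"
    from loc[OF this] obtain e g where e: "e > 0" "g holomorphic_on ball a e" "\<forall>w\<in>ball a e. H w = g w"
      by blast
    have "H holomorphic_on ball a e"
      using holomorphic_transform[OF e(2), of H] e(3) by simp
    then show "\<exists>f'. (H has_field_derivative f') (at a)"
      using e(1) by (simp add: holomorphic_on_open)
  qed
  moreover have "norm (H w) \<le> C \<and> P w = H w * E w" if w: "w \<in> ball 0 \<rho>" for w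
  proof -
    from loc[OF w] obtain e g where "e > 0" "\<forall>v\<in>ball w e. H v = g v" "norm (g w) \<le> C" "P w = g w * E w"
      by blast
    then show ?thesis by simp
  qed
  ultimately show ?thesis by blast
qed

text \<open>The divisor is w ^ d u(w) + \<Delta> with |\<Delta>| \<le> \<eta>. Division by w ^ d
  u(w) multiplies sup norms by at most L (3 / \<rho>) ^ d, since the d-th difference quotient costs
  (3 / \<rho>) ^ d and 1 / u costs L. The smallness condition makes this operation, followed by
  multiplication with \<Delta>, a contraction with factor 1 / 2.\<close>

locale perturbed_divisor =
  fixes d :: nat and \<rho> L \<eta> :: real and u :: "complex \<Rightarrow> complex"
  assumes rho: "\<rho> > 0" and L: "L > 0" and eta: "\<eta> > 0" and small: "L * (3 / \<rho>) ^ d * \<eta> \<le> 1 / 2"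
    and u: "u holomorphic_on ball 0 \<rho>" "\<And>w. w \<in> ball 0 \<rho> \<Longrightarrow> u w \<noteq> 0"
      "\<And>w. w \<in> ball 0 \<rho> \<Longrightarrow> norm (inverse (u w)) \<le> L"
begin

text \<open>Starting from K_0 = G, each K_j is divided exactly by w ^ d u(w) with quotient h_j, and
  K_(j+1) = - h_j \<Delta> is the error of using the true divisor instead. The errors halve at each
  step, so the quotients and the remainders can be summed to Q and R.\<close>

lemma division:
  fixes r :: "nat \<Rightarrow> real" and m :: nat
  defines "P \<equiv> polydisc (Suc m) r"
  assumes r: "r m = \<rho>" "\<And>i. i < m \<Longrightarrow> r i > 0"
    and G: "C_diff_on (Suc m) P G" "\<And>z. z \<in> P \<Longrightarrow> norm (G z) \<le> B" "B > 0"
    and \<Delta>: "C_diff_on (Suc m) P \<Delta>" "\<And>z. z \<in> P \<Longrightarrow> norm (\<Delta> z) \<le> \<eta>"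
  shows "\<exists>Q R. C_diff_on (Suc m) P Q \<and> (\<exists>C. \<forall>z\<in>P. norm (Q z) \<le> C) \<and>
    (\<forall>k<d. C_diff_on m (polydisc m r) (R k)) \<and>
    (\<forall>z\<in>P. G z = Q z * (z m ^ d * u (z m) + \<Delta> z) + (\<Sum>k<d. R k (z(m := 0)) * z m ^ k))"
proof -
  define D where "D k K = (diff_quot m ^^ k) K" for k K
  define K where "K = rec_nat G (\<lambda>_ K z. - (D d K z * inverse (u (z m)) * \<Delta> z))"
  define h where "h j z = D d (K j) z * inverse (u (z m))" for j z
  have K0: "K 0 = G" and KSuc: "K (Suc j) = (\<lambda>z. - (h j z * \<Delta> z))" for j
    by (simp_all add: K_def h_def)
  have zm: "z m \<in> ball 0 \<rho>" if "z \<in> P" for z using that r(1) by (auto simp: P_def polydisc_def)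
  have rm: "r m > 0" using r(1) rho by simp
  have Dprop: "C_diff_on (Suc m) P (D k F)" "\<And>z. z \<in> P \<Longrightarrow> norm (D k F z) \<le> b * (3 / \<rho>) ^ k"
    if "C_diff_on (Suc m) P F" "\<And>z. z \<in> P \<Longrightarrow> norm (F z) \<le> b" "b > 0" for k F b
  proof -
    note F = that(1)[unfolded P_def] that(2)[unfolded P_def]
    show "C_diff_on (Suc m) P (D k F)"
      unfolding P_def D_def by (rule diff_quot_iter(1)[OF F(1) _ that(3) lessI rm]) (rule F(2))
    show "norm (D k F z) \<le> b * (3 / \<rho>) ^ k" if "z \<in> P" for z
      unfolding D_def r(1)[symmetric]
      by (rule diff_quot_iter(2)[OF F(1) _ \<open>b > 0\<close> lessI rm that[unfolded P_def]]) (rule F(2))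
  qed
  have inv_u: "C_diff_on (Suc m) P (\<lambda>z. inverse (u (z m)))"
    by (rule C_diff_on_holomorphic_coord[where S = "ball 0 \<rho>"])
      (use u zm in \<open>auto intro!: holomorphic_intros\<close>)
  have hprop: "C_diff_on (Suc m) P (h j)" "\<And>z. z \<in> P \<Longrightarrow> norm (h j z) \<le> b * (3 / \<rho>) ^ d * L"
    if "C_diff_on (Suc m) P (K j)" "\<And>z. z \<in> P \<Longrightarrow> norm (K j z) \<le> b" "b > 0" for j b
  proof -
    show "C_diff_on (Suc m) P (h j)"
      unfolding h_def by (intro C_diff_on_mult Dprop(1)[OF that] inv_u)
    show "norm (h j z) \<le> b * (3 / \<rho>) ^ d * L" if z: "z \<in> P" for z
      unfolding h_def norm_mult
      by (intro mult_mono Dprop(2)[OF \<open>C_diff_on (Suc m) P (K j)\<close> _ \<open>b > 0\<close> z] u(3) zm z)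
        (use \<open>\<And>z. z \<in> P \<Longrightarrow> norm (K j z) \<le> b\<close> \<open>b > 0\<close> rho in auto)
  qed
  have Kprop: "C_diff_on (Suc m) P (K j) \<and> (\<forall>z\<in>P. norm (K j z) \<le> B / 2 ^ j)" for j
  proof (induction j)
    case 0
    then show ?case using G by (simp add: K0)
  next
    case (Suc j)
    have pos: "B / 2 ^ j > 0" using G(3) by simp
    note h = hprop[of j "B / 2 ^ j", OF _ _ pos]
    have "norm (K (Suc j) z) \<le> B / 2 ^ Suc j" if z: "z \<in> P" for z
    proof -
      have "norm (K (Suc j) z) \<le> B / 2 ^ j * (3 / \<rho>) ^ d * L * \<eta>"
        unfolding KSuc norm_minus_cancel norm_mult
        by (intro mult_mono h(2) \<Delta>(2) z) (use Suc G(3) rho L in auto)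
      also have "\<dots> = B / 2 ^ j * (L * (3 / \<rho>) ^ d * \<eta>)" by (simp add: mult_ac)
      also have "\<dots> \<le> B / 2 ^ j * (1 / 2)" by (intro mult_left_mono small) (use pos in simp)
      finally show ?thesis by simp
    qed
    moreover have "C_diff_on (Suc m) P (K (Suc j))"
      unfolding KSuc by (intro C_diff_on_minus C_diff_on_mult h(1) \<Delta>(1)) (use Suc in auto)
    ultimately show ?case by blast
  qed
  have pos: "B / 2 ^ j > 0" for j using G(3) by simp
  have K1: "C_diff_on (Suc m) P (K j)" and K2: "\<And>z. z \<in> P \<Longrightarrow> norm (K j z) \<le> B / 2 ^ j" for j
    using Kprop by auto
  have h1: "C_diff_on (Suc m) P (h j)" for j
    by (rule hprop(1)[OF K1 _ pos]) (rule K2)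
  have h2: "norm (h j z) \<le> B / 2 ^ j * (3 / \<rho>) ^ d * L" if "z \<in> P" for j z
    by (rule hprop(2)[OF K1 _ pos that]) (rule K2)
  have D1: "C_diff_on (Suc m) P (D k (K j))" for k j
    by (rule Dprop(1)[OF K1 _ pos]) (rule K2)
  have D2: "norm (D k (K j) z) \<le> B / 2 ^ j * (3 / \<rho>) ^ k" if "z \<in> P" for k j z
    by (rule Dprop(2)[OF K1 _ pos that]) (rule K2)
  have geo: "summable (\<lambda>j. B / 2 ^ j * c)" for c
  proof -
    have "summable (\<lambda>j. B * c * (1 / 2) ^ j)" by (intro summable_mult summable_geometric) simp
    then show ?thesis by (simp add: power_divide mult_ac)
  qed
  have geo_d: "summable (\<lambda>j. B / 2 ^ j * (3 / \<rho>) ^ d * L)"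
    using geo[of "(3 / \<rho>) ^ d * L"] by (simp add: mult.assoc)
  define Q where "Q z = (\<Sum>j. h j z)" for z
  define R where "R k z = (\<Sum>j. D k (K j) z)" for k z
  have "uniform_limit P (\<lambda>n z. \<Sum>j<n. h j z) Q sequentially"
    unfolding Q_def by (rule Weierstrass_m_test[OF h2 geo_d])
  then have Q1: "C_diff_on (Suc m) P Q"
    unfolding P_def
    by (rule C_diff_on_uniform_limit[rotated])
      (use h1 in \<open>auto simp: P_def intro!: C_diff_on_sum always_eventually\<close>)
  have hs: "summable (\<lambda>j. h j z)" if "z \<in> P" for z
    by (rule summable_comparison_test'[OF geo_d h2[OF that]])
  have Q2: "norm (Q z) \<le> (\<Sum>j. B / 2 ^ j * (3 / \<rho>) ^ d * L)" if "z \<in> P" for z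
    unfolding Q_def by (rule norm_suminf_le[OF h2[OF that] geo_d])
  have sub: "polydisc m r \<subseteq> P" unfolding P_def using polydisc_subset_Suc[of r m] rm by blast
  have "uniform_limit (polydisc m r) (\<lambda>n z. \<Sum>j<n. D k (K j) z) (R k) sequentially" for k
    unfolding R_def by (rule Weierstrass_m_test[OF D2 geo]) (use sub in blast)
  then have R1: "C_diff_on m (polydisc m r) (R k)" for k
    by (rule C_diff_on_uniform_limit[rotated])
      (auto intro!: C_diff_on_sum always_eventually
        C_diff_on_le[OF C_diff_on_subset[OF D1 sub]])
  have "G z = Q z * (z m ^ d * u (z m) + \<Delta> z) + (\<Sum>k<d. R k (z(m := 0)) * z m ^ k)" if z: "z \<in> P" for z
  proof -
    let ?w = "z m"
    have z0: "z(m := 0) \<in> P"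
      using polydisc_upd[OF z[unfolded P_def] lessI] rm by (simp add: P_def)
    have split: "K j z = h j z * (?w ^ d * u ?w) + (\<Sum>k<d. D k (K j) (z(m := 0)) * ?w ^ k)" for j
      using diff_quot_expand[of "K j" z m d] u(2)[OF zm[OF z]] by (simp add: h_def D_def)
    have hQ: "(\<lambda>j. h j z) sums Q z" unfolding Q_def by (rule summable_sums[OF hs[OF z]])
    have "(\<lambda>j. D k (K j) (z(m := 0))) sums R k (z(m := 0))" for k
      unfolding R_def by (rule summable_sums, rule summable_comparison_test'[OF geo D2[OF z0]])
    then have "(\<lambda>j. K j z) sums (Q z * (?w ^ d * u ?w) + (\<Sum>k<d. R k (z(m := 0)) * ?w ^ k))"
      unfolding split by (intro sums_add sums_mult2 hQ sums_sum)
    moreover have "(\<lambda>j. K (Suc j) z) sums (- (Q z * \<Delta> z))"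
      unfolding KSuc by (intro sums_minus sums_mult2 hQ)
    \<comment> \<open>The sum of all K_j is computed a second time from the shifted series, whose
      missing term is K_0 = G; comparing both values is the division identity.\<close>
    then have "(\<lambda>j. K j z) sums (- (Q z * \<Delta> z) + K 0 z)" by (rule sums_Suc)
    ultimately have "Q z * (?w ^ d * u ?w) + (\<Sum>k<d. R k (z(m := 0)) * ?w ^ k) = - (Q z * \<Delta> z) + G z"
      by (simp add: sums_unique2 K0)
    then show ?thesis by (simp add: algebra_simps)
  qed
  then show ?thesis using Q1 Q2 R1 by (intro exI[of _ Q] exI[of _ R] conjI) blast+
qed

text \<open>At \<rho> / 2 the main term is at least (\<rho> / 2) ^ d / L. A zero would force this
  below \<eta>, and the smallness condition would give (3 / 2) ^ d \<le> 1 / 2. One nonzero value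
  shows that the divisor does not vanish identically on any complex line parallel to the last
  axis.\<close>

lemma divisor_nonzero:
  assumes "norm \<delta> \<le> \<eta>"
  shows "of_real (\<rho> / 2) ^ d * u (of_real (\<rho> / 2)) + \<delta> \<noteq> 0"
proof
  let ?w = "complex_of_real (\<rho> / 2)"
  assume 0: "?w ^ d * u ?w + \<delta> = 0"
  have w: "?w \<in> ball 0 \<rho>" using rho by simp
  have "norm (?w ^ d * u ?w) \<le> \<eta>"
    using 0 assms by (metis add_eq_0_iff norm_minus_cancel)
  then have a: "(\<rho> / 2) ^ d * norm (u ?w) \<le> \<eta>"
    using rho by (simp add: norm_mult norm_power norm_divide)
  have "1 \<le> L * norm (u ?w)"
    using u(2)[OF w] u(3)[OF w, unfolded norm_inverse] by (simp add: inverse_eq_divide divide_le_eq)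
  then have "(\<rho> / 2) ^ d * 1 \<le> (\<rho> / 2) ^ d * (L * norm (u ?w))" using rho by (intro mult_left_mono) auto
  also have "\<dots> = L * ((\<rho> / 2) ^ d * norm (u ?w))" by (simp only: mult_ac)
  also have "\<dots> \<le> L * \<eta>" using mult_left_mono[OF a] L by simp
  finally have "(\<rho> / 2) ^ d \<le> L * \<eta>" by simp
  then have "(3 / \<rho>) ^ d * (\<rho> / 2) ^ d \<le> (3 / \<rho>) ^ d * (L * \<eta>)" using rho by (intro mult_left_mono) auto
  also have "\<dots> \<le> 1 / 2" using small by (simp add: mult_ac)
  finally have "(3 / 2) ^ d \<le> (1 / 2 :: real)" using rho by (simp add: power_mult_distrib[symmetric])
  moreover have "(3 / 2) ^ d \<ge> (1 :: real)" by (rule one_le_power) simp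
  ultimately show False by simp
qed

text \<open>The bound gives p = H E with bounded holomorphic H, that is, p - H \<Delta> = w ^ d u H.
  Comparison with the Taylor formula of - H \<Delta> shows that u H is the d-th difference quotient
  of - H \<Delta>, so the contraction estimate halves every bound for H. Therefore H = 0 and p =
  0.\<close>

lemma remainder_unique:
  assumes \<Delta>: "\<Delta> holomorphic_on ball 0 \<rho>" "\<And>w. w \<in> ball 0 \<rho> \<Longrightarrow> norm (\<Delta> w) \<le> \<eta>"
    and le: "\<And>w. w \<in> ball 0 \<rho> \<Longrightarrow> norm (\<Sum>k<d. p k * w ^ k) \<le> C * norm (w ^ d * u w + \<Delta> w)"
    and k: "k < d"
  shows "p k = 0"
proof -
  let ?E = "\<lambda>w. w ^ d * u w + \<Delta> w" and ?p = "\<lambda>w. \<Sum>k<d. p k * w ^ k"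
  have E: "?E holomorphic_on ball 0 \<rho>" by (intro holomorphic_intros u \<Delta>)
  have half: "complex_of_real (\<rho> / 2) \<in> ball 0 \<rho>" using rho by simp
  have nz: "?E (of_real (\<rho> / 2)) \<noteq> 0" by (rule divisor_nonzero[OF \<Delta>(2)[OF half]])
  have "?p holomorphic_on ball 0 \<rho>" by (intro holomorphic_intros)
  from bounded_quotient_holomorphic[OF this E half nz le]
  obtain H where H: "H holomorphic_on ball 0 \<rho>"
    and HC: "\<forall>w\<in>ball 0 \<rho>. norm (H w) \<le> C \<and> ?p w = H w * ?E w"
    by blast
  have halve: "norm (H w) \<le> S / 2" if S: "S > 0" "\<And>w. w \<in> ball 0 \<rho> \<Longrightarrow> norm (H w) \<le> S" and w: "w \<in> ball 0 \<rho>" for S w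
  proof -
    \<comment> \<open>Functions of one variable are viewed on a one-dimensional polydisc so that the
      difference quotient estimates apply.\<close>
    let ?P = "polydisc 1 (\<lambda>_. \<rho>) :: (nat \<Rightarrow> complex) set"
    define K where "K z = - (H (z 0) * \<Delta> (z 0))" for z :: "nat \<Rightarrow> complex"
    let ?z = "\<lambda>w. (\<lambda>_. 0)(0 := w) :: nat \<Rightarrow> complex"
    define b where "b j = (diff_quot 0 ^^ j) K (\<lambda>_. 0)" for j
    define T where "T w = (diff_quot 0 ^^ d) K (?z w)" for w
    have zP: "?z w \<in> ?P \<longleftrightarrow> w \<in> ball 0 \<rho>" for w by (auto simp: polydisc_def tuples_def)
    have K1: "C_diff_on 1 ?P K"
      unfolding K_def
      by (rule C_diff_on_holomorphic_coord[where h = "\<lambda>w. - (H w * \<Delta> w)" and S = "ball 0 \<rho>"])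
        (auto intro!: holomorphic_intros H \<Delta> simp: polydisc_def)
    have K2: "norm (K z) \<le> S * \<eta>" if "z \<in> ?P" for z
      unfolding K_def norm_minus_cancel norm_mult
      by (intro mult_mono S(2) \<Delta>(2)) (use that S(1) in \<open>auto simp: polydisc_def\<close>)
    have pos: "S * \<eta> > 0" using S(1) eta by simp
    have it: "norm ((diff_quot 0 ^^ d) K z) \<le> S * \<eta> * (3 / \<rho>) ^ d" if "z \<in> ?P" for z
      by (rule diff_quot_iter(2)[OF K1 _ pos]) (use that K2 rho in auto)
    have Tb: "norm (T w) \<le> S * \<eta> * (3 / \<rho>) ^ d" if "w \<in> ball 0 \<rho>" for w
      unfolding T_def by (rule it) (use zP that in auto)
    have Tc: "continuous_on (ball 0 \<rho>) T"
    proof -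
      have "C_diff_on 1 ?P ((diff_quot 0 ^^ d) K)" by (rule diff_quot_iter(1)[OF K1 _ pos]) (use K2 rho in auto)
      then have "(\<lambda>w. (diff_quot 0 ^^ d) K ((\<lambda>_. 0)(0 := w))) holomorphic_on ball 0 \<rho>"
        by (rule C_diff_on_line) (use rho in \<open>auto simp: polydisc_def tuples_def\<close>)
      then show ?thesis unfolding T_def by (rule holomorphic_on_imp_continuous_on)
    qed
    have expand: "K (?z w) = (\<Sum>k<d. b k * w ^ k) + w ^ d * T w" for w
      using diff_quot_expand[of K "?z w" 0 d] by (simp add: b_def T_def fun_upd_idem)
    have eq: "(\<Sum>k<d. (p k + b k) * w ^ k) = w ^ d * (u w * H w - T w)" if "w \<in> ball 0 \<rho>" for w
    proof -
      have "?p w + K (?z w) = w ^ d * u w * H w" using HC that by (simp add: K_def algebra_simps)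
      then show ?thesis unfolding expand by (simp add: algebra_simps sum.distrib)
    qed
    have "continuous_on (ball 0 \<rho>) (\<lambda>w. u w * H w - T w)"
      by (intro continuous_intros holomorphic_on_imp_continuous_on H u(1) Tc)
    from truncation_unique[OF this rho eq] have "\<forall>w\<in>ball 0 \<rho>. u w * H w - T w = 0" by blast
    then have "H w = inverse (u w) * T w" using w u(2)[OF w] by (auto simp: field_simps)
    then have "norm (H w) = norm (inverse (u w)) * norm (T w)" by (simp only: norm_mult)
    also have "\<dots> \<le> L * (S * \<eta> * (3 / \<rho>) ^ d)"
      by (intro mult_mono u(3) Tb w) (use L in auto)
    also have "\<dots> = S * (L * (3 / \<rho>) ^ d * \<eta>)" by (simp add: mult_ac)
    also have "\<dots> \<le> S * (1 / 2)" by (intro mult_left_mono small) (use S(1) in simp)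
    finally show ?thesis by simp
  qed
  have C0: "C \<ge> 0" using HC half norm_ge_zero order_trans by blast
  \<comment> \<open>C may be 0 and \<open>halve\<close> asks for a positive bound, hence C +
    1.\<close>
  have "\<forall>w\<in>ball 0 \<rho>. norm (H w) \<le> (C + 1) / 2 ^ j" for j
  proof (induction j)
    case 0
    then show ?case using HC by (auto intro: order_trans)
  next
    case (Suc j)
    show ?case using halve[of "(C + 1) / 2 ^ j"] Suc C0 by (simp add: field_simps)
  qed
  then have "norm (H w) \<le> (C + 1) * (1 / 2) ^ j" if "w \<in> ball 0 \<rho>" for w j
    using that by (simp add: power_divide)
  moreover have "(\<lambda>j. (C + 1) * (1 / 2) ^ j) \<longlonglongrightarrow> 0"
    by (intro tendsto_mult_right_zero LIMSEQ_power_zero) simp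
  ultimately have "norm (H w) \<le> 0" if "w \<in> ball 0 \<rho>" for w
    using that by (intro LIMSEQ_le_const) auto
  then have "(\<Sum>k<d. p k * w ^ k) = w ^ d * 0" if "w \<in> ball 0 \<rho>" for w
    using HC that by simp
  then show ?thesis
    using truncation_unique[of \<rho> "\<lambda>_. 0" p d] rho k by auto
qed

end

section \<open>Definability of quotient and remainder\<close>

text \<open>For functions given implicitly: \<Gamma> characterises the value instead of computing
  it.\<close>

lemma definable_fun_graphI:
  assumes "dpred M P" and \<Gamma>: "dpred M (\<lambda>e. \<Gamma> (e 0) (\<lambda>i. e (Suc i)))"
    and eq: "\<And>x y. x \<in> tuples n \<Longrightarrow> P x \<Longrightarrow> \<Gamma> y x \<longleftrightarrow> y = f x"
  shows "definable_fun M n {x \<in> tuples n. P x} f"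
proof -
  have "dpred M (\<lambda>e. \<Gamma> (e 0) ((\<lambda>i. e (Suc i))(n := 0)))"
    using dpred_upd0[OF \<Gamma>, of "Suc n"] by (simp add: fun_upd_def)
  \<comment> \<open>The renaming moves the value from index 0 to index n, its place in the
    graph.\<close>
  from dpred_rename[OF this, of "case_nat n (\<lambda>i. i)"]
  have "dpred M (\<lambda>x. \<Gamma> (x n) (x(n := 0)))" by simp
  then have "dpred M (\<lambda>x. P (x(n := 0)) \<and> \<Gamma> (x n) (x(n := 0)))"
    by (intro dpred_conj dpred_upd0 assms(1))
  moreover have "graph_on n {x \<in> tuples n. P x} f =
      {x \<in> tuples (Suc n). P (x(n := 0)) \<and> \<Gamma> (x n) (x(n := 0))}"
    using eq tuples_upd_0 by (subst set_eq_iff, subst mem_graph_on) auto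
  ultimately show ?thesis
    unfolding definable_fun_def using definableI by fastforce
qed

section \<open>Complex-valued definable functions of the assignment\<close>

definition cdfn :: "('f, 'r) expansion_of_reals \<Rightarrow> ((nat \<Rightarrow> real) \<Rightarrow> complex) \<Rightarrow> bool" where
  "cdfn M h \<longleftrightarrow> dfn M (\<lambda>e. Re (h e)) \<and> dfn M (\<lambda>e. Im (h e))"

lemma cdfn_Complex: "dfn M s \<Longrightarrow> dfn M t \<Longrightarrow> cdfn M (\<lambda>e. Complex (s e) (t e))"
  by (simp add: cdfn_def)

lemma cdfn_of_real: "dfn M s \<Longrightarrow> cdfn M (\<lambda>e. of_real (s e))"
  by (simp add: cdfn_def dfn_const)

lemma cdfn_const: "cdfn M (\<lambda>e. c)"
  by (simp add: cdfn_def dfn_const)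

lemma cdfn_add: "cdfn M s \<Longrightarrow> cdfn M t \<Longrightarrow> cdfn M (\<lambda>e. s e + t e)"
  by (auto simp: cdfn_def intro!: dfn_add)

lemma cdfn_diff: "cdfn M s \<Longrightarrow> cdfn M t \<Longrightarrow> cdfn M (\<lambda>e. s e - t e)"
  by (auto simp: cdfn_def intro!: dfn_diff)

lemma cdfn_mult: "cdfn M s \<Longrightarrow> cdfn M t \<Longrightarrow> cdfn M (\<lambda>e. s e * t e)"
  by (auto simp: cdfn_def intro!: dfn_diff dfn_add dfn_mult)

lemma cdfn_power: "cdfn M s \<Longrightarrow> cdfn M (\<lambda>e. s e ^ k)"
  by (induction k) (auto intro: cdfn_mult cdfn_const)

lemma cdfn_sum: "(\<And>k. k \<in> I \<Longrightarrow> cdfn M (s k)) \<Longrightarrow> cdfn M (\<lambda>e. \<Sum>k\<in>I. s k e)"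
  by (induction I rule: infinite_finite_induct) (auto intro: cdfn_add cdfn_const)

text \<open>The condition does not depend on the assignment; it serves for case distinctions on
  coordinate indices.\<close>

lemma cdfn_cond: "(b \<Longrightarrow> cdfn M s) \<Longrightarrow> (\<not> b \<Longrightarrow> cdfn M t) \<Longrightarrow> cdfn M (\<lambda>e. if b then s e else t e)"
  by (cases b) simp_all

lemma dfn_cond: "(b \<Longrightarrow> dfn M s) \<Longrightarrow> (\<not> b \<Longrightarrow> dfn M t) \<Longrightarrow> dfn M (\<lambda>e. if b then s e else t e)"
  by (cases b) simp_all

lemma dfn_norm_squared: "cdfn M h \<Longrightarrow> dfn M (\<lambda>e. (norm (h e))\<^sup>2)"
  unfolding cmod_power2 cdfn_def by (intro dfn_add dfn_power) auto

lemma cdfn_definable_cfun: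
  assumes "definable_cfun M n V F" "\<And>e. Z e \<in> tuples n" "\<And>i. i < n \<Longrightarrow> cdfn M (\<lambda>e. Z e i)"
  shows "cdfn M (\<lambda>e. if Z e \<in> V then F (Z e) else 0)"
  using dpred_dom_definable_cfun(2,3)[OF assms(1,2)] assms(3) by (simp add: cdfn_def)

text \<open>The value y is described as the real part of coefficient k of some polynomial of degree
  less than d whose difference from G is bounded by a multiple of F on the disc.
  \<open>division\<close> supplies such a polynomial, with Q as the bounded factor, and
  \<open>remainder_unique\<close> shows that there is only one.\<close>

lemma (in perturbed_divisor) definable_remainder:
  fixes r :: "nat \<Rightarrow> real" and m :: nat
  defines "P \<equiv> polydisc (Suc m) r"
  assumes F: "definable_cfun M (Suc m) V F" and G: "definable_cfun M (Suc m) V G" and V: "P \<subseteq> V"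
    and r: "r m = \<rho>"
    and \<Delta>: "C_diff_on (Suc m) P \<Delta>" "\<And>z. z \<in> P \<Longrightarrow> norm (\<Delta> z) \<le> \<eta>"
    and F\<Delta>: "\<And>z. z \<in> P \<Longrightarrow> F z = z m ^ d * u (z m) + \<Delta> z"
    and div: "\<And>z. z \<in> P \<Longrightarrow> G z = Q z * F z + (\<Sum>k<d. R k (z(m := 0)) * z m ^ k)"
    and Q: "\<And>z. z \<in> P \<Longrightarrow> norm (Q z) \<le> C"
    and k: "k < d"
  shows "definable_fun M m (polydisc m r) (\<lambda>x. Re (R k (complex_of_real \<circ> x)))"
proof -
  define Z where "Z x a b = (\<lambda>i. if i < m then complex_of_real (x i) else if i = m then Complex a b else 0)"
    for x :: "nat \<Rightarrow> real" and a b
  \<comment> \<open>Squared norms avoid roots in the formula. The default 0 outside V makes the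
    functions total and is never met on the disc, as P lies in V.\<close>
  define N where "N x Y a b = (norm ((if Z x a b \<in> V then G (Z x a b) else 0) -
      (\<Sum>j<d. Complex (Y j) (Y (d + j)) * Complex a b ^ j)))\<^sup>2" for x Y a b
  define N' where "N' x a b = (norm (if Z x a b \<in> V then F (Z x a b) else 0))\<^sup>2" for x a b
  define \<Gamma> where "\<Gamma> y x \<longleftrightarrow>
    (\<exists>Y. y = Y k \<and> (\<exists>c. \<forall>a b. a * a + b * b < \<rho>\<^sup>2 \<longrightarrow> N x Y a b \<le> c * N' x a b))" for y :: real and x
  \<comment> \<open>Layout of the variables: the 2 d real coordinates of the coefficients, real
    parts before imaginary parts, then y at index 2 d, then x.\<close>
  define \<Phi> where "\<Phi> e \<longleftrightarrow> e (2 * d) = e k \<and> (\<exists>c. \<forall>a. \<forall>b. a * a + b * b < \<rho>\<^sup>2 \<longrightarrow>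
      N (\<lambda>i. e (2 * d + 1 + i)) e a b \<le> c * N' (\<lambda>i. e (2 * d + 1 + i)) a b)" for e :: "nat \<Rightarrow> real"
  have "dpred M \<Phi>"
    unfolding \<Phi>_def N_def N'_def Z_def
    by (intro dpred_conj dpred_eq dfn_var dpred_ex dpred_all dpred_imp dpred_less dpred_le dfn_add dfn_mult
        dfn_const dfn_norm_squared cdfn_diff cdfn_sum cdfn_mult cdfn_Complex cdfn_power
        cdfn_definable_cfun[OF F] cdfn_definable_cfun[OF G] cdfn_cond cdfn_of_real cdfn_const)
      (auto simp: tuples_def)
  from dpred_ex_block[OF this, of "2 * d"]
  have dp: "dpred M (\<lambda>e. \<exists>Y. \<Phi> (\<lambda>i. if i < 2 * d then Y i else e (i - 2 * d)))" .
  have "\<Phi> (\<lambda>i. if i < 2 * d then Y i else e (i - 2 * d)) \<longleftrightarrow>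
      (e 0 = Y k \<and> (\<exists>c. \<forall>a b. a * a + b * b < \<rho>\<^sup>2 \<longrightarrow> N (\<lambda>i. e (Suc i)) Y a b \<le> c * N' (\<lambda>i. e (Suc i)) a b))" for e Y
    unfolding \<Phi>_def N_def using k by simp
  with dp have d\<Gamma>: "dpred M (\<lambda>e. \<Gamma> (e 0) (\<lambda>i. e (Suc i)))" by (simp add: \<Gamma>_def)
  have "\<Gamma> y x \<longleftrightarrow> y = Re (R k (complex_of_real \<circ> x))" if x: "x \<in> polydisc m r" for x y
  proof -
    let ?x = "complex_of_real \<circ> x"
    have xt: "x \<in> tuples m" and xc: "?x \<in> polydisc m r" using x by (auto simp: polydisc_def tuples_def)
    have Zw: "Z x (Re w) (Im w) = ?x(m := w)" for w
      using xt by (auto simp: Z_def fun_eq_iff tuples_def)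
    have ZP: "?x(m := w) \<in> P" if "w \<in> ball 0 \<rho>" for w
      unfolding P_def by (rule polydisc_Suc_upd[OF xc]) (use that r in simp)
    have x0: "(?x(m := w))(m := 0) = ?x" for w using xt by (simp add: fun_upd_idem tuples_def)
    have N_eq: "N x Y (Re w) (Im w) = (norm (G (?x(m := w)) - (\<Sum>j<d. Complex (Y j) (Y (d + j)) * w ^ j)))\<^sup>2"
      and N'_eq: "N' x (Re w) (Im w) = (norm (F (?x(m := w))))\<^sup>2" if "w \<in> ball 0 \<rho>" for w Y
      using ZP[OF that] V by (auto simp: N_def N'_def Zw)
    have bd: "norm (G (?x(m := w)) - (\<Sum>j<d. R j ?x * w ^ j)) \<le> C * norm (F (?x(m := w)))"
      if "w \<in> ball 0 \<rho>" for w
    proof -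
      have "G (?x(m := w)) - (\<Sum>j<d. R j ?x * w ^ j) = Q (?x(m := w)) * F (?x(m := w))"
        using div[OF ZP[OF that]] unfolding x0 by simp
      then show ?thesis using Q[OF ZP[OF that]] by (simp add: norm_mult mult_right_mono)
    qed
    have ball: "Complex a b \<in> ball 0 \<rho> \<longleftrightarrow> a * a + b * b < \<rho>\<^sup>2" for a b
      using rho real_sqrt_less_iff[of "a\<^sup>2 + b\<^sup>2" "\<rho>\<^sup>2"] by (simp add: cmod_def power2_eq_square)
    show ?thesis
    proof
      assume "y = Re (R k ?x)"
      define Y where "Y i = (if i < d then Re (R i ?x) else Im (R (i - d) ?x))" for i
      have "N x Y a b \<le> C\<^sup>2 * N' x a b" if "a * a + b * b < \<rho>\<^sup>2" for a b
      proof -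
        have w: "Complex a b \<in> ball 0 \<rho>" using ball that by blast
        have "(\<Sum>j<d. Complex (Y j) (Y (d + j)) * Complex a b ^ j) = (\<Sum>j<d. R j ?x * Complex a b ^ j)"
          by (intro sum.cong) (auto simp: Y_def)
        then show ?thesis
          using N_eq[OF w, of Y] N'_eq[OF w] power_mono[OF bd[OF w], of 2] by (simp add: power_mult_distrib)
      qed
      then show "\<Gamma> y x" unfolding \<Gamma>_def using \<open>y = Re (R k ?x)\<close> k
        by (intro exI[of _ Y] conjI exI[of _ "C\<^sup>2"]) (auto simp: Y_def)
    next
      assume "\<Gamma> y x"
      then obtain Y c where y: "y = Y k" and Y: "\<And>a b. a * a + b * b < \<rho>\<^sup>2 \<Longrightarrow> N x Y a b \<le> c * N' x a b"
        unfolding \<Gamma>_def by blast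
      let ?Y = "\<lambda>j. Complex (Y j) (Y (d + j))"
      have hol: "(\<lambda>w. \<Delta> (?x(m := w))) holomorphic_on ball 0 \<rho>"
      proof -
        have "?x \<in> polydisc (Suc m) r" using xc polydisc_subset_Suc[of r m] r rho by blast
        from C_diff_on_line[OF \<Delta>(1)[unfolded P_def] this lessI] show ?thesis by (simp add: r)
      qed
      \<comment> \<open>The difference of two admissible polynomials is again bounded by a multiple
        of F, so uniqueness applies to it.\<close>
      have "?Y k - R k ?x = 0"
      proof (rule remainder_unique[OF hol _ _ k])
        show "norm (\<Delta> (?x(m := w))) \<le> \<eta>" if "w \<in> ball 0 \<rho>" for w by (rule \<Delta>(2)[OF ZP[OF that]])
        fix w :: complex assume w: "w \<in> ball 0 \<rho>"
        let ?F = "F (?x(m := w))" and ?G = "G (?x(m := w))"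
        let ?S = "\<Sum>j<d. ?Y j * w ^ j" and ?T = "\<Sum>j<d. R j ?x * w ^ j"
        have "(norm (?G - ?S))\<^sup>2 \<le> c * (norm ?F)\<^sup>2"
          using Y[of "Re w" "Im w"] ball[of "Re w" "Im w"] w unfolding N_eq[OF w] N'_eq[OF w] by simp
        \<comment> \<open>The formula does not fix the sign of c, hence the absolute value under the
          root.\<close>
        also have "\<dots> \<le> (sqrt \<bar>c\<bar> * norm ?F)\<^sup>2" by (simp add: power_mult_distrib mult_right_mono)
        finally have "norm (?G - ?S) \<le> sqrt \<bar>c\<bar> * norm ?F" by (rule power2_le_imp_le) simp
        moreover have "norm (?T - ?S) \<ge> norm (?S - ?T)" by (simp add: norm_minus_commute)
        moreover have "norm (?S - ?T) \<le> norm (?G - ?T) + norm (?G - ?S)"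
          using norm_triangle_ineq4[of "?G - ?T" "?G - ?S"] by simp
        ultimately have "norm (?S - ?T) \<le> (C + sqrt \<bar>c\<bar>) * norm ?F"
          using bd[OF w] by (simp add: algebra_simps)
        moreover have "(\<Sum>j<d. (?Y j - R j ?x) * w ^ j) = ?S - ?T"
          by (simp add: sum_subtractf algebra_simps)
        moreover have "?F = w ^ d * u w + \<Delta> (?x(m := w))" using F\<Delta>[OF ZP[OF w]] by simp
        ultimately show "norm (\<Sum>j<d. (?Y j - R j ?x) * w ^ j) \<le> (C + sqrt \<bar>c\<bar>) * norm (w ^ d * u w + \<Delta> (?x(m := w)))"
          by simp
      qed
      then show "y = Re (R k ?x)" using y by (metis complex.sel(1) eq_iff_diff_eq_0)
    qed
  qed
  then show ?thesis
    unfolding polydisc_eq_real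
    by (intro definable_fun_graphI[OF dpred_polydisc d\<Gamma>]) (auto simp: polydisc_eq_real)
qed

text \<open>Where f is nonzero, q is (g - remainder) / f. At zeros of f it is the limit of such
  values along the last coordinate, where nonzeros of f are dense by assumption.\<close>

lemma definable_quotient:
  fixes r :: "nat \<Rightarrow> real" and m :: nat
  defines "P \<equiv> polydisc (Suc m) r"
  assumes f: "definable_fun M (Suc m) P f" and g: "definable_fun M (Suc m) P g"
    and R: "\<And>k. k < d \<Longrightarrow> definable_fun M m (polydisc m r) (R k)"
    and div: "\<And>x. x \<in> P \<Longrightarrow> g x = q x * f x + (\<Sum>k<d. R k (x(m := 0)) * x m ^ k)"
    and cont: "\<And>x. x \<in> P \<Longrightarrow> isCont (\<lambda>t. q (x(m := t))) (x m)"
    and nz: "\<And>x \<delta>. x \<in> P \<Longrightarrow> \<delta> > 0 \<Longrightarrow> \<exists>t. \<bar>t - x m\<bar> < \<delta> \<and> \<bar>t\<bar> < r m \<and> f (x(m := t)) \<noteq> 0"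
  shows "definable_fun M (Suc m) P q"
proof -
  define X where "X x t = (\<lambda>i. if i < m then x i else if i = m then t else 0)" for x :: "nat \<Rightarrow> real" and t :: real
  define f' where "f' x t = (if X x t \<in> P then f (X x t) else 0)" for x t
  define g' where "g' x t = (if X x t \<in> P then g (X x t) else 0)" for x t
  define R' where "R' k x = (if X x 0 \<in> polydisc m r then R k (X x 0) else 0)" for k x
  \<comment> \<open>The limit statement |q - y| \<le> \<epsilon> is multiplied by |f|; this removes
    the division and makes the condition trivially true at zeros of f.\<close>
  define \<Gamma> where "\<Gamma> y x \<longleftrightarrow> (\<forall>\<epsilon>. 0 < \<epsilon> \<longrightarrow> (\<exists>\<delta>. 0 < \<delta> \<and> (\<forall>t. \<bar>t - x m\<bar> < \<delta> \<longrightarrow> \<bar>t\<bar> < r m \<longrightarrow>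
     \<bar>g' x t - (\<Sum>k<d. R' k x * t ^ k) - y * f' x t\<bar> \<le> \<epsilon> * \<bar>f' x t\<bar>)))" for y x
  have Xt: "X x t \<in> tuples (Suc m)" "X x 0 \<in> tuples m" for x t by (auto simp: X_def tuples_def)
  have dX: "dfn M (\<lambda>e. X (\<lambda>i. e (s i)) (e j) l)" "dfn M (\<lambda>e. X (\<lambda>i. e (s i)) 0 l)" for s j l
    unfolding X_def by (intro dfn_cond dfn_var dfn_const)+
  have df: "dfn M (\<lambda>e. f' (\<lambda>i. e (s i)) (e j))" for s j
    unfolding f'_def by (rule dpred_dom_definable_fun(2)[OF f]) (rule Xt dX)+
  have dg: "dfn M (\<lambda>e. g' (\<lambda>i. e (s i)) (e j))" for s j
    unfolding g'_def by (rule dpred_dom_definable_fun(2)[OF g]) (rule Xt dX)+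
  have dR: "dfn M (\<lambda>e. R' k (\<lambda>i. e (s i)))" if "k < d" for s k
    unfolding R'_def by (rule dpred_dom_definable_fun(2)[OF R[OF that]]) (rule Xt dX)+
  have d\<Gamma>: "dpred M (\<lambda>e. \<Gamma> (e 0) (\<lambda>i. e (Suc i)))"
    unfolding \<Gamma>_def
    by (intro dpred_all dpred_imp dpred_ex dpred_conj dpred_less dpred_le dfn_abs dfn_diff dfn_mult
        df dg dfn_sum dR dfn_power dfn_var dfn_const) auto
  have "\<Gamma> y x \<longleftrightarrow> y = q x" if x: "x \<in> P" for x y
  proof -
    have Xx: "X x t = x(m := t)" for t
      using x by (auto simp: X_def P_def polydisc_def tuples_def fun_eq_iff)
    have xP: "x(m := t) \<in> P \<longleftrightarrow> \<bar>t\<bar> < r m" for t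
      using polydisc_upd[OF x[unfolded P_def] lessI] by (simp add: P_def)
    have x0: "x(m := 0) \<in> polydisc m r" using polydisc_Suc_upd_0 x P_def by blast
    have eq: "g' x t - (\<Sum>k<d. R' k x * t ^ k) - y * f' x t = (q (x(m := t)) - y) * f (x(m := t))"
      and f'_eq: "f' x t = f (x(m := t))" if "\<bar>t\<bar> < r m" for t y
      using div[of "x(m := t)"] that x0 xP by (auto simp: f'_def g'_def R'_def Xx algebra_simps)
    show ?thesis
    proof
      assume y: "y = q x"
      show "\<Gamma> y x"
        unfolding \<Gamma>_def
      proof (intro allI impI)
        fix \<epsilon> :: real assume "\<epsilon> > 0"
        with cont[OF x] obtain \<delta> where \<delta>: "\<delta> > 0" "\<And>t. dist t (x m) < \<delta> \<Longrightarrow> dist (q (x(m := t))) (q (x(m := x m))) < \<epsilon>"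
          unfolding continuous_at_eps_delta by blast
        have "\<bar>g' x t - (\<Sum>k<d. R' k x * t ^ k) - y * f' x t\<bar> \<le> \<epsilon> * \<bar>f' x t\<bar>"
          if t: "\<bar>t - x m\<bar> < \<delta>" "\<bar>t\<bar> < r m" for t
        proof -
          have "\<bar>q (x(m := t)) - y\<bar> \<le> \<epsilon>" using \<delta>(2)[of t] t y by (simp add: dist_real_def)
          then have "\<bar>q (x(m := t)) - y\<bar> * \<bar>f (x(m := t))\<bar> \<le> \<epsilon> * \<bar>f (x(m := t))\<bar>"
            by (intro mult_right_mono) auto
          then show ?thesis using eq[OF t(2), of y] f'_eq[OF t(2)] by (simp add: abs_mult)
        qed
        then show "\<exists>\<delta>>0. \<forall>t. \<bar>t - x m\<bar> < \<delta> \<longrightarrow> \<bar>t\<bar> < r m \<longrightarrow>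
            \<bar>g' x t - (\<Sum>k<d. R' k x * t ^ k) - y * f' x t\<bar> \<le> \<epsilon> * \<bar>f' x t\<bar>"
          using \<delta>(1) by blast
      qed
    next
      assume \<Gamma>: "\<Gamma> y x"
      have "\<bar>q x - y\<bar> \<le> e" if e: "e > 0" for e
      proof -
        from e have e2: "e / 2 > 0" by simp
        with \<Gamma> obtain \<delta> where \<delta>: "\<delta> > 0" "\<And>t. \<bar>t - x m\<bar> < \<delta> \<Longrightarrow> \<bar>t\<bar> < r m \<Longrightarrow>
            \<bar>g' x t - (\<Sum>k<d. R' k x * t ^ k) - y * f' x t\<bar> \<le> e / 2 * \<bar>f' x t\<bar>"
          unfolding \<Gamma>_def by blast
        from cont[OF x] e2 obtain \<delta>' where \<delta>': "\<delta>' > 0"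
          "\<And>t. dist t (x m) < \<delta>' \<Longrightarrow> dist (q (x(m := t))) (q (x(m := x m))) < e / 2"
          unfolding continuous_at_eps_delta by blast
        obtain t where t: "\<bar>t - x m\<bar> < min \<delta> \<delta>'" "\<bar>t\<bar> < r m" "f (x(m := t)) \<noteq> 0"
          using nz[OF x, of "min \<delta> \<delta>'"] \<delta>(1) \<delta>'(1) by auto
        have "\<bar>q (x(m := t)) - y\<bar> * \<bar>f (x(m := t))\<bar> \<le> e / 2 * \<bar>f (x(m := t))\<bar>"
          using \<delta>(2)[of t] t eq[OF t(2), of y] f'_eq[OF t(2)] by (simp add: abs_mult)
        then have "\<bar>q (x(m := t)) - y\<bar> \<le> e / 2" using t(3) by simp
        moreover have "\<bar>q (x(m := t)) - q x\<bar> < e / 2"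
          using \<delta>'(2)[of t] t(1) by (simp add: dist_real_def)
        ultimately show ?thesis by linarith
      qed
      then have "\<bar>q x - y\<bar> \<le> 0" by (rule field_le_epsilon[of _ 0, simplified])
      then show "y = q x" by simp
    qed
  qed
  then show ?thesis
    unfolding P_def polydisc_eq_real
    by (intro definable_fun_graphI[OF dpred_polydisc d\<Gamma>]) (auto simp: P_def polydisc_eq_real)
qed

section \<open>Weierstrass division from complexification\<close>

text \<open>Regularity is stated by real derivatives, the factorization of \<phi> by complex ones.
  Along the real axis \<phi> has real values, so its derivative there has imaginary part 0 and the
  induction proceeds.\<close>

lemma higher_deriv_of_real:
  assumes hol: "\<phi> holomorphic_on ball 0 \<epsilon>"
    and eq: "\<And>t. \<bar>t\<bar> < \<epsilon> \<Longrightarrow> \<phi> (complex_of_real t) = complex_of_real (h t)"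
  shows "\<bar>t\<bar> < \<epsilon> \<Longrightarrow> (deriv ^^ k) \<phi> (complex_of_real t) = complex_of_real ((deriv ^^ k) h t)"
proof (induction k arbitrary: t)
  case 0
  then show ?case using eq by simp
next
  case (Suc k)
  let ?\<psi> = "(deriv ^^ k) \<phi>" and ?h = "(deriv ^^ k) h"
  define D where "D = deriv ?\<psi> (complex_of_real t)"
  have "?\<psi> holomorphic_on ball 0 \<epsilon>" by (rule holomorphic_higher_deriv[OF hol open_ball])
  then have "(?\<psi> has_field_derivative D) (at (complex_of_real t))"
    unfolding D_def by (rule holomorphic_derivI[OF _ open_ball]) (use Suc.prems in simp)
  then have "((\<lambda>s. ?\<psi> (complex_of_real s)) has_vector_derivative D) (at t)"
    by (rule has_vector_derivative_real_field)
  then have D: "((\<lambda>s. complex_of_real (?h s)) has_vector_derivative D) (at t)"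
    by (rule has_vector_derivative_transform_within_open[where S = "{-\<epsilon><..<\<epsilon>}"])
      (use Suc in auto)
  from bounded_linear.has_vector_derivative[OF bounded_linear_Re D]
  have "(?h has_vector_derivative Re D) (at t)" by simp
  then have "deriv ?h t = Re D"
    by (intro DERIV_imp_deriv) (simp add: has_real_derivative_iff_has_vector_derivative)
  moreover from bounded_linear.has_vector_derivative[OF bounded_linear_Im D]
  have "((\<lambda>s. 0) has_vector_derivative Im D) (at t)" by simp
  then have "Im D = 0" using has_vector_derivative_const vector_derivative_unique_at by blast
  ultimately show ?case by (simp add: D_def[symmetric] complex_eq_iff)
qed

lemma regular_factorization:
  assumes hol: "\<phi> holomorphic_on ball 0 \<epsilon>" and \<epsilon>: "\<epsilon> > 0"
    and eq: "\<And>t. \<bar>t\<bar> < \<epsilon> \<Longrightarrow> \<phi> (complex_of_real t) = complex_of_real (h t)"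
    and reg: "\<forall>k<d. (deriv ^^ k) h 0 = 0" "(deriv ^^ d) h 0 \<noteq> 0"
  shows "\<exists>\<rho>>0. \<exists>u. \<exists>L>0. \<rho> < \<epsilon> \<and> u holomorphic_on ball 0 \<rho> \<and>
    (\<forall>w\<in>ball 0 \<rho>. u w \<noteq> 0 \<and> norm (inverse (u w)) \<le> L \<and> \<phi> w = w ^ d * u w)"
proof -
  have D: "(deriv ^^ k) \<phi> 0 = of_real ((deriv ^^ k) h 0)" for k
    using higher_deriv_of_real[OF hol eq, of 0 k] \<epsilon> by simp
  have "\<exists>s>0. \<exists>u. u holomorphic_on ball 0 s \<and> (\<forall>w\<in>ball 0 s. u w \<noteq> 0 \<and> \<phi> w = w ^ d * u w)"
  \<comment> \<open>The factorization theorem concerns a genuine zero; order 0 is settled by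
    continuity, with \<phi> itself as the unit.\<close>
  proof (cases "d = 0")
    case True
    then have "\<phi> 0 \<noteq> 0" using D[of 0] reg(2) by simp
    moreover have "isCont \<phi> 0"
      using hol \<epsilon> by (meson centre_in_ball continuous_on_eq_continuous_at holomorphic_on_imp_continuous_on open_ball)
    ultimately obtain e where e: "e > 0" "\<And>w. dist w 0 < e \<Longrightarrow> \<phi> w \<noteq> 0"
      using continuous_at_avoid[of 0 \<phi> 0] by (auto simp: dist_commute)
    have "\<phi> holomorphic_on ball 0 (min e \<epsilon>)" by (rule holomorphic_on_subset[OF hol]) auto
    then show ?thesis using e \<epsilon> True by (intro exI[of _ "min e \<epsilon>"] conjI exI[of _ \<phi>]) auto
  next
    case False
    have 0: "\<phi> 0 = 0" using D[of 0] reg(1)[rule_format, of 0] False by simp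
    obtain u s where "0 < s" "u holomorphic_on ball 0 s"
      "\<And>w. w \<in> ball 0 s \<Longrightarrow> \<phi> w - \<phi> 0 = (w - 0) ^ d * u w" "\<And>w. w \<in> ball 0 s \<Longrightarrow> u w \<noteq> 0"
      by (rule holomorphic_factor_order_of_zero[OF hol open_ball, of 0 d]) (use \<epsilon> False D reg in auto)
    then show ?thesis using 0 by (intro exI[of _ s] conjI exI[of _ u]) auto
  qed
  then obtain s u where s: "s > 0" and u: "u holomorphic_on ball 0 s"
    "\<And>w. w \<in> ball 0 s \<Longrightarrow> u w \<noteq> 0" "\<And>w. w \<in> ball 0 s \<Longrightarrow> \<phi> w = w ^ d * u w" by blast
  \<comment> \<open>The closed disc of radius \<rho> is compact in the domain of u, which gives the
    bound L for 1 / u.\<close>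
  define \<rho> where "\<rho> = min s \<epsilon> / 2"
  have \<rho>: "\<rho> > 0" "\<rho> < s" "\<rho> < \<epsilon>" using s \<epsilon> by (auto simp: \<rho>_def)
  have sub: "cball 0 \<rho> \<subseteq> ball 0 s" using \<rho> by auto
  have "continuous_on (cball 0 \<rho>) (\<lambda>w. inverse (u w))"
    using u(1,2) sub by (intro continuous_on_inverse holomorphic_on_imp_continuous_on) (auto elim: holomorphic_on_subset)
  then have "bounded ((\<lambda>w. inverse (u w)) ` cball 0 \<rho>)"
    by (intro compact_imp_bounded compact_continuous_image) auto
  then obtain L where L: "L > 0" "\<And>w. w \<in> cball 0 \<rho> \<Longrightarrow> norm (inverse (u w)) \<le> L"
    unfolding bounded_pos by blast
  have sub': "ball 0 \<rho> \<subseteq> cball (0::complex) \<rho>" "ball 0 \<rho> \<subseteq> ball (0::complex) s" using \<rho> by auto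
  have "\<forall>w\<in>ball 0 \<rho>. u w \<noteq> 0 \<and> norm (inverse (u w)) \<le> L \<and> \<phi> w = w ^ d * u w"
  proof
    fix w :: complex assume "w \<in> ball 0 \<rho>"
    then have "w \<in> cball 0 \<rho>" "w \<in> ball 0 s" using sub' by blast+
    then show "u w \<noteq> 0 \<and> norm (inverse (u w)) \<le> L \<and> \<phi> w = w ^ d * u w" using u(2,3) L(2) by simp
  qed
  with \<rho>(1,3) L(1) holomorphic_on_subset[OF u(1) sub'(2)] show ?thesis
    by (intro exI[of _ \<rho>] exI[of _ u] exI[of _ L] conjI)
qed

text \<open>The first m coordinates are set to 0 one at a time, each at the price of one difference
  quotient. This quantifies how little F(z', w) differs from F(0, w) for small z'.\<close>

lemma norm_diff_zeroed_coords_le: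
  assumes F: "C_diff_on n (polydisc n r) F" "\<And>z. z \<in> polydisc n r \<Longrightarrow> norm (F z) \<le> B" "B > 0"
    and z: "z \<in> polydisc n r" and m: "m \<le> n"
  shows "norm (F z - F (\<lambda>i. if i < m then 0 else z i)) \<le> (\<Sum>i<m. 3 * B / r i * norm (z i))"
  using m
proof (induction m)
  case (Suc m)
  let ?y = "\<lambda>i. if i < m then 0 else z i"
  have y: "?y \<in> polydisc n r"
    using z polydisc_radius_pos[OF z] by (auto simp: polydisc_def tuples_def)
  have upd: "(\<lambda>i. if i < Suc m then 0 else z i) = ?y(m := 0)" by (auto simp: fun_eq_iff)
  have "F ?y - F (?y(m := 0)) = ?y m * diff_quot m F ?y"
    using diff_quot_eq[of F ?y m] by (simp add: algebra_simps)
  moreover have "norm (diff_quot m F ?y) \<le> 3 * B / r m"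
    by (rule diff_quot_bound[OF F(1) _ F(3) y]) (use F(2) Suc.prems in auto)
  ultimately have "norm (F ?y - F (?y(m := 0))) \<le> 3 * B / r m * norm (z m)"
    using mult_left_mono[of "norm (diff_quot m F ?y)" "3 * B / r m" "norm (z m)"]
    by (simp add: norm_mult mult.commute)
  moreover have "norm (F z - F (?y(m := 0))) \<le> norm (F z - F ?y) + norm (F ?y - F (?y(m := 0)))"
    using norm_triangle_ineq[of "F z - F ?y" "F ?y - F (?y(m := 0))"] by simp
  ultimately show ?case using Suc by (simp add: upd)
qed simp

text \<open>The constants are chosen in the classical order: \<rho>, u and L on the axis z' = 0,
  then \<eta> from them, and finally the radius \<delta> of z' from \<eta>.\<close>

lemma Weierstrass_division_if_germs_eq:
  assumes "\<And>n. definable_germs M n \<inter> analytic_germs n = R_analytic_germs M n"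
  shows "Weierstrass_division (\<lambda>n. definable_germs M n \<inter> analytic_germs n)"
  unfolding Weierstrass_division_def
proof (intro allI impI, elim conjE)
  fix m d f g
  assume f0: "germ_at0 (Suc m) f \<in> definable_germs M (Suc m) \<inter> analytic_germs (Suc m)"
    and reg: "regular_of_order m d f"
    and g0: "germ_at0 (Suc m) g \<in> definable_germs M (Suc m) \<inter> analytic_germs (Suc m)"
  let ?c = "\<lambda>x. complex_of_real \<circ> x"
  let ?PC = "\<lambda>s. cube (Suc m) s :: (nat \<Rightarrow> complex) set"
  let ?PR = "\<lambda>s. cube (Suc m) s :: (nat \<Rightarrow> real) set"
  from f0 have "germ_at0 (Suc m) f \<in> R_analytic_germs M (Suc m)" using assms by simp
  from R_analytic_germ_extension[OF this] obtain \<epsilon>1 F BF where \<epsilon>1: "\<epsilon>1 > 0" "BF > 0"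
    "\<And>s. 0 < s \<Longrightarrow> s \<le> \<epsilon>1 \<Longrightarrow> definable_fun M (Suc m) (?PR s) f \<and> definable_cfun M (Suc m) (?PC s) F \<and>
      C_diff_on (Suc m) (?PC s) F \<and> (\<forall>x\<in>?PR s. F (?c x) = complex_of_real (f x)) \<and>
      (\<forall>z\<in>?PC s. norm (F z) \<le> BF)"
    by blast
  from g0 have "germ_at0 (Suc m) g \<in> R_analytic_germs M (Suc m)" using assms by simp
  from R_analytic_germ_extension[OF this] obtain \<epsilon>2 G BG where \<epsilon>2: "\<epsilon>2 > 0" "BG > 0"
    "\<And>s. 0 < s \<Longrightarrow> s \<le> \<epsilon>2 \<Longrightarrow> definable_fun M (Suc m) (?PR s) g \<and> definable_cfun M (Suc m) (?PC s) G \<and>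
      C_diff_on (Suc m) (?PC s) G \<and> (\<forall>x\<in>?PR s. G (?c x) = complex_of_real (g x)) \<and>
      (\<forall>z\<in>?PC s. norm (G z) \<le> BG)"
    by blast
  define \<epsilon> where "\<epsilon> = min \<epsilon>1 \<epsilon>2"
  define B where "B = max BF BG"
  have \<epsilon>: "\<epsilon> > 0" "\<epsilon> \<le> \<epsilon>1" "\<epsilon> \<le> \<epsilon>2" and B: "B > 0" using \<epsilon>1(1,2) \<epsilon>2(1) by (auto simp: \<epsilon>_def B_def)
  from \<epsilon>1(3)[OF \<epsilon>(1,2)] have f: "definable_fun M (Suc m) (?PR \<epsilon>) f"
    and F: "definable_cfun M (Suc m) (?PC \<epsilon>) F" "C_diff_on (Suc m) (?PC \<epsilon>) F"
      "\<And>x. x \<in> ?PR \<epsilon> \<Longrightarrow> F (?c x) = complex_of_real (f x)" "\<And>z. z \<in> ?PC \<epsilon> \<Longrightarrow> norm (F z) \<le> B"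
    unfolding B_def by (simp_all add: le_max_iff_disj)
  from \<epsilon>2(3)[OF \<epsilon>(1,3)] have g: "definable_fun M (Suc m) (?PR \<epsilon>) g"
    and G: "definable_cfun M (Suc m) (?PC \<epsilon>) G" "C_diff_on (Suc m) (?PC \<epsilon>) G"
      "\<And>x. x \<in> ?PR \<epsilon> \<Longrightarrow> G (?c x) = complex_of_real (g x)" "\<And>z. z \<in> ?PC \<epsilon> \<Longrightarrow> norm (G z) \<le> B"
    unfolding B_def by (simp_all add: le_max_iff_disj)
  define \<phi> where "\<phi> w = F ((\<lambda>_. 0)(m := w))" for w
  have "\<phi> holomorphic_on ball 0 \<epsilon>"
    unfolding \<phi>_def
    using C_diff_on_line[OF F(2) zero_mem_polydisc lessI] \<epsilon>(1) by simp
  moreover have "\<phi> (complex_of_real t) = complex_of_real (f ((\<lambda>_. 0)(m := t)))" if "\<bar>t\<bar> < \<epsilon>" for t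
  proof -
    have "(\<lambda>_. 0)(m := complex_of_real t) = ?c ((\<lambda>_. 0)(m := t))" by auto
    moreover have "(\<lambda>_. 0)(m := t) \<in> ?PR \<epsilon>"
      using that \<epsilon>(1) by (auto simp: polydisc_def tuples_def)
    ultimately show ?thesis unfolding \<phi>_def using F(3) by simp
  qed
  ultimately have "\<exists>\<rho>>0. \<exists>u. \<exists>L>0. \<rho> < \<epsilon> \<and> u holomorphic_on ball 0 \<rho> \<and>
    (\<forall>w\<in>ball 0 \<rho>. u w \<noteq> 0 \<and> norm (inverse (u w)) \<le> L \<and> \<phi> w = w ^ d * u w)"
    using reg unfolding regular_of_order_def by (intro regular_factorization[OF _ \<epsilon>(1)]) auto
  then obtain \<rho> u L where \<rho>: "\<rho> > 0" "\<rho> < \<epsilon>" and L: "L > 0" and u: "u holomorphic_on ball 0 \<rho>"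
    "\<And>w. w \<in> ball 0 \<rho> \<Longrightarrow> u w \<noteq> 0" "\<And>w. w \<in> ball 0 \<rho> \<Longrightarrow> norm (inverse (u w)) \<le> L"
    "\<And>w. w \<in> ball 0 \<rho> \<Longrightarrow> \<phi> w = w ^ d * u w" by blast
  define \<eta> where "\<eta> = 1 / (2 * (L * (3 / \<rho>) ^ d))"
  have pos: "L * (3 / \<rho>) ^ d > 0" using L \<rho>(1) by simp
  then have \<eta>: "\<eta> > 0" "L * (3 / \<rho>) ^ d * \<eta> \<le> 1 / 2" unfolding \<eta>_def by simp_all
  interpret dv: perturbed_divisor d \<rho> L \<eta> u
    by unfold_locales (use \<rho> L \<eta> u in auto)
  define c where "c = real m * (3 * B / \<epsilon>)"
  have c: "c \<ge> 0" using B \<epsilon>(1) by (simp add: c_def)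
  \<comment> \<open>c bounds the change of F per unit of z'; c + 1 avoids division by 0, as c = 0
    for m = 0.\<close>
  define \<delta> where "\<delta> = min \<epsilon> (\<eta> / (c + 1))"
  have \<delta>: "\<delta> > 0" "\<delta> \<le> \<epsilon>" "c * \<delta> \<le> \<eta>"
  proof -
    show "\<delta> > 0" using \<epsilon>(1) \<eta>(1) c by (simp add: \<delta>_def)
    show "\<delta> \<le> \<epsilon>" by (simp add: \<delta>_def)
    have "c * \<delta> \<le> c * (\<eta> / (c + 1))" using c by (intro mult_left_mono) (auto simp: \<delta>_def)
    also have "\<dots> \<le> \<eta>" using c \<eta>(1) by (simp add: field_simps)
    finally show "c * \<delta> \<le> \<eta>" .
  qed
  \<comment> \<open>Small radii \<delta> for the first m variables, while the distinguished one
    keeps \<rho>.\<close>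
  define r where "r i = (if i < m then \<delta> else \<rho>)" for i
  have r: "r m = \<rho>" "\<And>i. r i > 0" "\<And>i. r i \<le> \<epsilon>" using \<rho> \<delta> by (auto simp: r_def)
  let ?P = "polydisc (Suc m) r :: (nat \<Rightarrow> complex) set" and ?Q = "polydisc (Suc m) r :: (nat \<Rightarrow> real) set"
  have sub: "?P \<subseteq> ?PC \<epsilon>" "?Q \<subseteq> ?PR \<epsilon>" using r(3) by (auto intro!: polydisc_mono)
  have cQ: "?c x \<in> ?P" if "x \<in> ?Q" for x using that by (auto simp: polydisc_def tuples_def)
  have zm: "z m \<in> ball 0 \<rho>" if "z \<in> ?P" for z using that r(1) by (auto simp: polydisc_def)
  define \<Delta> where "\<Delta> z = F z - z m ^ d * u (z m)" for z
  have F\<Delta>: "F z = z m ^ d * u (z m) + \<Delta> z" for z by (simp add: \<Delta>_def)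
  have FP: "C_diff_on (Suc m) ?P F" by (rule C_diff_on_subset[OF F(2) sub(1)])
  have \<Delta>1: "C_diff_on (Suc m) ?P \<Delta>"
    unfolding \<Delta>_def
    by (intro C_diff_on_diff C_diff_on_mult C_diff_on_power C_diff_on_coord
        FP C_diff_on_holomorphic_coord[OF u(1) open_ball] zm)
  have \<Delta>2: "norm (\<Delta> z) \<le> \<eta>" if z: "z \<in> ?P" for z
  proof -
    \<comment> \<open>On the axis F equals w ^ d u(w), so \<Delta> is the difference of F at z and
      at its projection to the axis.\<close>
    have "(\<lambda>i. if i < m then 0 else z i) = (\<lambda>_. 0)(m := z m)"
      using z by (auto simp: fun_eq_iff polydisc_def tuples_def)
    then have "\<Delta> z = F z - F (\<lambda>i. if i < m then 0 else z i)"
      using u(4)[OF zm[OF z]] by (simp add: \<Delta>_def \<phi>_def)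
    also have "norm \<dots> \<le> (\<Sum>i<m. 3 * B / \<epsilon> * norm (z i))"
      by (rule norm_diff_zeroed_coords_le[OF F(2) _ B]) (use F(4) sub z in auto)
    also have "\<dots> \<le> (\<Sum>i<m. 3 * B / \<epsilon> * \<delta>)"
    proof (intro sum_mono mult_left_mono)
      fix i assume "i \<in> {..<m}"
      then have "norm (z i) < r i" using z by (simp add: polydisc_def)
      with \<open>i \<in> {..<m}\<close> show "norm (z i) \<le> \<delta>" by (simp add: r_def)
    qed (use B \<epsilon>(1) in auto)
    also have "\<dots> = c * \<delta>" by (simp add: c_def)
    finally show ?thesis using \<delta>(3) by linarith
  qed
  have "\<exists>Q R. C_diff_on (Suc m) ?P Q \<and> (\<exists>C. \<forall>z\<in>?P. norm (Q z) \<le> C) \<and>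
    (\<forall>k<d. C_diff_on m (polydisc m r) (R k)) \<and>
    (\<forall>z\<in>?P. G z = Q z * (z m ^ d * u (z m) + \<Delta> z) + (\<Sum>k<d. R k (z(m := 0)) * z m ^ k))"
    by (rule dv.division[OF r(1) r(2) C_diff_on_subset[OF G(2) sub(1)] _ B \<Delta>1 \<Delta>2])
      (use G(4) sub(1) in blast)
  then obtain Q R C where Q: "C_diff_on (Suc m) ?P Q" "\<forall>z\<in>?P. norm (Q z) \<le> C"
    and R: "\<forall>k<d. C_diff_on m (polydisc m r) (R k)"
    and div0: "\<forall>z\<in>?P. G z = Q z * (z m ^ d * u (z m) + \<Delta> z) + (\<Sum>k<d. R k (z(m := 0)) * z m ^ k)"
    by (elim exE conjE)
  have div: "G z = Q z * F z + (\<Sum>k<d. R k (z(m := 0)) * z m ^ k)" if "z \<in> ?P" for z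
    using div0 that F\<Delta>[of z] by simp
  \<comment> \<open>F and G are real at real points, so the real part of the complex identity is a
    division with real quotient and remainder.\<close>
  define q where "q x = Re (Q (?c x))" for x
  define R' where "R' k x = Re (R k (?c x))" for k x
  have div': "g x = q x * f x + (\<Sum>k<d. R' k (x(m := 0)) * x m ^ k)" if x: "x \<in> ?Q" for x
  proof -
    have "x \<in> ?PR \<epsilon>" using x sub(2) by blast
    then have FG: "F (?c x) = of_real (f x)" "G (?c x) = of_real (g x)" using F(3) G(3) by auto
    have c0: "(?c x)(m := 0) = ?c (x(m := 0))" by auto
    have "of_real (g x) = Q (?c x) * of_real (f x) + (\<Sum>k<d. R k (?c (x(m := 0))) * of_real (x m ^ k))"
      using div[OF cQ[OF x]] unfolding FG c0 by simp
    then have "Re (of_real (g x)) = Re (Q (?c x) * of_real (f x) + (\<Sum>k<d. R k (?c (x(m := 0))) * of_real (x m ^ k)))"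
      by (rule arg_cong)
    then show ?thesis by (simp add: q_def R'_def)
  qed
  have fQ: "definable_fun M (Suc m) ?Q f" "definable_fun M (Suc m) ?Q g"
    using definable_fun_restrict[OF f sub(2)] definable_fun_restrict[OF g sub(2)] by blast+
  have R'_def': "definable_fun M m (polydisc m r) (R' k)" if "k < d" for k
    unfolding R'_def
    by (rule dv.definable_remainder[OF F(1) G(1) sub(1) r(1) \<Delta>1 \<Delta>2 F\<Delta> div _ that]) (use Q(2) in auto)
  have line: "(\<lambda>w. K ((?c x)(m := w))) holomorphic_on ball 0 \<rho>" if "C_diff_on (Suc m) ?P K" "x \<in> ?Q" for K x
    using C_diff_on_line[OF that(1) cQ[OF that(2)] lessI] by (simp add: r(1))
  have xm: "\<bar>x m\<bar> < \<rho>" if "x \<in> ?Q" for x using that r(1) by (auto simp: polydisc_def)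
  have c_upd: "?c (x(m := t)) = (?c x)(m := of_real t)" for x t by auto
  have q_def': "definable_fun M (Suc m) ?Q q"
  proof (rule definable_quotient[OF fQ R'_def' div'])
    show "isCont (\<lambda>t. q (x(m := t))) (x m)" if x: "x \<in> ?Q" for x
    proof -
      have "isCont (\<lambda>w. Q ((?c x)(m := w))) (of_real (x m))"
        using holomorphic_on_imp_continuous_on[OF line[OF Q(1) x]] xm[OF x]
        by (simp add: continuous_on_eq_continuous_at)
      then have "isCont (\<lambda>t. Q ((?c x)(m := of_real t))) (x m)"
        using isCont_o2[of "x m" complex_of_real "\<lambda>w. Q ((?c x)(m := w))"] by simp
      then show ?thesis unfolding q_def c_upd by (rule isCont_Re)
    qed
    fix x :: "nat \<Rightarrow> real" and e :: real assume x: "x \<in> ?Q" and e: "e > 0"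
    show "\<exists>t. \<bar>t - x m\<bar> < e \<and> \<bar>t\<bar> < r m \<and> f (x(m := t)) \<noteq> 0"
    \<comment> \<open>If f vanished on a whole real interval of this line, F would vanish on the
      complex disc by the identity theorem, contrary to \<open>divisor_nonzero\<close> at \<rho> /
      2.\<close>
    proof (rule ccontr)
      assume no: "\<nexists>t. \<bar>t - x m\<bar> < e \<and> \<bar>t\<bar> < r m \<and> f (x(m := t)) \<noteq> 0"
      let ?E = "\<lambda>w. F ((?c x)(m := w))"
      let ?U = "{t. \<bar>t - x m\<bar> < e \<and> \<bar>t\<bar> < \<rho>}"
      have upd: "x(m := t) \<in> ?Q" if "\<bar>t\<bar> < \<rho>" for t
        using polydisc_upd[OF x lessI] that r(1) by simp
      have zero: "?E (of_real t) = 0" if "t \<in> ?U" for t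
      proof -
        have "f (x(m := t)) = 0" using no that r(1) by auto
        moreover have "x(m := t) \<in> ?PR \<epsilon>" using upd that sub(2) by blast
        ultimately show ?thesis using F(3) unfolding c_upd[symmetric] by simp
      qed
      have half: "complex_of_real (\<rho> / 2) \<in> ball 0 \<rho>" using \<rho>(1) by simp
      have "?E (of_real (\<rho> / 2)) = 0"
      proof (rule analytic_continuation[OF line[OF FP x] open_ball connected_ball _ _ _ _ half])
        show "complex_of_real ` ?U \<subseteq> ball 0 \<rho>" by auto
        show "complex_of_real (x m) \<in> ball 0 \<rho>" using xm[OF x] by simp
        show "complex_of_real (x m) islimpt complex_of_real ` ?U"
          unfolding islimpt_approachable
        proof (intro allI impI)
          fix e' :: real assume "e' > 0"
          define s where "s = min (min e e') (\<rho> - \<bar>x m\<bar>) / 2"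
          have s: "s > 0" "s < e" "s < e'" "s < \<rho> - \<bar>x m\<bar>"
            using e \<open>e' > 0\<close> xm[OF x] by (auto simp: s_def)
          then have "x m + s \<in> ?U" by auto
          moreover have "dist (complex_of_real (x m + s)) (complex_of_real (x m)) < e'"
            using s by (simp add: dist_norm)
          moreover have "complex_of_real (x m + s) \<noteq> complex_of_real (x m)" using s(1) by simp
          ultimately show "\<exists>w\<in>complex_of_real ` ?U. w \<noteq> complex_of_real (x m) \<and> dist w (complex_of_real (x m)) < e'"
            by blast
        qed
      qed (use zero in auto)
      moreover have "(?c x)(m := of_real (\<rho> / 2)) \<in> ?P"
        using cQ[OF upd[of "\<rho> / 2"]] \<rho>(1) unfolding c_upd by simp
      from dv.divisor_nonzero[OF \<Delta>2[OF this]]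
      have "?E (of_real (\<rho> / 2)) \<noteq> 0" unfolding F\<Delta>[of "(?c x)(m := of_real (\<rho> / 2))"] by simp
      ultimately show False by blast
    qed
  qed
  have nbhd: "open_nbhd0 (Suc m) ?Q" "open_nbhd0 m (polydisc m r)"
    unfolding open_nbhd0_def by (auto intro: open_in_space_polydisc zero_mem_polydisc r(2))
  have "germ_at0 (Suc m) q \<in> definable_germs M (Suc m)"
    unfolding definable_germs_def using nbhd(1) q_def' by blast
  moreover have "germ_at0 (Suc m) q \<in> analytic_germs (Suc m)"
    by (rule analytic_germ_if_holomorphic_extension[OF r(2) Q(1)]) (simp add: q_def)
  moreover have "germ_at0 m (R' k) \<in> definable_germs M m" if "k < d" for k
    unfolding definable_germs_def using nbhd(2) R'_def'[OF that] by blast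
  moreover have "germ_at0 m (R' k) \<in> analytic_germs m" if "k < d" for k
    by (rule analytic_germ_if_holomorphic_extension[OF r(2)]) (use R that in \<open>auto simp: R'_def\<close>)
  moreover have "germ_at0 (Suc m) g = germ_at0 (Suc m) (\<lambda>x. q x * f x + (\<Sum>k<d. R' k (x(m := 0)) * x m ^ k))"
    unfolding germ_at0_eq_iff using nbhd(1) div' by blast
  ultimately show "\<exists>q r. germ_at0 (Suc m) q \<in> definable_germs M (Suc m) \<inter> analytic_germs (Suc m) \<and>
      (\<forall>k<d. germ_at0 m (r k) \<in> definable_germs M m \<inter> analytic_germs m) \<and>
      germ_at0 (Suc m) g = germ_at0 (Suc m) (\<lambda>x. q x * f x + (\<Sum>k<d. r k (x(m := 0)) * x m ^ k))"
    by (intro exI[of _ q] exI[of _ R'] conjI allI impI IntI) simp_all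
qed

theorem theorem2p4:
  fixes M :: "('f, 'r) expansion_of_reals"
  assumes "o_minimal M"
  shows "(has_complexification M \<longleftrightarrow>
            (\<forall>n. definable_germs M n \<inter> analytic_germs n = R_analytic_germs M n)) \<and>
         ((\<forall>n. definable_germs M n \<inter> analytic_germs n = R_analytic_germs M n) \<longleftrightarrow>
            Weierstrass_division (\<lambda>n. definable_germs M n \<inter> analytic_germs n))"
  using germs_eq_if_complexification complexification_if_germs_eq
    germs_eq_if_Weierstrass_division Weierstrass_division_if_germs_eq by blast

end
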